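(* Let $\{F_v\}_{v\in\mathcal{V}}$ be a family of graph-directed self-similar sets in $[0,1]$, with associated directed graph $\Gamma=(\mathcal{V},\mathcal{E})$ and similarities $\{S_e\}_{e\in\mathcal{E}}$, with common Hausdorff dimension $s<1$. Then: 1. If the graph-directed weak separation property (GDWSP) is satisfied, then for all $v\in\mathcal{V}$ we have $\mathcal{H}^s(F_v)>0$ and $\dim_{\mathrm{A}}F_v=\dim_{\mathrm{H}}F_v=s<1$. 2. If the GDWSP is not satisfied, then for all $v\in\mathcal{V}$ we have $\mathcal{H}^s(F_v)=0$ and $\dim_{\mathrm{A}}F_v=1$.
   Context: Let $\Gamma=(\mathcal{V},\mathcal{E})$ be a finite connected directed graph (connected in the directed sense: there is a directed path from any vertex to any vertex), with finite vertex set $\mathcal{V}$ and finite edge set $\mathcal{E}$, each edge starting and ending at a vertex; there may be multiple edges connecting a particular pair of vertices. To each $e\in\mathcal{E}$ is associated a contracting similarity $S_e:\mathbb{R}\to\mathbb{R}$ with contraction ratio $c_e\in(0,1)$, and it is assumed that $S_e([0,1])\subseteq[0,1]$. For $u,v\in\mathcal{V}$, $\mathcal{E}_{u,v}\subseteq\mathcal{E}$ is the set of edges from $u$ to $v$. The family of graph-directed self-similar sets is the unique tuple $\{F_v\}_{v\in\mathcal{V}}$ of non-empty compact subsets of $[0,1]$ with $$F_v=\bigcup_{u\in\mathcal{V}}\bigcup_{e\in\mathcal{E}_{u,v}}S_e(F_u)\qquad(v\in\mathcal{V}).$$ Since $\Gamma$ is connected, all the sets $F_v$ have the same Hausdorff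 dimension. Let $\mathcal{E}^*_{u,v}$ be the set of all finite directed paths in the graph going from $u$ to $v$; for a path $\mathbf{e}\in\mathcal{E}^*_{u,v}$, $S_{\mathbf{e}}$ is the similarity obtained by composing the maps of the edges of $\mathbf{e}$ in the appropriate order, that is, the order for which $S_{\mathbf{e}}(F_u)\subseteq F_v$ (for $\mathbf{e}$ traversing $e_1,\dots,e_n$ in this order, $S_{\mathbf{e}}=S_{e_n}\circ\cdots\circ S_{e_1}$). Put $\mathcal{F}_{u,v}=\{S_{\mathbf{e}}^{-1}\circ S_{\mathbf{f}}:\mathbf{e},\mathbf{f}\in\mathcal{E}^*_{u,v}\}$. The graph $\Gamma$ and associated mappings satisfy the GDWSP if for any (or equivalently all) $v\in\mathcal{V}$ the identity is an isolated point of $\mathcal{F}_{v,v}$ in the topology of pointwise convergence. $\dim_{\mathrm{H}}$ is Hausdorff dimension and $\mathcal{H}^s$ is $s$-dimensional Hausdorff measure. For a non-empty set $E\subseteq\mathbb{R}^d$ and $r>0$, $N_r(E)$ is the smallest number of open sets of diameter at most $r$ needed to cover $E$. The Assouad dimension of a non-empty set $F\subseteq\mathbb{R}^d$ is $$\dim_{\mathrm{A}}F=\inf\Big\{t\ge 0:\ (\exists C>0)(\forall R>0)(\forall r\in(0,R))(\forall x\in F)\ N_r(B(x,R)\cap F)\le C\Big(\frac{R}{r}\Big)^t\Big\},$$ where $B(x,R)$ is the open Euclidean ball centred at $x$ with radius $R$.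
   Formalization: Part 2 additionally assumes that some F_v is not a single point; without this it is false: for one vertex with loops x/2 and x/3, F={0}, s=0, the GDWSP fails, but H^0(F)=1 and dim_A F=0. *)

theory Defs
  imports "HOL-Analysis.Analysis" "Graph_Theory.Digraph_Component"
begin

section \<open>Hausdorff measure and Hausdorff dimension\<close>

text \<open>
  The summand is the \<open>s\<close>-th power of the diameter. The case \<open>s = 0\<close> is separated because
  \<open>0 powr 0 = 0\<close> in HOL, whereas a one-point set has to contribute \<open>1\<close> to \<open>\<H>\<^sup>0\<close>.
\<close>

definition diam_pow :: "real \<Rightarrow> 'a::metric_space set \<Rightarrow> ennreal" where
  "diam_pow s U = (if U = {} then 0 else if s = 0 then 1 else ennreal (diameter U powr s))"

text \<open>
  \<^const>\<open>diameter\<close> has no meaningful value on unbounded sets, so boundedness is required explicitly,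
  here and in the covering numbers below. Finite covers are included, by padding with the empty set.
\<close>

definition hausdorff_premeasure :: "real \<Rightarrow> real \<Rightarrow> 'a::metric_space set \<Rightarrow> ennreal" where
  "hausdorff_premeasure s \<delta> E =
    (INF U \<in> {U :: nat \<Rightarrow> 'a set. E \<subseteq> (\<Union>i. U i) \<and> (\<forall>i. bounded (U i) \<and> diameter (U i) \<le> \<delta>)}.
       \<Sum>i. diam_pow s (U i))"

definition hausdorff_measure :: "real \<Rightarrow> 'a::metric_space set \<Rightarrow> ennreal" where
  "hausdorff_measure s E = (SUP \<delta> \<in> {0<..}. hausdorff_premeasure s \<delta> E)"

text \<open>
  In a Euclidean space every \<open>s > DIM('a)\<close> belongs to the set below, so the infimum of reals is
  taken over a non-empty set.
\<close>

definition hausdorff_dim :: "'a::euclidean_space set \<Rightarrow> real" where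
  "hausdorff_dim E = Inf {s. 0 \<le> s \<and> hausdorff_measure s E = 0}"


section \<open>Assouad dimension\<close>

text \<open>Only used for bounded \<open>E\<close> in Euclidean space and \<open>r > 0\<close>, where finite covers exist.\<close>

definition covering_number :: "real \<Rightarrow> 'a::euclidean_space set \<Rightarrow> nat" where
  "covering_number r E =
    (LEAST n. \<exists>\<U>. finite \<U> \<and> card \<U> = n \<and> E \<subseteq> \<Union>\<U> \<and>
       (\<forall>U\<in>\<U>. open U \<and> bounded U \<and> diameter U \<le> r))"

definition assouad_dim :: "'a::euclidean_space set \<Rightarrow> real" where
  "assouad_dim F =
    Inf {t. 0 \<le> t \<and> (\<exists>C>0. \<forall>R>0. \<forall>r\<in>{0<..<R}. \<forall>x\<in>F.
       real (covering_number r (ball x R \<inter> F)) \<le> C * (R / r) powr t)}"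


section \<open>Graph-directed self-similar sets\<close>

locale graph_directed_system = fin_digraph G
  for G :: "('v, 'e) pre_digraph" (structure) +
  fixes S :: "'e \<Rightarrow> real \<Rightarrow> real" and c :: "'e \<Rightarrow> real"
  assumes strongly_connected: "strongly_connected G"
    and ratio: "e \<in> arcs G \<Longrightarrow> 0 < c e \<and> c e < 1"
    and similarity: "e \<in> arcs G \<Longrightarrow> dist (S e x) (S e y) = c e * dist x y"
    and maps_unit_interval: "e \<in> arcs G \<Longrightarrow> S e ` {0..1} \<subseteq> {0..1}"

definition arcs_from_to :: "('v, 'e) pre_digraph \<Rightarrow> 'v \<Rightarrow> 'v \<Rightarrow> 'e set" where
  "arcs_from_to G u v = {e \<in> arcs G. tail G e = u \<and> head G e = v}"

definition graph_directed_sets ::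
    "('v, 'e) pre_digraph \<Rightarrow> ('e \<Rightarrow> real \<Rightarrow> real) \<Rightarrow> ('v \<Rightarrow> real set) \<Rightarrow> bool" where
  "graph_directed_sets G S F \<longleftrightarrow>
    (\<forall>v\<in>verts G. F v \<noteq> {} \<and> compact (F v) \<and> F v \<subseteq> {0..1} \<and>
       F v = (\<Union>u\<in>verts G. \<Union>e\<in>arcs_from_to G u v. S e ` F u))"

text \<open>
  The path \<open>[e\<^sub>1, \<dots>, e\<^sub>n]\<close> is sent to \<open>S e\<^sub>n \<circ> \<dots> \<circ> S e\<^sub>1\<close>, the first edge acting first.
  \<open>awalk u p v\<close> allows \<open>p = []\<close> when \<open>u = v\<close>; its map is the identity.
\<close>

definition path_map :: "('e \<Rightarrow> real \<Rightarrow> real) \<Rightarrow> 'e list \<Rightarrow> real \<Rightarrow> real" where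
  "path_map S p = fold S p"

definition relative_maps ::
    "('v, 'e) pre_digraph \<Rightarrow> ('e \<Rightarrow> real \<Rightarrow> real) \<Rightarrow> 'v \<Rightarrow> 'v \<Rightarrow> (real \<Rightarrow> real) set" where
  "relative_maps G S u v =
    {inv (path_map S p) \<circ> path_map S q | p q.
       pre_digraph.awalk G u p v \<and> pre_digraph.awalk G u q v}"

text \<open>
  The topology on \<^typ>\<open>real \<Rightarrow> real\<close> used by \<open>isolated_in\<close> is the product topology, i.e. that of
  pointwise convergence.
\<close>

definition gdwsp :: "('v, 'e) pre_digraph \<Rightarrow> ('e \<Rightarrow> real \<Rightarrow> real) \<Rightarrow> bool" where
  "gdwsp G S \<longleftrightarrow> (\<forall>v\<in>verts G. id isolated_in relative_maps G S v v)"

text \<open>It is equivalent to require the condition at a single vertex.\<close>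

lemma real_similarity_bij:
  fixes f :: "real \<Rightarrow> real"
  assumes "0 < k" and f: "\<And>x y. dist (f x) (f y) = k * dist x y"
  shows "bij f"
proof (rule bijI)
  show "inj f"
  proof (rule injI)
    fix x y assume "f x = f y"
    then show "x = y" using f[of x y] \<open>0 < k\<close> by simp
  qed
  have d: "\<bar>f x - f y\<bar> = k * \<bar>x - y\<bar>" for x y
    using f by (simp add: dist_real_def)
  show "surj f"
    unfolding surj_def
  proof
    fix y
    define t where "t = (y - f 0) / k"
    have kt: "k * t = y - f 0" "k * \<bar>t\<bar> = \<bar>y - f 0\<bar>"
      using \<open>0 < k\<close> by (auto simp: t_def abs_div)
    have "\<bar>f t - f 0\<bar> = \<bar>y - f 0\<bar>" "\<bar>f (-t) - f 0\<bar> = \<bar>y - f 0\<bar>"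
      using d[of t 0] d[of "-t" 0] kt(2) by simp_all
    moreover have "\<bar>f t - f (-t)\<bar> = 2 * \<bar>y - f 0\<bar>"
      using d[of t "-t"] kt(2) by (simp add: abs_mult)
    ultimately have "f t = y \<or> f (-t) = y" by (smt (verit))
    then show "\<exists>x. y = f x" by auto
  qed
qed

context graph_directed_system
begin

lemma path_map_similarity:
  assumes "set p \<subseteq> arcs G"
  shows "\<exists>k>0. \<forall>x y. dist (path_map S p x) (path_map S p y) = k * dist x y"
  using assms
proof (induction p)
  case Nil
  then show ?case by (auto simp: path_map_def intro: exI[of _ 1])
next
  case (Cons e p)
  then obtain k where "k > 0" "\<And>x y. dist (path_map S p x) (path_map S p y) = k * dist x y"
    by auto
  then show ?case
    using ratio[of e] similarity[of e] Cons.prems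
    by (intro exI[of _ "k * c e"]) (auto simp: path_map_def)
qed

lemma bij_path_map:
  assumes "set p \<subseteq> arcs G"
  shows "bij (path_map S p)"
  using path_map_similarity[OF assms] real_similarity_bij by metis

lemma continuous_inv_path_map:
  assumes "set p \<subseteq> arcs G"
  shows "continuous_on UNIV (inv (path_map S p))"
proof -
  obtain k where k: "k > 0" "\<And>x y. dist (path_map S p x) (path_map S p y) = k * dist x y"
    using path_map_similarity[OF assms] by auto
  have "dist (inv (path_map S p) x) (inv (path_map S p) y) = (1 / k) * dist x y" for x y
    using k(1) k(2)[of "inv (path_map S p) x" "inv (path_map S p) y"] bij_path_map[OF assms]
    by (simp add: bij_is_surj surj_f_inv_f)
  then have "(1 / k)-lipschitz_on UNIV (inv (path_map S p))"
    using k(1) by (auto intro!: lipschitz_onI)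
  then show ?thesis by (rule lipschitz_on_continuous_on)
qed

lemma isolated_transfer:
  assumes "u \<in> verts G" "v \<in> verts G" and iso: "id isolated_in relative_maps G S v v"
  shows "id isolated_in relative_maps G S u u"
proof -
  have "u \<rightarrow>\<^sup>*\<^bsub>G\<^esub> v" "v \<rightarrow>\<^sup>*\<^bsub>G\<^esub> u"
    using strongly_connected assms(1,2) by (auto simp: strongly_connected_def)
  then obtain p q where p: "awalk u p v" and q: "awalk v q u"
    by (auto simp: reachable_awalk)
  let ?Q = "path_map S q"
  define \<Phi> where "\<Phi> g = inv ?Q \<circ> g \<circ> ?Q" for g
  have sub: "set p \<subseteq> arcs G" "set q \<subseteq> arcs G" using p q by (auto simp: awalk_def)
  note bQ = bij_path_map[OF sub(2)] and bP = bij_path_map[OF sub(1)]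
  from iso obtain T where T: "open T" "T \<inter> relative_maps G S v v = {id}"
    by (auto simp: isolated_in_def)
  have cont: "continuous_on UNIV \<Phi>"
  proof (rule continuous_on_coordinatewise_then_product)
    fix x
    have "continuous_on UNIV (\<lambda>g. inv ?Q (g (?Q x)))"
      using continuous_inv_path_map[OF sub(2)]
      by (rule continuous_on_compose2) (auto intro: continuous_on_product_coordinates)
    then show "continuous_on UNIV (\<lambda>g. \<Phi> g x)" by (simp add: \<Phi>_def)
  qed
  have "\<Phi> g \<in> relative_maps G S v v" if "g \<in> relative_maps G S u u" for g
  proof -
    from that obtain e f where ef: "awalk u e u" "awalk u f u"
      and g: "g = inv (path_map S e) \<circ> path_map S f"
      by (auto simp: relative_maps_def)
    have w: "awalk v (q @ e @ p) v" "awalk v (q @ f @ p) v"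
      using ef p q by auto
    have be: "bij (path_map S e)" using ef(1) by (intro bij_path_map) (auto simp: awalk_def)
    have comp: "path_map S (q @ r @ p) = path_map S p \<circ> (path_map S r \<circ> ?Q)" for r
      by (auto simp: path_map_def)
    have "inv (path_map S (q @ e @ p)) = (inv ?Q \<circ> inv (path_map S e)) \<circ> inv (path_map S p)"
      using be bP bQ by (simp add: comp o_inv_distrib bij_comp)
    then have "inv (path_map S (q @ e @ p)) \<circ> path_map S (q @ f @ p) = \<Phi> g"
      by (simp add: comp \<Phi>_def g fun_eq_iff inv_f_f[OF bij_is_inj[OF bP]])
    then show ?thesis
      unfolding relative_maps_def using w
      by (intro CollectI exI[of _ "q @ e @ p"] exI[of _ "q @ f @ p"]) simp
  qed
  moreover have "g = id" if "\<Phi> g = id" for g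
  proof
    fix x
    have "inv ?Q (g (?Q (inv ?Q x))) = inv ?Q x"
      using fun_cong[OF that, of "inv ?Q x"] by (simp add: \<Phi>_def)
    then show "g x = id x"
      by (simp add: bij_is_surj[OF bQ] surj_f_inv_f inj_eq[OF bij_is_inj[OF bij_imp_bij_inv[OF bQ]]])
  qed
  moreover have "\<Phi> id = id"
    using bQ by (simp add: \<Phi>_def bij_is_inj)
  moreover have id_in: "id \<in> relative_maps G S u u"
    unfolding relative_maps_def using assms(1)
    by (intro CollectI exI[of _ "[]"]) (simp add: path_map_def awalk_def)
  ultimately have "\<Phi> -` T \<inter> relative_maps G S u u = {id}"
    using T(2) by blast
  moreover have "open (\<Phi> -` T)"
    using cont T(1) by (simp add: continuous_on_open_vimage)
  ultimately show ?thesis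
    unfolding isolated_in_def using id_in by blast
qed

lemma gdwsp_iff_at_vertex:
  assumes "w \<in> verts G"
  shows "gdwsp G S \<longleftrightarrow> id isolated_in relative_maps G S w w"
  unfolding gdwsp_def using isolated_transfer assms by blast

end

end

theory Submission
  imports Defs
begin

text \<open>
  Write \<open>ratio\<close> for the contraction ratio of a path map. Everything rests on a packing bound: if loop
  maps at a vertex \<open>v\<close> send \<open>[0,1]\<close> to pairwise disjoint intervals, their ratios satisfy
  \<open>\<Sum> ratio\<^sup>s \<le> 1\<close> (lemma \<open>packing\<close>). If the sum were larger, it would still exceed \<open>1\<close> for some \<open>t > s\<close>,
  and the disjoint copies of \<open>F\<^sub>v\<close> inside \<open>F\<^sub>v\<close> would keep the \<open>t\<close>-sums of all covers of \<open>F\<^sub>v\<close> away from \<open>0\<close>,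
  although \<open>t\<close> is larger than the dimension. As a consequence a \<open>\<delta>\<close>-separated subset of \<open>F\<^sub>v\<close> has
  \<open>O(\<delta>\<^sup>-\<^sup>s)\<close> points.
  
  Suppose the separation property fails. Then there are loop maps \<open>T\<close>, \<open>U\<close> with \<open>T\<^sup>-\<^sup>1 \<circ> U\<close> close to the
  identity, but different from it. Precomposing both with the same contraction magnifies the
  displacement \<open>T\<^sup>-\<^sup>1 (U x) - x\<close>, so it can be given any prescribed small size on all of \<open>[0,1]\<close>, up to a
  constant factor (\<open>uniform_displacement\<close>). If \<open>Y \<subseteq> F\<^sub>v\<close> is a finite set with gaps of about that size,
  then \<open>T Y\<close> together with one endpoint taken from \<open>U Y\<close> is a similar set with one more point. So \<open>F\<^sub>v\<close> contains
  arbitrarily long approximate arithmetic progressions (\<open>near_progressions\<close>), which forces the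
  Assouad dimension up to \<open>1\<close>. Because \<open>s < 1\<close>, small pieces placed along a long progression give an
  interval \<open>J\<close> in which disjoint pieces have \<open>\<Sum> ratio\<^sup>s\<close> much larger than \<open>\<bar>J\<bar>\<^sup>s\<close> (\<open>dense_clusters\<close>).
  Take disjoint copies of \<open>J\<close> under loop maps whose total \<open>\<Sum> ratio\<^sup>s\<close> is nearly maximal. By the packing bound
  the copies are a cheap cover of the part of \<open>F\<^sub>v\<close> they meet; by maximality only a small packing fits
  into the rest, so the rest is cheap to cover as well. Hence \<open>F\<^sub>v\<close> has measure zero
  (\<open>small_covers_at_dimension\<close>).
  
  Suppose the separation property holds. The maps of size about \<open>r\<close> with image near a given point fall
  into boundedly many classes of almost equal maps, and almost equal maps are equal. Hence the part of
  \<open>F\<^sub>v\<close> in a ball of radius \<open>r\<close> is covered by a bounded number of pieces of ratio at most \<open>r\<close>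
  (\<open>finitely_many_pieces\<close>). With the counting bound this gives \<open>s\<close> as an upper bound for the Assouad
  dimension. If \<open>F\<^sub>v\<close> had measure zero, replacing the balls of a very cheap cover by pieces would exhibit
  every \<open>F\<^sub>v\<close> as a finite union of pieces with \<open>\<Sum> ratio\<^sup>s < 1\<close>. Then \<open>\<Sum> ratio\<^sup>t < 1\<close> for some \<open>t < s\<close>, and
  iterating this cover shows that the dimension is at most \<open>t\<close>, a contradiction (\<open>hausdorff_measure_pos\<close>).
\<close>

section \<open>Similarities of the real line\<close>

definition similarity :: "(real \<Rightarrow> real) \<Rightarrow> bool" where
  "similarity T \<longleftrightarrow> (\<exists>a b. a \<noteq> 0 \<and> T = (\<lambda>x. a * x + b))"

definition scaling :: "(real \<Rightarrow> real) \<Rightarrow> real" where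
  "scaling T = \<bar>T 1 - T 0\<bar>"

text \<open>
  The squared distances of \<open>f x\<close> to \<open>f 0\<close> and to \<open>f 1\<close> differ by an expression linear in \<open>f x\<close>, which
  determines \<open>f x\<close>.
\<close>

lemma similarity_of_dist:
  fixes f :: "real \<Rightarrow> real"
  assumes "0 < k" and f: "\<And>x y. dist (f x) (f y) = k * dist x y"
  shows "similarity f" "scaling f = k"
proof -
  have d: "\<bar>f x - f y\<bar> = k * \<bar>x - y\<bar>" for x y
    using f by (simp add: dist_real_def)
  define a where "a = f 1 - f 0"
  have k: "\<bar>a\<bar> = k" using d[of 1 0] by (simp add: a_def)
  then show "scaling f = k" by (simp add: scaling_def a_def)
  have "f x = a * x + f 0" for x
  proof -
    have "\<bar>f x - f 0\<bar> = \<bar>a * x\<bar>" "\<bar>f x - f 1\<bar> = \<bar>a * (x - 1)\<bar>"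
      using d[of x 0] d[of x 1] by (simp_all add: k abs_mult)
    then have "(f x - f 0)\<^sup>2 = (a * x)\<^sup>2" "(f x - f 1)\<^sup>2 = (a * (x - 1))\<^sup>2"
      by (simp_all only: abs_eq_iff power2_eq_iff)
    moreover have "f 1 = f 0 + a" by (simp add: a_def)
    ultimately have "2 * a * (f x - f 0 - a * x) = 0"
      by (simp only:) (simp add: power2_eq_square algebra_simps)
    then show ?thesis using k \<open>0 < k\<close> by auto
  qed
  then have "f = (\<lambda>x. a * x + f 0)" by blast
  moreover have "a \<noteq> 0" using k \<open>0 < k\<close> by auto
  ultimately show "similarity f" unfolding similarity_def by blast
qed

lemma similarityE:
  assumes "similarity T"
  obtains a b where "a \<noteq> 0" "T = (\<lambda>x. a * x + b)" "scaling T = \<bar>a\<bar>"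
proof -
  obtain a b where ab: "a \<noteq> 0" "T = (\<lambda>x. a * x + b)"
    using assms by (auto simp: similarity_def)
  then show ?thesis using that[OF ab] by (simp add: scaling_def)
qed

lemma scaling_pos: "similarity T \<Longrightarrow> 0 < scaling T"
  by (elim similarityE) auto

lemma dist_similarity: "similarity T \<Longrightarrow> dist (T x) (T y) = scaling T * dist x y"
  by (elim similarityE) (auto simp: dist_real_def abs_mult[symmetric] algebra_simps)

lemma similarity_id: "similarity id" and scaling_id: "scaling id = 1"
proof -
  show "similarity id" unfolding similarity_def
    by (intro exI[of _ 1] exI[of _ 0]) auto
qed (simp add: scaling_def)

lemma similarity_comp:
  assumes "similarity T" "similarity U"
  shows "similarity (T \<circ> U)" "scaling (T \<circ> U) = scaling T * scaling U"
proof -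
  obtain a b a' b' where "a \<noteq> 0" "T = (\<lambda>x. a * x + b)" "a' \<noteq> 0" "U = (\<lambda>x. a' * x + b')"
    using assms by (meson similarityE)
  then show "similarity (T \<circ> U)" unfolding similarity_def
    by (intro exI[of _ "a * a'"] exI[of _ "a * b' + b"]) (auto simp: fun_eq_iff algebra_simps)
  show "scaling (T \<circ> U) = scaling T * scaling U"
    using dist_similarity[OF assms(1), of "U 1" "U 0"] by (simp add: scaling_def dist_real_def)
qed

lemma similarity_bij: "similarity T \<Longrightarrow> bij T"
  using real_similarity_bij dist_similarity scaling_pos by metis

lemma similarity_inv:
  assumes "similarity T"
  shows "similarity (inv T)" "scaling (inv T) = 1 / scaling T"
proof -
  have "dist (inv T x) (inv T y) = (1 / scaling T) * dist x y" for x y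
    using dist_similarity[OF assms, of "inv T x" "inv T y"] scaling_pos[OF assms] similarity_bij[OF assms]
    by (simp add: bij_is_surj surj_f_inv_f)
  from similarity_of_dist[OF _ this] scaling_pos[OF assms]
  show "similarity (inv T)" "scaling (inv T) = 1 / scaling T" by auto
qed

lemma inv_f_similarity [simp]: "similarity T \<Longrightarrow> inv T (T x) = x"
  by (simp add: bij_is_inj similarity_bij)

lemma f_inv_similarity [simp]: "similarity T \<Longrightarrow> T (inv T x) = x"
  by (simp add: bij_is_surj similarity_bij surj_f_inv_f)

lemma continuous_on_similarity: "similarity T \<Longrightarrow> continuous_on A T"
  by (elim similarityE) (auto intro!: continuous_intros)

lemma similarity_vimage_ball:
  assumes "similarity T"
  shows "T -` ball x r = ball (inv T x) (r / scaling T)"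
proof -
  have "dist x (T y) = scaling T * dist (inv T x) y" for y
    using dist_similarity[OF assms, of "inv T x" y] assms by simp
  then show ?thesis using scaling_pos[OF assms] by (auto simp: field_simps)
qed

lemma similarity_image_ball:
  assumes "similarity T"
  shows "T ` ball x r = ball (T x) (scaling T * r)"
  using similarity_vimage_ball[OF similarity_inv(1)[OF assms], of x r] assms
  by (simp add: bij_vimage_eq_inv_image similarity_bij similarity_inv inv_inv_eq bij_imp_bij_inv mult.commute)

section \<open>Finite covers by balls\<close>

definition ball_sum :: "real \<Rightarrow> (real \<times> real) set \<Rightarrow> real" where
  "ball_sum t B = (\<Sum>(x, r)\<in>B. r powr t)"

definition ball_cover :: "(real \<times> real) set \<Rightarrow> real set \<Rightarrow> bool" where
  "ball_cover B E \<longleftrightarrow> finite B \<and> (\<forall>(x, r)\<in>B. 0 < r) \<and> E \<subseteq> (\<Union>(x, r)\<in>B. ball x r)"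

text \<open>
  For compact \<open>E\<close> and \<open>t > 0\<close> this means that \<open>E\<close> has \<open>t\<close>-dimensional Hausdorff measure zero. Finitely many
  balls allow induction on their number, and similarities map balls to balls.
\<close>

definition small_covers :: "real \<Rightarrow> real set \<Rightarrow> bool" where
  "small_covers t E \<longleftrightarrow> (\<forall>\<epsilon>>0. \<exists>B. ball_cover B E \<and> ball_sum t B < \<epsilon>)"

lemma ball_sum_nonneg: "0 \<le> ball_sum t B"
  by (auto simp: ball_sum_def intro: sum_nonneg)

lemma ball_cover_family:
  assumes "finite I" "\<And>i. i \<in> I \<Longrightarrow> 0 < r i" "E \<subseteq> (\<Union>i\<in>I. ball (x i) (r i))"
  shows "\<exists>B. ball_cover B E \<and> ball_sum t B \<le> (\<Sum>i\<in>I. r i powr t)"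
proof (intro exI conjI)
  show "ball_cover ((\<lambda>i. (x i, r i)) ` I) E"
    using assms by (auto simp: ball_cover_def)
  show "ball_sum t ((\<lambda>i. (x i, r i)) ` I) \<le> (\<Sum>i\<in>I. r i powr t)"
    unfolding ball_sum_def using sum_image_le[OF assms(1), of "\<lambda>(x, r). r powr t" "\<lambda>i. (x i, r i)"]
    by (simp add: o_def)
qed

lemma ball_cover_Un:
  assumes "ball_cover B E" "ball_cover B' E'"
  shows "ball_cover (B \<union> B') (E \<union> E')" "ball_sum t (B \<union> B') \<le> ball_sum t B + ball_sum t B'"
  using assms sum.union_inter[of B B' "\<lambda>(x, r). r powr t"] ball_sum_nonneg[of t "B \<inter> B'"]
  by (auto simp: ball_cover_def ball_sum_def)

lemma ball_cover_mono: "ball_cover B E \<Longrightarrow> E' \<subseteq> E \<Longrightarrow> ball_cover B E'"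
  by (auto simp: ball_cover_def)

text \<open>
  The number of balls is recorded for the induction in the proof of the packing bound.
\<close>

lemma ball_cover_vimage:
  assumes "similarity T" "ball_cover B E" "T ` E' \<subseteq> E"
  shows "\<exists>B'. ball_cover B' E' \<and> ball_sum t B' = ball_sum t B / scaling T powr t \<and> card B' = card B"
proof -
  define \<phi> where "\<phi> = (\<lambda>(x, r). (inv T x, r / scaling T))"
  have pos: "0 < scaling T" using scaling_pos assms(1) by blast
  have inj: "inj_on \<phi> B"
    using similarity_bij[OF similarity_inv(1)[OF assms(1)]] pos
    by (auto simp: inj_on_def \<phi>_def dest: bij_is_inj injD)
  have "ball_cover (\<phi> ` B) E'"
  proof -
    have "E \<subseteq> (\<Union>b\<in>B. ball (fst b) (snd b))"
      using assms(2) by (simp add: ball_cover_def case_prod_beta)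
    with assms(3) have "E' \<subseteq> T -` (\<Union>b\<in>B. ball (fst b) (snd b))"
      unfolding image_subset_iff_subset_vimage[symmetric] by (rule subset_trans)
    also have "\<dots> = (\<Union>b\<in>\<phi> ` B. ball (fst b) (snd b))"
      by (simp add: vimage_UN similarity_vimage_ball[OF assms(1)] \<phi>_def case_prod_beta)
    finally show ?thesis
      using assms(2) pos by (auto simp: ball_cover_def \<phi>_def case_prod_beta)
  qed
  moreover have "ball_sum t (\<phi> ` B) = ball_sum t B / scaling T powr t"
    unfolding ball_sum_def sum.reindex[OF inj] sum_divide_distrib
    using assms(2) pos by (intro sum.cong) (auto simp: \<phi>_def powr_divide ball_cover_def)
  ultimately show ?thesis using card_image[OF inj] by blast
qed

lemma small_covers_vimage:
  assumes "similarity T" "small_covers t E" "T ` E' \<subseteq> E"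
  shows "small_covers t E'"
  unfolding small_covers_def
proof (intro allI impI)
  fix \<epsilon> :: real assume "0 < \<epsilon>"
  have pos: "0 < scaling T powr t" using scaling_pos[OF assms(1)] by simp
  then obtain B where "ball_cover B E" "ball_sum t B < \<epsilon> * scaling T powr t"
    using assms(2) \<open>0 < \<epsilon>\<close> unfolding small_covers_def by (meson mult_pos_pos)
  then show "\<exists>B. ball_cover B E' \<and> ball_sum t B < \<epsilon>"
    using ball_cover_vimage[OF assms(1) _ assms(3), of B t] pos by (metis pos_divide_less_eq)
qed

section \<open>Hausdorff null sets\<close>

lemma diam_pow_zero: "U \<noteq> {} \<Longrightarrow> diam_pow 0 U = 1"
  by (simp add: diam_pow_def)

lemma hausdorff_measure_zero_pos:
  fixes E :: "'a::metric_space set"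
  assumes "E \<noteq> {}"
  shows "hausdorff_measure 0 E > 0"
proof -
  have "1 \<le> hausdorff_premeasure 0 1 E"
    unfolding hausdorff_premeasure_def
  proof (rule INF_greatest)
    fix U :: "nat \<Rightarrow> 'a set" assume "U \<in> {U. E \<subseteq> (\<Union>i. U i) \<and> (\<forall>i. bounded (U i) \<and> diameter (U i) \<le> 1)}"
    then obtain i where i: "U i \<noteq> {}" using assms by blast
    have "diam_pow 0 (U i) \<le> (\<Sum>i. diam_pow 0 (U i))"
      using sum_le_suminf[of "\<lambda>i. diam_pow 0 (U i)" "{i}"] by simp
    then show "1 \<le> (\<Sum>i. diam_pow 0 (U i))" using i by (simp add: diam_pow_zero)
  qed
  also have "\<dots> \<le> hausdorff_measure 0 E"
    unfolding hausdorff_measure_def by (intro SUP_upper) auto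
  finally show ?thesis by (meson less_le_trans zero_less_one)
qed

text \<open>
  Since \<open>t > 0\<close>, a ball contributing little to the sum is itself small, so the bound on the diameters
  holds automatically.
\<close>

lemma hausdorff_null_if_small_covers:
  assumes "0 < t" "small_covers t E"
  shows "hausdorff_measure t E = 0"
proof -
  have "hausdorff_premeasure t \<delta> E \<le> 0" if "0 < \<delta>" for \<delta>
  proof (rule ennreal_le_epsilon)
    fix e :: real assume "0 < e"
    define \<epsilon> where "\<epsilon> = min (e / 2 powr t) ((\<delta> / 2) powr t)"
    have "0 < \<epsilon>" using \<open>0 < e\<close> \<open>0 < \<delta>\<close> by (simp add: \<epsilon>_def)
    then obtain B where B: "ball_cover B E" "ball_sum t B < \<epsilon>"
      using assms(2) by (auto simp: small_covers_def)
    have finB: "finite B" and posB: "\<And>x r. (x, r) \<in> B \<Longrightarrow> 0 < r" and covB: "E \<subseteq> (\<Union>(x, r)\<in>B. ball x r)"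
      using B(1) by (auto simp: ball_cover_def)
    obtain f where f: "bij_betw f {0..<card B} B"
      using ex_bij_betw_nat_finite[OF finB] by blast
    define U where "U i = (if i < card B then ball (fst (f i)) (snd (f i)) else {})" for i
    have fB: "f i \<in> B" if "i < card B" for i using f that by (auto simp: bij_betw_def)
    have small: "r powr t < \<epsilon>" if "(x, r) \<in> B" for x r
    proof -
      have "r powr t \<le> ball_sum t B"
        unfolding ball_sum_def using finB that member_le_sum[of "(x, r)" B "\<lambda>(x, r). r powr t"] by auto
      with B(2) show ?thesis by simp
    qed
    have rad: "2 * r \<le> \<delta>" if "(x, r) \<in> B" for x r
    proof -
      have "r powr t < (\<delta> / 2) powr t" using small[OF that] by (simp add: \<epsilon>_def)
      then have "r < \<delta> / 2" using assms(1) posB[OF that] \<open>0 < \<delta>\<close>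
        by (metis less_eq_real_def linorder_not_le powr_mono2 half_gt_zero)
      then show ?thesis by simp
    qed
    have diam: "diameter (ball (fst (f i)) (snd (f i))) = 2 * snd (f i)" if "i < card B" for i
      using posB[of "fst (f i)" "snd (f i)"] fB[OF that] by simp
    have "hausdorff_premeasure t \<delta> E \<le> (\<Sum>i. diam_pow t (U i))"
      unfolding hausdorff_premeasure_def
    proof (rule INF_lower, safe)
      fix x assume "x \<in> E"
      then obtain b where "b \<in> B" "x \<in> ball (fst b) (snd b)" using covB by auto
      moreover obtain i where "i < card B" "f i = b"
        using bij_betw_imp_surj_on[OF f] \<open>b \<in> B\<close> by (metis imageE atLeastLessThan_iff)
      ultimately show "x \<in> (\<Union>i. U i)" by (auto simp: U_def intro!: exI[of _ i])
    next
      fix i show "bounded (U i)" by (simp add: U_def)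
      show "diameter (U i) \<le> \<delta>"
        using \<open>0 < \<delta>\<close> rad[of "fst (f i)" "snd (f i)"] fB[of i] diam[of i] by (auto simp: U_def)
    qed
    also have "\<dots> = (\<Sum>i<card B. diam_pow t (U i))"
      by (rule suminf_finite) (auto simp: U_def diam_pow_def)
    also have "\<dots> = (\<Sum>i<card B. ennreal (2 powr t * snd (f i) powr t))"
    proof (rule sum.cong)
      fix i assume "i \<in> {..<card B}"
      then have "i < card B" "0 < snd (f i)" using fB[of i] posB[of "fst (f i)" "snd (f i)"] by auto
      then show "diam_pow t (U i) = ennreal (2 powr t * snd (f i) powr t)"
        using diam[of i] assms(1) by (auto simp: U_def diam_pow_def powr_mult)
    qed simp
    also have "\<dots> = ennreal (2 powr t * (\<Sum>i<card B. snd (f i) powr t))"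
      by (simp add: sum_ennreal sum_distrib_left)
    also have "(\<Sum>i<card B. snd (f i) powr t) = ball_sum t B"
      unfolding ball_sum_def using f
      by (subst sum.reindex_bij_betw[OF f, symmetric]) (auto simp: case_prod_beta lessThan_atLeast0)
    also have "ennreal (2 powr t * ball_sum t B) \<le> ennreal e"
    proof (rule ennreal_leI)
      have "2 powr t * ball_sum t B \<le> 2 powr t * (e / 2 powr t)"
        using B(2) by (intro mult_left_mono) (auto simp: \<epsilon>_def)
      then show "2 powr t * ball_sum t B \<le> e" by simp
    qed
    finally show "hausdorff_premeasure t \<delta> E \<le> 0 + ennreal e" by simp
  qed
  then show ?thesis
    unfolding hausdorff_measure_def by (auto intro!: SUP_eqI simp: bot_ennreal le_zero_eq)
qed

lemma powr_enlarge:
  fixes d t :: real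
  assumes "0 \<le> d" "0 < t" "0 < \<epsilon>"
  shows "\<exists>r>d. r powr t < d powr t + \<epsilon>"
proof -
  have "((\<lambda>x. x powr t) \<longlongrightarrow> d powr t) (at_right d)"
    using assms by (intro tendsto_intros tendsto_powr') (auto intro: tendsto_powr' tendsto_ident_at simp: eventually_at_filter)
  then have "eventually (\<lambda>x. x powr t < d powr t + \<epsilon>) (at_right d)"
    using assms(3) by (auto intro: order_tendstoD)
  then have "eventually (\<lambda>x. x powr t < d powr t + \<epsilon> \<and> x > d) (at_right d)"
    using eventually_at_right_less eventually_conj by blast
  then show ?thesis using eventually_happens'[OF trivial_limit_at_right_real] by blast
qed

text \<open>
  Each set of a countable cover lies in a ball around one of its points with radius slightly larger
  than its diameter. The excesses can be chosen summable, and compactness leaves finitely many balls.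
\<close>

lemma small_covers_if_hausdorff_null:
  assumes "compact E" "0 < t" "hausdorff_measure t E = 0"
  shows "small_covers t E"
  unfolding small_covers_def
proof (intro allI impI)
  fix \<epsilon> :: real assume "0 < \<epsilon>"
  have "hausdorff_premeasure t 1 E \<le> hausdorff_measure t E"
    unfolding hausdorff_measure_def by (intro SUP_upper) auto
  then have "hausdorff_premeasure t 1 E < ennreal (\<epsilon> / 2)"
    using assms(3) \<open>0 < \<epsilon>\<close> by simp
  then obtain U where U: "E \<subseteq> (\<Union>i. U i)" "\<And>i. bounded (U i)"
    and sumU: "(\<Sum>i. diam_pow t (U i)) < ennreal (\<epsilon> / 2)"
    unfolding hausdorff_premeasure_def INF_less_iff by blast
  define x where "x i = (SOME y. y \<in> U i)" for i :: nat
  have "\<exists>r>diameter (U i). r powr t < diameter (U i) powr t + (\<epsilon> / 4) * (1/2) ^ i" for i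
    using U(2) assms(2) \<open>0 < \<epsilon>\<close> by (intro powr_enlarge) (auto intro: diameter_ge_0)
  then obtain r where r: "\<And>i. r i > diameter (U i)"
      "\<And>i. r i powr t < diameter (U i) powr t + (\<epsilon> / 4) * (1/2) ^ i"
    by metis
  have Ux: "U i \<subseteq> ball (x i) (r i)" for i
  proof
    fix y assume "y \<in> U i"
    then have "x i \<in> U i" unfolding x_def by (rule someI)
    then have "dist (x i) y \<le> diameter (U i)" using U(2) \<open>y \<in> U i\<close> by (intro diameter_bounded_bound)
    then show "y \<in> ball (x i) (r i)" using r(1)[of i] by simp
  qed
  have rpos: "0 < r i" for i using r(1)[of i] diameter_ge_0[OF U(2), of i] by linarith
  have "E \<subseteq> (\<Union>i\<in>{i. U i \<noteq> {}}. ball (x i) (r i))" using U(1) Ux by blast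
  then obtain I where I: "I \<subseteq> {i. U i \<noteq> {}}" "finite I" "E \<subseteq> (\<Union>i\<in>I. ball (x i) (r i))"
    using compactE_image[OF assms(1), of "{i. U i \<noteq> {}}" "\<lambda>i. ball (x i) (r i)"] by auto
  have "ennreal (\<Sum>i\<in>I. diameter (U i) powr t) = (\<Sum>i\<in>I. ennreal (diameter (U i) powr t))"
    by simp
  also have "\<dots> = (\<Sum>i\<in>I. diam_pow t (U i))"
    using I(1) assms(2) by (intro sum.cong) (auto simp: diam_pow_def)
  also have "\<dots> \<le> (\<Sum>i. diam_pow t (U i))" using I(2) by (intro sum_le_suminf) auto
  finally have "ennreal (\<Sum>i\<in>I. diameter (U i) powr t) < ennreal (\<epsilon> / 2)" using sumU by simp
  then have A: "(\<Sum>i\<in>I. diameter (U i) powr t) < \<epsilon> / 2"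
    by (subst (asm) ennreal_less_iff) (auto intro: sum_nonneg)
  have "(\<Sum>i\<in>I. (1/2::real) ^ i) \<le> (\<Sum>i. (1/2) ^ i)" using I(2) by (intro sum_le_suminf) auto
  also have "\<dots> = 2" by (simp add: suminf_geometric)
  finally have "(\<Sum>i\<in>I. (1/2::real) ^ i) \<le> 2" .
  moreover have "(\<Sum>i\<in>I. r i powr t) \<le> (\<Sum>i\<in>I. diameter (U i) powr t + (\<epsilon> / 4) * (1/2) ^ i)"
    using r(2) by (intro sum_mono) (simp add: less_imp_le)
  moreover have "\<dots> = (\<Sum>i\<in>I. diameter (U i) powr t) + (\<epsilon> / 4) * (\<Sum>i\<in>I. (1/2) ^ i)"
    by (simp add: sum.distrib sum_distrib_left)
  moreover have "(\<epsilon> / 4) * (\<Sum>i\<in>I. (1/2) ^ i) \<le> (\<epsilon> / 4) * 2"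
    using \<open>0 < \<epsilon>\<close> calculation(1) by (intro mult_left_mono) auto
  ultimately have "(\<Sum>i\<in>I. r i powr t) < \<epsilon>" using A by linarith
  moreover obtain B where "ball_cover B E" "ball_sum t B \<le> (\<Sum>i\<in>I. r i powr t)"
    using ball_cover_family[OF I(2), of r E x t] rpos I(3) by blast
  ultimately show "\<exists>B. ball_cover B E \<and> ball_sum t B < \<epsilon>" by (auto intro!: exI[of _ B])
qed

text \<open>
  A set of diameter \<open>d \<le> \<delta>\<close> satisfies \<open>d\<^sup>t \<le> \<delta>\<^sup>t\<^sup>-\<^sup>s d\<^sup>s\<close>.
\<close>

lemma hausdorff_null_mono:
  fixes E :: "'a::metric_space set"
  assumes "0 \<le> s" "s < t" "hausdorff_measure s E = 0"
  shows "hausdorff_measure t E = 0"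
proof -
  have "hausdorff_premeasure t \<delta> E \<le> 0" if "0 < \<delta>" for \<delta>
  proof (rule ennreal_le_epsilon)
    fix e :: real assume "0 < e"
    define \<eta> where "\<eta> = \<delta> powr (t - s)"
    have "0 < \<eta>" using that by (simp add: \<eta>_def)
    have "hausdorff_premeasure s \<delta> E \<le> hausdorff_measure s E"
      unfolding hausdorff_measure_def using that by (intro SUP_upper) auto
    then have "hausdorff_premeasure s \<delta> E < ennreal (e / \<eta>)"
      using assms(3) \<open>0 < e\<close> \<open>0 < \<eta>\<close> by simp
    then obtain U where U: "E \<subseteq> (\<Union>i. U i)" "\<And>i. bounded (U i)" "\<And>i. diameter (U i) \<le> \<delta>"
      and sumU: "(\<Sum>i. diam_pow s (U i)) < ennreal (e / \<eta>)"
      unfolding hausdorff_premeasure_def INF_less_iff by blast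
    have le: "diam_pow t (U i) \<le> ennreal \<eta> * diam_pow s (U i)" for i
    proof (cases "U i = {}")
      case False
      have "diameter (U i) powr t = diameter (U i) powr (t - s) * diameter (U i) powr s"
        by (simp add: powr_add[symmetric])
      also have "\<dots> \<le> \<eta> * (if s = 0 then 1 else diameter (U i) powr s)"
        unfolding \<eta>_def using U(3)[of i] diameter_ge_0[OF U(2), of i] assms
        by (intro mult_mono powr_mono2) (auto simp: powr_def)
      finally have "ennreal (diameter (U i) powr t) \<le> ennreal (\<eta> * (if s = 0 then 1 else diameter (U i) powr s))"
        by (rule ennreal_leI)
      also have "\<dots> = ennreal \<eta> * diam_pow s (U i)"
        using \<open>0 < \<eta>\<close> False by (auto simp: diam_pow_def ennreal_mult)
      finally show ?thesis using False assms by (simp add: diam_pow_def)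
    qed (simp add: diam_pow_def)
    have "hausdorff_premeasure t \<delta> E \<le> (\<Sum>i. diam_pow t (U i))"
      unfolding hausdorff_premeasure_def using U by (intro INF_lower) auto
    also have "\<dots> \<le> (\<Sum>i. ennreal \<eta> * diam_pow s (U i))" using le by (intro suminf_le) auto
    also have "\<dots> = ennreal \<eta> * (\<Sum>i. diam_pow s (U i))" by simp
    also have "\<dots> \<le> ennreal \<eta> * ennreal (e / \<eta>)" using sumU by (intro mult_left_mono) auto
    also have "\<dots> = ennreal e" using \<open>0 < \<eta>\<close> \<open>0 < e\<close> by (simp add: ennreal_mult[symmetric])
    finally show "hausdorff_premeasure t \<delta> E \<le> 0 + ennreal e" by simp
  qed
  then show ?thesis
    unfolding hausdorff_measure_def by (auto intro!: SUP_eqI simp: bot_ennreal le_zero_eq)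
qed

section \<open>Covering numbers and separated sets\<close>

definition separated :: "real \<Rightarrow> 'a::metric_space set \<Rightarrow> bool" where
  "separated r Z \<longleftrightarrow> (\<forall>x\<in>Z. \<forall>y\<in>Z. x \<noteq> y \<longrightarrow> r \<le> dist x y)"

lemma covering_number_le:
  assumes "finite \<U>" "E \<subseteq> \<Union>\<U>" "\<And>U. U \<in> \<U> \<Longrightarrow> open U \<and> bounded U \<and> diameter U \<le> r"
  shows "covering_number r E \<le> card \<U>"
  unfolding covering_number_def using assms by (intro Least_le) blast

lemma covering_number_le_balls:
  fixes E :: "'a::euclidean_space set"
  assumes "finite Z" "0 < r" "E \<subseteq> (\<Union>z\<in>Z. ball (f z) (r / 2))"
  shows "covering_number r E \<le> card Z"
proof -
  have "covering_number r E \<le> card ((\<lambda>z. ball (f z) (r / 2)) ` Z)"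
    using assms by (intro covering_number_le) auto
  also have "\<dots> \<le> card Z" by (rule card_image_le[OF assms(1)])
  finally show ?thesis .
qed

lemma covering_number_attained:
  fixes E :: "'a::euclidean_space set"
  assumes "bounded E" "0 < r"
  obtains \<U> where "finite \<U>" "card \<U> = covering_number r E" "E \<subseteq> \<Union>\<U>"
    "\<And>U. U \<in> \<U> \<Longrightarrow> open U \<and> bounded U \<and> diameter U \<le> r"
proof -
  have "compact (closure E)" using assms(1) by (simp add: compact_closure)
  then obtain K where K: "finite K" "closure E \<subseteq> (\<Union>x\<in>K. ball x (r / 2))"
    using assms(2) unfolding compact_eq_totally_bounded by (meson half_gt_zero)
  let ?\<V> = "(\<lambda>x. ball x (r / 2)) ` K"
  have "finite ?\<V>" "E \<subseteq> \<Union>?\<V>" using K closure_subset[of E] by auto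
  moreover have "\<forall>U\<in>?\<V>. open U \<and> bounded U \<and> diameter U \<le> r"
    using assms(2) by auto
  ultimately have "\<exists>n \<U>. finite \<U> \<and> card \<U> = n \<and> E \<subseteq> \<Union>\<U> \<and>
      (\<forall>U\<in>\<U>. open U \<and> bounded U \<and> diameter U \<le> r)"
    by (intro exI[of _ "card ?\<V>"] exI[of _ ?\<V>]) (rule conjI; simp)
  from LeastI_ex[OF this] that show ?thesis
    unfolding covering_number_def by blast
qed

text \<open>
  The diameter of a covering set is less than the separation, so it contains at most one of the points.
\<close>

lemma card_separated_le_covering_number:
  fixes E :: "'a::euclidean_space set"
  assumes "bounded E" "0 < r" "r < r'" "Z \<subseteq> E" "separated r' Z"
  shows "card Z \<le> covering_number r E"
proof -
  obtain \<U> where \<U>: "finite \<U>" "card \<U> = covering_number r E" "E \<subseteq> \<Union>\<U>"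
    "\<And>U. U \<in> \<U> \<Longrightarrow> open U \<and> bounded U \<and> diameter U \<le> r"
    using covering_number_attained[OF assms(1,2)] by blast
  have "\<forall>z\<in>Z. \<exists>U\<in>\<U>. z \<in> U" using assms(4) \<U>(3) by blast
  then obtain f where f: "\<And>z. z \<in> Z \<Longrightarrow> f z \<in> \<U> \<and> z \<in> f z" by metis
  have "inj_on f Z"
  proof (rule inj_onI, rule ccontr)
    fix x y assume xy: "x \<in> Z" "y \<in> Z" "f x = f y" "x \<noteq> y"
    then have "dist x y \<le> diameter (f x)"
      using f[of x] f[of y] \<U>(4) by (intro diameter_bounded_bound) auto
    also have "\<dots> \<le> r" using f xy \<U>(4) by blast
    also have "\<dots> < r'" by fact
    also have "r' \<le> dist x y" using assms(5) xy by (simp add: separated_def)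
    finally show False by simp
  qed
  then show ?thesis using card_inj_on_le[of f Z \<U>] f \<U>(1,2) by auto
qed

text \<open>
  A separated subset with the largest possible number of points is a net: a point far from all of them could be added.
\<close>

lemma maximal_separated:
  fixes E :: "'a::metric_space set"
  assumes "0 < r" and bound: "\<And>Z. finite Z \<Longrightarrow> Z \<subseteq> E \<Longrightarrow> separated r Z \<Longrightarrow> real (card Z) \<le> b"
  obtains Z where "finite Z" "Z \<subseteq> E" "separated r Z" "E \<subseteq> (\<Union>z\<in>Z. ball z r)"
proof -
  define P where "P Z \<longleftrightarrow> finite Z \<and> Z \<subseteq> E \<and> separated r Z" for Z
  have "P {}" by (simp add: P_def separated_def)
  moreover have "\<forall>Z. P Z \<longrightarrow> card Z < Suc (nat \<lfloor>b\<rfloor>)"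
    using bound by (auto simp: P_def less_Suc_eq_le le_nat_floor)
  ultimately obtain Z where Z: "P Z" "\<And>Z'. P Z' \<Longrightarrow> card Z' \<le> card Z"
    using ex_has_greatest_nat[of P "{}" card] by blast
  have "E \<subseteq> (\<Union>z\<in>Z. ball z r)"
  proof (rule ccontr)
    assume "\<not> E \<subseteq> (\<Union>z\<in>Z. ball z r)"
    then obtain x where x: "x \<in> E" "\<And>z. z \<in> Z \<Longrightarrow> r \<le> dist z x" by (force simp: not_less)
    then have "x \<notin> Z" using \<open>0 < r\<close> by force
    have "P (insert x Z)" using Z(1) x by (auto simp: P_def separated_def dist_commute)
    from Z(2)[OF this] \<open>x \<notin> Z\<close> Z(1) show False by (simp add: P_def)
  qed
  then show ?thesis using that Z(1) by (auto simp: P_def)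
qed

text \<open>
  Points at distance at least \<open>r\<close> have different values of \<open>\<lfloor>z / r\<rfloor>\<close>.
\<close>

lemma card_separated_interval:
  fixes Z :: "real set"
  assumes "Z \<subseteq> {a..b}" "separated r Z" "0 < r" "a \<le> b"
  shows "real (card Z) \<le> (b - a) / r + 2"
proof -
  define f where "f z = \<lfloor>z / r\<rfloor>" for z
  have "inj_on f Z"
  proof (rule inj_onI, rule ccontr)
    fix x y assume xy: "x \<in> Z" "y \<in> Z" "f x = f y" "x \<noteq> y"
    have "\<bar>x / r - y / r\<bar> < 1" using xy(3) unfolding f_def by linarith
    then have "\<bar>x - y\<bar> < r" using assms(3) by (simp add: diff_divide_distrib[symmetric] abs_div)
    then show False using assms(2) xy by (force simp: separated_def dist_real_def)
  qed
  moreover have "f ` Z \<subseteq> {\<lfloor>a / r\<rfloor>..\<lfloor>b / r\<rfloor>}"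
  proof
    fix k assume "k \<in> f ` Z"
    then obtain z where "k = \<lfloor>z / r\<rfloor>" "a \<le> z" "z \<le> b" using assms(1) by (auto simp: f_def)
    then show "k \<in> {\<lfloor>a / r\<rfloor>..\<lfloor>b / r\<rfloor>}"
      using assms(3) by (auto intro!: floor_mono divide_right_mono)
  qed
  ultimately have "card Z \<le> card {\<lfloor>a / r\<rfloor>..\<lfloor>b / r\<rfloor>}" by (meson card_inj_on_le finite_atLeastAtMost_int)
  moreover have "a / r \<le> b / r" using assms(3,4) by (simp add: divide_right_mono)
  then have "real (card {\<lfloor>a / r\<rfloor>..\<lfloor>b / r\<rfloor>}) \<le> b / r - a / r + 2"
    using floor_mono[of "a / r" "b / r"] by simp linarith
  ultimately show ?thesis by (simp add: diff_divide_distrib)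
qed

section \<open>Assouad dimension\<close>

definition assouad_exponent :: "real \<Rightarrow> 'a::euclidean_space set \<Rightarrow> bool" where
  "assouad_exponent t F \<longleftrightarrow> 0 \<le> t \<and> (\<exists>C>0. \<forall>R>0. \<forall>r\<in>{0<..<R}. \<forall>x\<in>F.
       real (covering_number r (ball x R \<inter> F)) \<le> C * (R / r) powr t)"

lemma assouad_dim_eq: "assouad_dim F = Inf {t. assouad_exponent t F}"
  by (simp add: assouad_dim_def assouad_exponent_def)

lemma assouad_dim_eqI:
  assumes "assouad_exponent s F" "\<And>t. assouad_exponent t F \<Longrightarrow> s \<le> t"
  shows "assouad_dim F = s"
  unfolding assouad_dim_eq using assms by (intro cInf_eq_minimum) auto

lemma assouad_exponent_one: "assouad_exponent 1 (F :: real set)"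
  unfolding assouad_exponent_def
proof (intro conjI exI[of _ 6] allI impI ballI)
  fix R r x :: real assume R: "0 < R" and r: "r \<in> {0<..<R}"
  have b: "real (card Z) \<le> 2 * R / (r / 2) + 2"
    if "finite Z" "Z \<subseteq> ball x R \<inter> F" "separated (r / 2) Z" for Z
  proof -
    have "ball x R \<subseteq> {x - R..x + R}" by (auto simp: dist_real_def)
    then have "Z \<subseteq> {x - R..x + R}" using that(2) by blast
    from card_separated_interval[OF this that(3)] show ?thesis using R r by simp
  qed
  have "0 < r / 2" using r by simp
  obtain Z where Z: "finite Z" "Z \<subseteq> ball x R \<inter> F" "separated (r / 2) Z"
      "ball x R \<inter> F \<subseteq> (\<Union>z\<in>Z. ball z (r / 2))"
    by (rule maximal_separated[OF \<open>0 < r / 2\<close> b])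
  have "real (covering_number r (ball x R \<inter> F)) \<le> card Z"
    using covering_number_le_balls[OF Z(1) _ Z(4)] r by simp
  also have "\<dots> \<le> 2 * R / (r / 2) + 2" using b Z by blast
  also have "\<dots> \<le> 6 * (R / r) powr 1" using R r by (simp add: field_simps)
  finally show "real (covering_number r (ball x R \<inter> F)) \<le> 6 * (R / r) powr 1" .
qed auto

text \<open>
  The condition with \<open>R = 2\<close> covers all of \<open>F\<close> by \<open>O(r\<^sup>-\<^sup>t)\<close> sets of diameter \<open>r\<close>, at total cost
  \<open>O(r\<^sup>t\<^sup>'\<^sup>-\<^sup>t)\<close>.
\<close>

lemma small_covers_of_assouad_exponent:
  assumes "F \<subseteq> {0..1}" "assouad_exponent t F" "t < t'"
  shows "small_covers t' F"
proof (cases "F = {}")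
  case True
  then show ?thesis
    by (auto simp: small_covers_def ball_cover_def ball_sum_def intro!: exI[of _ "{}"])
next
  case False
  then obtain x where "x \<in> F" by blast
  have "0 \<le> t" using assms(2) by (simp add: assouad_exponent_def)
  obtain C where "C > 0" and C: "\<And>R r x. 0 < r \<Longrightarrow> r < R \<Longrightarrow> x \<in> F \<Longrightarrow>
      real (covering_number r (ball x R \<inter> F)) \<le> C * (R / r) powr t"
    using assms(2) unfolding assouad_exponent_def by fastforce
  have "x \<in> {0..1}" using assms(1) \<open>x \<in> F\<close> by blast
  then have "{0..1} \<subseteq> ball x 2" by (auto simp: dist_real_def)
  then have "F \<subseteq> ball x 2" using assms(1) by blast
  then have F2: "ball x 2 \<inter> F = F" by blast
  have "bounded F" using assms(1) bounded_closed_interval bounded_subset by blast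
  show ?thesis unfolding small_covers_def
  proof (intro allI impI)
    fix \<epsilon> :: real assume "0 < \<epsilon>"
    define K where "K = C * 2 powr t * 2 powr t'"
    have "K > 0" using \<open>C > 0\<close> by (simp add: K_def)
    define r where "r = min 1 ((\<epsilon> / (2 * K)) powr (1 / (t' - t)))"
    have r: "0 < r" "r \<le> 1" using \<open>0 < \<epsilon>\<close> \<open>0 < K\<close> by (auto simp: r_def)
    have "r powr (t' - t) \<le> ((\<epsilon> / (2 * K)) powr (1 / (t' - t))) powr (t' - t)"
      using r assms(3) by (intro powr_mono2) (auto simp: r_def)
    also have "\<dots> = \<epsilon> / (2 * K)"
      using assms(3) \<open>0 < \<epsilon>\<close> \<open>0 < K\<close> by (simp add: powr_powr)
    finally have "K * r powr (t' - t) \<le> \<epsilon> / 2" using \<open>0 < K\<close> by (simp add: field_simps)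
    obtain \<U> where \<U>: "finite \<U>" "card \<U> = covering_number r F" "F \<subseteq> \<Union>\<U>"
      "\<And>U. U \<in> \<U> \<Longrightarrow> open U \<and> bounded U \<and> diameter U \<le> r"
      using covering_number_attained[OF \<open>bounded F\<close> r(1)] by blast
    define p where "p U = (SOME y. y \<in> U)" for U :: "real set"
    have "F \<subseteq> (\<Union>U\<in>\<U>. ball (p U) (2 * r))"
    proof
      fix y assume "y \<in> F"
      then obtain U where U: "U \<in> \<U>" "y \<in> U" using \<U>(3) by blast
      then have "p U \<in> U" unfolding p_def by (intro someI)
      then have "dist (p U) y \<le> diameter U" using U \<U>(4) by (intro diameter_bounded_bound) auto
      also have "\<dots> < 2 * r" using \<U>(4)[OF U(1)] r by linarith
      finally show "y \<in> (\<Union>U\<in>\<U>. ball (p U) (2 * r))" using U by auto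
    qed
    then obtain B where B: "ball_cover B F" "ball_sum t' B \<le> (\<Sum>U\<in>\<U>. (2 * r) powr t')"
      using ball_cover_family[OF \<U>(1), of "\<lambda>_. 2 * r" F p t'] r by auto
    note B(2)
    also have "(\<Sum>U\<in>\<U>. (2 * r) powr t') = real (covering_number r F) * (2 * r) powr t'"
      using \<U>(2) by simp
    also have "\<dots> \<le> (C * (2 / r) powr t) * (2 * r) powr t'"
      using C[of r 2 x] r \<open>x \<in> F\<close> F2 by (intro mult_right_mono) auto
    also have "\<dots> = K * r powr (t' - t)"
      using r by (simp add: K_def powr_divide powr_mult powr_diff)
    also have "\<dots> \<le> \<epsilon> / 2" by fact
    finally show "\<exists>B. ball_cover B F \<and> ball_sum t' B < \<epsilon>"
      using B(1) \<open>0 < \<epsilon>\<close> by (intro exI[of _ B]) auto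
  qed
qed

section \<open>Hausdorff dimension of subsets of the unit interval\<close>

lemma hausdorff_null_above_one:
  assumes "E \<subseteq> {0..1::real}" "1 < t"
  shows "hausdorff_measure t E = 0"
  using small_covers_of_assouad_exponent[OF assms(1) assouad_exponent_one assms(2)] assms(2)
  by (intro hausdorff_null_if_small_covers) auto

lemma hausdorff_dim_le:
  assumes "0 \<le> t" "hausdorff_measure t E = 0"
  shows "hausdorff_dim E \<le> t"
  unfolding hausdorff_dim_def using assms by (intro cInf_lower bdd_belowI[of _ 0]) auto

lemma hausdorff_null_exponent_exists:
  assumes "E \<subseteq> {0..1::real}"
  shows "{s. 0 \<le> s \<and> hausdorff_measure s E = 0} \<noteq> {}"
proof -
  have "2 \<in> {s. 0 \<le> s \<and> hausdorff_measure s E = 0}"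
    using hausdorff_null_above_one[OF assms, of 2] by simp
  then show ?thesis by blast
qed

lemma hausdorff_dim_nonneg:
  assumes "E \<subseteq> {0..1::real}"
  shows "0 \<le> hausdorff_dim E"
  unfolding hausdorff_dim_def
  by (rule cInf_greatest[OF hausdorff_null_exponent_exists[OF assms]]) simp

lemma hausdorff_null_above_dim:
  assumes "E \<subseteq> {0..1::real}" "hausdorff_dim E < t"
  shows "hausdorff_measure t E = 0"
proof -
  have "Inf {s. 0 \<le> s \<and> hausdorff_measure s E = 0} < t"
    using assms(2) by (simp add: hausdorff_dim_def)
  from cInf_lessD[OF hausdorff_null_exponent_exists[OF assms(1)] this]
  obtain s where "0 \<le> s" "s < t" "hausdorff_measure s E = 0" by auto
  then show ?thesis by (rule hausdorff_null_mono)
qed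

lemma hausdorff_dim_le_assouad_exponent:
  assumes "F \<subseteq> {0..1::real}" "assouad_exponent t F"
  shows "hausdorff_dim F \<le> t"
proof (rule dense_ge)
  fix t' assume "t < t'"
  have "0 \<le> t" using assms(2) by (simp add: assouad_exponent_def)
  then show "hausdorff_dim F \<le> t'"
    using small_covers_of_assouad_exponent[OF assms \<open>t < t'\<close>] \<open>t < t'\<close>
    by (intro hausdorff_dim_le hausdorff_null_if_small_covers) auto
qed

section \<open>Semigroups of similarities acting on a compact set\<close>

lemma disjoint_compact_family_gap:
  fixes A :: "'i \<Rightarrow> real set"
  assumes "finite I" and comp: "\<And>i. i \<in> I \<Longrightarrow> compact (A i)" and disj: "disjoint_family_on A I"
  shows "\<exists>\<gamma>>0. \<forall>i\<in>I. \<forall>j\<in>I. i \<noteq> j \<longrightarrow> (\<forall>x\<in>A i. \<forall>y\<in>A j. \<gamma> \<le> dist x y)"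
proof -
  have "\<exists>d>0. i \<noteq> j \<longrightarrow> (\<forall>x\<in>A i. \<forall>y\<in>A j. d \<le> dist x y)" if "i \<in> I" "j \<in> I" for i j
  proof (cases "i = j")
    case False
    then have "A i \<inter> A j = {}" using disj that by (auto simp: disjoint_family_on_def)
    then show ?thesis
      using separate_compact_closed[OF comp[OF that(1)] compact_imp_closed[OF comp[OF that(2)]]] by blast
  qed (auto intro: exI[of _ 1])
  then obtain d where d: "\<And>i j. i \<in> I \<Longrightarrow> j \<in> I \<Longrightarrow> 0 < d i j"
    "\<And>i j x y. i \<in> I \<Longrightarrow> j \<in> I \<Longrightarrow> i \<noteq> j \<Longrightarrow> x \<in> A i \<Longrightarrow> y \<in> A j \<Longrightarrow> d i j \<le> dist x y"
    by metis
  define D where "D = insert 1 ((\<lambda>(i, j). d i j) ` (I \<times> I))"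
  have "finite D" "D \<noteq> {}" using assms(1) by (auto simp: D_def)
  then have "0 < Min D" using d(1) by (subst Min_gr_iff) (auto simp: D_def)
  moreover have "Min D \<le> dist x y" if "i \<in> I" "j \<in> I" "i \<noteq> j" "x \<in> A i" "y \<in> A j" for i j x y
  proof -
    have "d i j \<in> D" using that by (auto simp: D_def)
    then have "Min D \<le> d i j" using \<open>finite D\<close> by simp
    also have "\<dots> \<le> dist x y" using d(2) that by blast
    finally show ?thesis .
  qed
  ultimately show ?thesis by blast
qed

text \<open>
  This isolates what is needed about the maps of the loops at one vertex. The last assumption provides,
  near every point \<open>y\<close> of \<open>F\<close> and for every scale \<open>r \<le> 1\<close>, an image of the unit interval of length comparable to \<open>r\<close>. This image
  need not contain \<open>y\<close>: the paths leading to pieces that contain \<open>y\<close> start at various vertices, and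
  composing them with a path from the chosen vertex to their start loses the point itself.
\<close>

locale similarity_monoid =
  fixes L :: "(real \<Rightarrow> real) set" and F :: "real set" and \<rho> :: real
  assumes comp_closed: "T \<in> L \<Longrightarrow> U \<in> L \<Longrightarrow> T \<circ> U \<in> L"
    and id_closed: "id \<in> L"
    and sim: "T \<in> L \<Longrightarrow> similarity T"
    and unit: "T \<in> L \<Longrightarrow> T ` {0..1} \<subseteq> {0..1}"
    and invariant: "T \<in> L \<Longrightarrow> T ` F \<subseteq> F"
    and compact: "compact F" and nonempty: "F \<noteq> {}" and sub_unit: "F \<subseteq> {0..1}"
    and \<rho>_pos: "0 < \<rho>"
    and approx: "y \<in> F \<Longrightarrow> 0 < r \<Longrightarrow> r \<le> 1 \<Longrightarrow> \<exists>T\<in>L. T ` {0..1} \<subseteq> ball y r \<and> \<rho> * r \<le> scaling T"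
begin

subsection \<open>Packings\<close>

lemma scaling_le_1: "T \<in> L \<Longrightarrow> scaling T \<le> 1"
proof -
  assume "T \<in> L"
  then have "\<forall>x\<in>{0..1}. T x \<in> {0..1}" using unit by blast
  then have "T 0 \<in> {0..1}" "T 1 \<in> {0..1}" by simp_all
  then show ?thesis by (auto simp: scaling_def)
qed

lemma pos: "T \<in> L \<Longrightarrow> 0 < scaling T"
  using sim scaling_pos by blast

lemma dim_nonneg: "hausdorff_dim F \<le> s \<Longrightarrow> 0 \<le> s"
  using hausdorff_dim_nonneg[OF sub_unit] by simp

text \<open>
  Otherwise the sum still exceeds \<open>1\<close> for some exponent \<open>t > s\<close>. Let \<open>\<gamma>\<close> be a lower bound for the
  gaps between the intervals \<open>T i [0,1]\<close>. Every finite cover of \<open>F\<close> by balls then has \<open>t\<close>-sum at least \<open>(\<gamma>/2)\<^sup>t\<close>, by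
  induction on the number of balls: if all balls are small, each of them meets at most one of the
  intervals, so the cover splits into smaller covers of the sets \<open>T i F\<close>. Pulled back by \<open>T i\<close> these are
  covers of \<open>F\<close>, and \<open>\<Sum> ratio\<^sup>t > 1\<close> reassembles the lower bound. This contradicts that \<open>F\<close> has
  \<open>t\<close>-dimensional measure zero.
\<close>

lemma packing:
  fixes T :: "'i \<Rightarrow> real \<Rightarrow> real"
  assumes dim: "hausdorff_dim F \<le> s" and I: "finite I" "\<And>i. i \<in> I \<Longrightarrow> T i \<in> L"
    and disj: "disjoint_family_on (\<lambda>i. T i ` {0..1}) I"
  shows "(\<Sum>i\<in>I. scaling (T i) powr s) \<le> 1"
proof (rule ccontr)
  assume "\<not> ?thesis"
  then have gt1: "1 < (\<Sum>i\<in>I. scaling (T i) powr s)" by simp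
  have "0 \<le> s" using dim_nonneg[OF dim] .
  have other: "\<exists>j\<in>I. j \<noteq> i" if "i \<in> I" for i
  proof (rule ccontr)
    assume "\<not> (\<exists>j\<in>I. j \<noteq> i)"
    then have "I = {i}" using that by blast
    then have "(\<Sum>i\<in>I. scaling (T i) powr s) = scaling (T i) powr s" by simp
    also have "\<dots> \<le> 1"
      using scaling_le_1[OF I(2)[OF that]] pos[OF I(2)[OF that]] \<open>0 \<le> s\<close>
      by (intro powr_le1) auto
    finally show False using gt1 by simp
  qed
  have "compact (T i ` {0..1})" if "i \<in> I" for i
    using continuous_on_similarity[OF sim[OF I(2)[OF that]]] by (intro compact_continuous_image) auto
  from disjoint_compact_family_gap[OF I(1) this disj]
  obtain \<gamma> where "0 < \<gamma>" and \<gamma>: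
      "\<forall>i\<in>I. \<forall>j\<in>I. i \<noteq> j \<longrightarrow> (\<forall>x\<in>T i ` {0..1}. \<forall>y\<in>T j ` {0..1}. \<gamma> \<le> dist x y)"
    by blast
  have gap: "\<gamma> \<le> dist x y"
    if "i \<in> I" "j \<in> I" "i \<noteq> j" "x \<in> T i ` {0..1}" "y \<in> T j ` {0..1}" for i j x y
    using \<gamma> that by blast
  have "((\<lambda>t. \<Sum>i\<in>I. scaling (T i) powr t) \<longlongrightarrow> (\<Sum>i\<in>I. scaling (T i) powr s)) (at_right s)"
    using pos I(2) by (intro tendsto_sum tendsto_powr tendsto_const tendsto_ident_at) fastforce
  from order_tendstoD(1)[OF this gt1]
  have "\<forall>\<^sub>F t in at_right s. 1 < (\<Sum>i\<in>I. scaling (T i) powr t) \<and> s < t"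
    using eventually_at_right_less by (rule eventually_conj)
  then obtain t where "s < t" and t: "1 < (\<Sum>i\<in>I. scaling (T i) powr t)"
    using eventually_happens'[OF trivial_limit_at_right_real] by blast
  then have "0 < t" using \<open>0 \<le> s\<close> by simp
  have claim: "(\<gamma> / 2) powr t \<le> ball_sum t B" if "ball_cover B F" for B
    using that
  proof (induction "card B" arbitrary: B rule: less_induct)
    case less
    have finB: "finite B" and posB: "\<And>b. b \<in> B \<Longrightarrow> 0 < snd b"
      and covB: "F \<subseteq> (\<Union>b\<in>B. ball (fst b) (snd b))"
      using less.prems by (auto simp: ball_cover_def case_prod_beta)
    show ?case
    proof (cases "\<exists>b\<in>B. \<gamma> / 2 \<le> snd b")
      case True
      then obtain b where b: "b \<in> B" "\<gamma> / 2 \<le> snd b" by blast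
      then have "(\<gamma> / 2) powr t \<le> snd b powr t"
        using \<open>0 < \<gamma>\<close> \<open>0 < t\<close> by (intro powr_mono2) auto
      also have "\<dots> \<le> ball_sum t B"
        unfolding ball_sum_def case_prod_beta using b(1) finB by (intro member_le_sum) auto
      finally show ?thesis .
    next
      case False
      then have small: "snd b < \<gamma> / 2" if "b \<in> B" for b using that by force
      define P where "P i = {b \<in> B. ball (fst b) (snd b) \<inter> T i ` {0..1} \<noteq> {}}" for i
      have PB: "P i \<subseteq> B" for i by (auto simp: P_def)
      have Pdisj: "P i \<inter> P j = {}" if "i \<in> I" "j \<in> I" "i \<noteq> j" for i j
      proof (rule ccontr)
        assume "P i \<inter> P j \<noteq> {}"
        then obtain b p q where b: "b \<in> B" "dist (fst b) p < snd b" "dist (fst b) q < snd b"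
          "p \<in> T i ` {0..1}" "q \<in> T j ` {0..1}"
          unfolding P_def by (auto simp: disjoint_iff)
        have "dist p q \<le> dist (fst b) p + dist (fst b) q" by (rule dist_triangle3)
        then show False using b small[OF b(1)] gap[OF that b(4,5)] by simp
      qed
      have Pcov: "ball_cover (P i) (T i ` F)" if "i \<in> I" for i
      proof -
        have "T i ` F \<subseteq> (\<Union>b\<in>P i. ball (fst b) (snd b))"
        proof
          fix y assume y: "y \<in> T i ` F"
          then have "y \<in> F" using invariant[OF I(2)[OF that]] by blast
          then obtain b where b: "b \<in> B" "y \<in> ball (fst b) (snd b)"
            using covB by blast
          moreover have "y \<in> T i ` {0..1}" using y sub_unit by blast
          ultimately have "b \<in> P i" unfolding P_def by blast
          then show "y \<in> (\<Union>b\<in>P i. ball (fst b) (snd b))" using b(2) by blast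
        qed
        then show ?thesis
          using finB posB by (auto simp: ball_cover_def case_prod_beta P_def)
      qed
      have Pne: "P i \<noteq> {}" if "i \<in> I" for i
        using Pcov[OF that] nonempty by (auto simp: ball_cover_def)
      have piece: "scaling (T i) powr t * (\<gamma> / 2) powr t \<le> ball_sum t (P i)" if i: "i \<in> I" for i
      proof -
        obtain j where "j \<in> I" "j \<noteq> i" using other[OF i] by blast
        then have "P i \<subset> B" using Pne[of j] Pdisj[of i j] i PB[of i] PB[of j] by blast
        then have "card (P i) < card B" by (rule psubset_card_mono[OF finB])
        moreover obtain B' where "ball_cover B' F" "ball_sum t B' = ball_sum t (P i) / scaling (T i) powr t"
          "card B' = card (P i)"
          using ball_cover_vimage[OF sim[OF I(2)[OF i]] Pcov[OF i] order_refl] by blast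
        ultimately have "(\<gamma> / 2) powr t \<le> ball_sum t (P i) / scaling (T i) powr t"
          using less.hyps[of B'] by simp
        then show ?thesis using pos[OF I(2)[OF i]] by (simp add: field_simps)
      qed
      have "(\<gamma> / 2) powr t \<le> (\<Sum>i\<in>I. scaling (T i) powr t) * (\<gamma> / 2) powr t"
        using mult_right_mono[of 1 "\<Sum>i\<in>I. scaling (T i) powr t" "(\<gamma> / 2) powr t"] t by simp
      also have "\<dots> \<le> (\<Sum>i\<in>I. ball_sum t (P i))"
        unfolding sum_distrib_right by (intro sum_mono piece)
      also have "\<dots> = ball_sum t (\<Union>i\<in>I. P i)"
        unfolding ball_sum_def using I(1) finite_subset[OF PB finB] Pdisj
        by (intro sum.UNION_disjoint[symmetric]) auto
      also have "\<dots> \<le> ball_sum t B"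
        unfolding ball_sum_def using finB PB by (intro sum_mono2) auto
      finally show ?thesis .
    qed
  qed
  have "hausdorff_measure t F = 0"
    using hausdorff_null_above_dim[OF sub_unit] dim \<open>s < t\<close> by simp
  then have "small_covers t F"
    using small_covers_if_hausdorff_null[OF compact \<open>0 < t\<close>] by simp
  moreover have "0 < (\<gamma> / 2) powr t" using \<open>0 < \<gamma>\<close> by simp
  ultimately obtain B where "ball_cover B F" "ball_sum t B < (\<gamma> / 2) powr t"
    unfolding small_covers_def by blast
  then show False using claim by force
qed

lemma separated_pieces:
  assumes "Z \<subseteq> F" "separated \<delta> Z" "0 < \<delta>" "\<delta> \<le> 1"
  obtains T where "\<And>z. z \<in> Z \<Longrightarrow> T z \<in> L" "\<And>z. z \<in> Z \<Longrightarrow> T z ` {0..1} \<subseteq> ball z (\<delta> / 2)"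
    "\<And>z. z \<in> Z \<Longrightarrow> \<rho> * \<delta> / 2 \<le> scaling (T z)" "disjoint_family_on (\<lambda>z. T z ` {0..1}) Z"
proof -
  have "\<exists>T\<in>L. T ` {0..1} \<subseteq> ball z (\<delta> / 2) \<and> \<rho> * \<delta> / 2 \<le> scaling T" if "z \<in> Z" for z
    using approx[of z "\<delta> / 2"] assms that by auto
  then obtain T where T: "\<And>z. z \<in> Z \<Longrightarrow> T z \<in> L \<and> T z ` {0..1} \<subseteq> ball z (\<delta> / 2) \<and> \<rho> * \<delta> / 2 \<le> scaling (T z)"
    by metis
  have "disjoint_family_on (\<lambda>z. T z ` {0..1}) Z"
    unfolding disjoint_family_on_def
  proof (intro ballI impI)
    fix z w assume zw: "z \<in> Z" "w \<in> Z" "z \<noteq> w"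
    then have "\<delta> \<le> dist z w" using assms(2) by (simp add: separated_def)
    then have "ball z (\<delta> / 2) \<inter> ball w (\<delta> / 2) = {}" by (intro disjoint_ballI) simp
    then show "T z ` {0..1} \<inter> T w ` {0..1} = {}" using T zw by blast
  qed
  with T that show ?thesis by blast
qed

text \<open>
  Apply the packing bound to one piece of size about \<open>\<delta>\<close> near each of the points.
\<close>

lemma card_separated_le:
  assumes dim: "hausdorff_dim F \<le> s"
    and "finite Z" "Z \<subseteq> F" "separated \<delta> Z" "0 < \<delta>" "\<delta> \<le> 1"
  shows "real (card Z) * (\<rho> * \<delta> / 2) powr s \<le> 1"
proof -
  obtain T where T: "\<And>z. z \<in> Z \<Longrightarrow> T z \<in> L" "\<And>z. z \<in> Z \<Longrightarrow> T z ` {0..1} \<subseteq> ball z (\<delta> / 2)"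
    "\<And>z. z \<in> Z \<Longrightarrow> \<rho> * \<delta> / 2 \<le> scaling (T z)" "disjoint_family_on (\<lambda>z. T z ` {0..1}) Z"
    using separated_pieces[OF assms(3-6)] by blast
  have "real (card Z) * (\<rho> * \<delta> / 2) powr s = (\<Sum>z\<in>Z. (\<rho> * \<delta> / 2) powr s)" by simp
  also have "\<dots> \<le> (\<Sum>z\<in>Z. scaling (T z) powr s)"
    using T(3) \<rho>_pos \<open>0 < \<delta>\<close> dim_nonneg[OF dim] by (intro sum_mono powr_mono2) auto
  also have "\<dots> \<le> 1" using packing[OF dim assms(2) T(1) T(4)] by simp
  finally show ?thesis .
qed

lemma separated_net:
  assumes dim: "hausdorff_dim F \<le> s" and "0 < \<delta>" "\<delta> \<le> 1" "E \<subseteq> F"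
  obtains Z where "finite Z" "Z \<subseteq> E" "separated \<delta> Z" "E \<subseteq> (\<Union>z\<in>Z. ball z \<delta>)"
proof -
  have b: "real (card Z) \<le> 1 / (\<rho> * \<delta> / 2) powr s"
    if "finite Z" "Z \<subseteq> E" "separated \<delta> Z" for Z
  proof -
    have "real (card Z) * (\<rho> * \<delta> / 2) powr s \<le> 1"
      using that assms by (intro card_separated_le) auto
    then show ?thesis using \<rho>_pos \<open>0 < \<delta>\<close> by (simp add: field_simps)
  qed
  show ?thesis by (rule maximal_separated[OF \<open>0 < \<delta>\<close> b that])
qed

lemma two_points:
  assumes "\<not> is_singleton F"
  obtains y1 y2 where "y1 \<in> F" "y2 \<in> F" "y1 \<noteq> y2" "dist y1 y2 \<le> 1"
proof -
  obtain y1 where y1: "y1 \<in> F" using nonempty by blast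
  obtain y2 where y2: "y2 \<in> F" "y1 \<noteq> y2" using assms y1 unfolding is_singleton_def by blast
  have "y1 \<in> {0..1}" "y2 \<in> {0..1}" using y1 y2 sub_unit by auto
  then have "dist y1 y2 \<le> 1" by (auto simp: dist_real_def)
  with y1 y2 that show ?thesis by blast
qed

text \<open>
  Two disjoint pieces violate the packing bound for \<open>s = 0\<close>.
\<close>

lemma dim_pos:
  assumes "\<not> is_singleton F" "hausdorff_dim F \<le> s"
  shows "0 < s"
proof (rule ccontr)
  assume "\<not> 0 < s"
  then have "s = 0" using dim_nonneg[OF assms(2)] by simp
  obtain y1 y2 where y: "y1 \<in> F" "y2 \<in> F" "y1 \<noteq> y2" "dist y1 y2 \<le> 1"
    using two_points[OF assms(1)] by blast
  have "real (card {y1, y2}) * (\<rho> * dist y1 y2 / 2) powr s \<le> 1"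
    using y by (intro card_separated_le assms) (auto simp: separated_def dist_commute)
  moreover have "(\<rho> * dist y1 y2 / 2) powr s = 1"
    using \<open>s = 0\<close> \<rho>_pos y(3) by simp
  ultimately show False using y(3) by simp
qed

subsection \<open>Without weak separation\<close>

text \<open>
  The maps \<open>T\<^sup>-\<^sup>1 \<circ> U\<close> are affine, so being close to the identity at \<open>0\<close> and \<open>1\<close> is being close in the topology of
  pointwise convergence.
\<close>

definition near_coincidences :: bool where
  "near_coincidences \<longleftrightarrow> (\<forall>\<eta>>0. \<exists>T\<in>L. \<exists>U\<in>L. inv T \<circ> U \<noteq> id \<and>
     \<bar>inv T (U 0)\<bar> < \<eta> \<and> \<bar>inv T (U 1) - 1\<bar> < \<eta>)"

lemma funpow_closed: "P \<in> L \<Longrightarrow> P ^^ k \<in> L" "P \<in> L \<Longrightarrow> scaling (P ^^ k) = scaling P ^ k"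
proof -
  assume P: "P \<in> L"
  have "P ^^ k \<in> L \<and> scaling (P ^^ k) = scaling P ^ k"
  proof (induction k)
    case 0 show ?case using id_closed scaling_id by (simp add: id_def)
  next
    case (Suc k)
    then show ?case
      using comp_closed[OF P, of "P ^^ k"] similarity_comp(2)[OF sim[OF P] sim, of "P ^^ k"]
      by (simp only: funpow.simps power_Suc)
  qed
  then show "P ^^ k \<in> L" "scaling (P ^^ k) = scaling P ^ k" by auto
qed

text \<open>
  The displacement \<open>D x = T\<^sup>-\<^sup>1 (U x) - x\<close> of a near coincidence is an affine function with a maximum \<open>M\<close> that
  is positive, but as small as desired. An affine function cannot be small at two distant points unless it is small everywhere,
  so on one of two fixed disjoint intervals \<open>W1 [0,1]\<close>, \<open>W2 [0,1]\<close> it is comparable to \<open>M\<close>. Precomposing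
  \<open>T\<close> and \<open>U\<close> with \<open>V = W \<circ> P\<^sup>k\<close> restricts \<open>D\<close> to a subinterval of that interval and multiplies it by
  \<open>1 / scaling V\<close>. A suitable number \<open>k\<close> of copies of a fixed contraction \<open>P\<close> adjusts the factor up to
  the ratio of \<open>P\<close>.
\<close>

lemma uniform_displacement:
  assumes "\<not> is_singleton F" near_coincidences
  obtains \<kappa> where "0 < \<kappa>" "\<kappa> \<le> 1"
    "\<And>\<tau>. 0 < \<tau> \<Longrightarrow> \<exists>T\<in>L. \<exists>U\<in>L. (\<forall>x\<in>{0..1}. inv T (U x) - x \<in> {\<kappa> * \<tau>..\<tau>}) \<or>
        (\<forall>x\<in>{0..1}. x - inv T (U x) \<in> {\<kappa> * \<tau>..\<tau>})"
proof -
  obtain y1 y2 where y: "y1 \<in> F" "y2 \<in> F" "y1 \<noteq> y2" "dist y1 y2 \<le> 1"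
    using two_points[OF assms(1)] by blast
  define \<gamma> where "\<gamma> = dist y1 y2 / 3"
  have \<gamma>: "0 < \<gamma>" "\<gamma> \<le> 1" using y by (auto simp: \<gamma>_def)
  obtain W1 where W1: "W1 \<in> L" "W1 ` {0..1} \<subseteq> ball y1 \<gamma>" using approx[OF y(1) \<gamma>] by blast
  obtain W2 where W2: "W2 \<in> L" "W2 ` {0..1} \<subseteq> ball y2 \<gamma>" using approx[OF y(2) \<gamma>] by blast
  have gap: "\<gamma> \<le> \<bar>x1 - x2\<bar>" if "x1 \<in> W1 ` {0..1}" "x2 \<in> W2 ` {0..1}" for x1 x2
  proof -
    have "dist y1 x1 < \<gamma>" "dist y2 x2 < \<gamma>" using that W1(2) W2(2) by auto
    moreover have "dist y1 y2 = 3 * \<gamma>" by (simp add: \<gamma>_def)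
    ultimately show ?thesis by (simp add: dist_real_def abs_if split: if_splits)
  qed
  obtain P where P: "P \<in> L" "P ` {0..1} \<subseteq> ball y1 (1/4)" using approx[OF y(1), of "1/4"] by auto
  define q where "q = scaling P"
  have "P 0 \<in> ball y1 (1/4)" "P 1 \<in> ball y1 (1/4)" using P(2) by (auto simp: image_subset_iff)
  then have q: "0 < q" "q < 1"
    using pos[OF P(1)] by (auto simp: q_def scaling_def dist_real_def abs_if split: if_splits)
  \<comment> \<open>The factor \<open>\<gamma> / 4\<close> is the loss in \<open>lower\<close> below, and \<open>q\<close> the precision to which \<open>k\<close> can adjust the size.\<close>
  define \<kappa> where "\<kappa> = \<gamma> / 4 * q"
  have "\<kappa> \<le> 1 * 1" unfolding \<kappa>_def using \<gamma> q by (intro mult_mono) auto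
  then have \<kappa>: "0 < \<kappa>" "\<kappa> \<le> 1" using \<gamma> q by (auto simp: \<kappa>_def)
  have "\<exists>T\<in>L. \<exists>U\<in>L. (\<forall>x\<in>{0..1}. inv T (U x) - x \<in> {\<kappa> * \<tau>..\<tau>}) \<or>
        (\<forall>x\<in>{0..1}. x - inv T (U x) \<in> {\<kappa> * \<tau>..\<tau>})" if "0 < \<tau>" for \<tau>
  proof -
    \<comment> \<open>Small enough that the displacement still has to be magnified after passing to \<open>W1\<close> or \<open>W2\<close>.\<close>
    define \<eta> where "\<eta> = \<tau> * min (scaling W1) (scaling W2)"
    have "0 < \<eta>" using that pos W1(1) W2(1) by (simp add: \<eta>_def)
    then obtain T U where TU: "T \<in> L" "U \<in> L" "inv T \<circ> U \<noteq> id"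
      "\<bar>inv T (U 0)\<bar> < \<eta>" "\<bar>inv T (U 1) - 1\<bar> < \<eta>"
      using assms(2) unfolding near_coincidences_def by blast
    note simT = sim[OF TU(1)] and simU = sim[OF TU(2)]
    have simg: "similarity (inv T \<circ> U)" using similarity_comp similarity_inv simT simU by blast
    then obtain a b where "inv T \<circ> U = (\<lambda>x. a * x + b)" unfolding similarity_def by blast
    then have g: "inv T (U x) = a * x + b" for x by (metis comp_apply)
    define D where "D x = (a - 1) * x + b" for x
    have gD: "inv T (U x) - x = D x" for x by (simp add: g D_def algebra_simps)
    define M where "M = max \<bar>D 0\<bar> \<bar>D 1\<bar>"
    have "M < \<eta>" using TU(4,5) gD[of 0] gD[of 1] by (simp add: M_def)
    have "M \<noteq> 0"
    proof
      assume "M = 0"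
      then have "D 0 = 0" "D 1 = 0" by (auto simp: M_def max_def split: if_splits)
      then have "b = 0" "a = 1" by (auto simp: D_def)
      then have "inv T \<circ> U = id" using g by (auto simp: fun_eq_iff)
      then show False using TU(3) by simp
    qed
    moreover have "0 \<le> M" by (simp add: M_def)
    ultimately have "0 < M" by simp
    have upper: "\<bar>D x\<bar> \<le> M" if "x \<in> {0..1}" for x
    proof -
      have "D x = (1 - x) * D 0 + x * D 1" by (simp add: D_def algebra_simps)
      also have "\<bar>\<dots>\<bar> \<le> (1 - x) * \<bar>D 0\<bar> + x * \<bar>D 1\<bar>"
        using that abs_triangle_ineq[of "(1 - x) * D 0" "x * D 1"] by (simp add: abs_mult)
      also have "\<dots> \<le> (1 - x) * M + x * M"
        using that by (intro add_mono mult_left_mono) (auto simp: M_def)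
      finally show ?thesis by (simp add: algebra_simps)
    qed
    have "\<exists>W\<in>{W1, W2}. \<forall>x\<in>W ` {0..1}. \<gamma> / 4 * M \<le> \<bar>D x\<bar>"
    proof (rule ccontr)
      assume "\<not> ?thesis"
      then obtain x1 x2 where x: "x1 \<in> W1 ` {0..1}" "x2 \<in> W2 ` {0..1}"
        "\<bar>D x1\<bar> < \<gamma> / 4 * M" "\<bar>D x2\<bar> < \<gamma> / 4 * M"
        by (auto simp: not_le)
      have "\<bar>a - 1\<bar> * \<gamma> \<le> \<bar>a - 1\<bar> * \<bar>x1 - x2\<bar>"
        using gap[OF x(1,2)] by (intro mult_left_mono) auto
      also have "\<dots> = \<bar>D x1 - D x2\<bar>" by (simp add: D_def abs_mult[symmetric] algebra_simps)
      also have "\<dots> < \<gamma> * (M / 2)" using x(3,4) by (simp add: abs_if split: if_splits)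
      finally have a: "\<bar>a - 1\<bar> < M / 2" using \<gamma> by (simp add: mult.commute)
      have x1: "x1 \<in> {0..1}" using x(1) unit[OF W1(1)] by blast
      have "\<bar>D z\<bar> < M" if "z \<in> {0..1}" for z
      proof -
        have "D z - D x1 = (a - 1) * (z - x1)" by (simp add: D_def algebra_simps)
        moreover have "\<bar>a - 1\<bar> * \<bar>z - x1\<bar> \<le> \<bar>a - 1\<bar> * 1"
          using x1 that by (intro mult_left_mono) auto
        ultimately have "\<bar>D z - D x1\<bar> < M / 2" using a by (simp add: abs_mult)
        moreover have "\<gamma> / 4 * M \<le> 1 / 4 * M" using \<gamma> \<open>0 < M\<close> by (intro mult_right_mono) auto
        ultimately show ?thesis using x(3) by linarith
      qed
      from this[of 0] this[of 1] show False by (simp add: M_def max_def split: if_splits)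
    qed
    then obtain W where "W \<in> {W1, W2}" and lower: "\<And>x. x \<in> W ` {0..1} \<Longrightarrow> \<gamma> / 4 * M \<le> \<bar>D x\<bar>"
      by blast
    then have W: "W \<in> L" "\<eta> \<le> \<tau> * scaling W"
      using W1(1) W2(1) that by (auto simp: \<eta>_def)
    define \<theta> where "\<theta> = M / (scaling W * \<tau>)"
    have \<theta>: "0 < \<theta>" "\<theta> < 1"
      using \<open>0 < M\<close> \<open>M < \<eta>\<close> W pos[OF W(1)] that by (auto simp: \<theta>_def field_simps)
    \<comment> \<open>The last \<open>k\<close> with \<open>\<theta> \<le> q ^ k\<close>, so that \<open>M / scaling V\<close> lies in \<open>(q * \<tau>, \<tau>]\<close>.\<close>
    define n where "n = (LEAST n. q ^ n < \<theta>)"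
    have "\<exists>n. q ^ n < \<theta>" using real_arch_pow_inv[OF \<theta>(1) q(2)] .
    then have n: "q ^ n < \<theta>" unfolding n_def by (rule LeastI_ex)
    then have "n \<noteq> 0" using \<theta>(2) by (cases n) auto
    then obtain k where k: "n = Suc k" by (cases n) auto
    have "\<not> q ^ k < \<theta>" using not_less_Least[of k "\<lambda>n. q ^ n < \<theta>"] k unfolding n_def by simp
    then have k1: "\<theta> \<le> q ^ k" and k2: "q * q ^ k < \<theta>" using n k by auto
    define V where "V = W \<circ> P ^^ k"
    have V: "V \<in> L" unfolding V_def using comp_closed W(1) funpow_closed(1)[OF P(1)] by blast
    have sV: "scaling V = scaling W * q ^ k"
      unfolding V_def q_def
      using similarity_comp(2)[OF sim[OF W(1)] sim[OF funpow_closed(1)[OF P(1)]]] funpow_closed(2)[OF P(1)] by simp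
    have pV: "0 < scaling V" by (rule pos[OF V])
    have VW: "V x \<in> W ` {0..1}" if "x \<in> {0..1}" for x
    proof -
      have "(P ^^ k) x \<in> {0..1}" using unit[OF funpow_closed(1)[OF P(1), of k]] that by blast
      then show ?thesis by (simp add: V_def)
    qed
    have MV: "M \<le> \<tau> * scaling V" "\<tau> * scaling V * q \<le> M"
      using k1 k2 pos[OF W(1)] that by (auto simp: \<theta>_def sV field_simps)
    define h where "h x = inv (T \<circ> V) ((U \<circ> V) x)" for x
    have h: "h x = inv V (inv T (U (V x)))" for x
      using similarity_bij[OF simT] similarity_bij[OF sim[OF V]] by (simp add: h_def o_inv_distrib)
    have disp: "\<bar>h x - x\<bar> = \<bar>D (V x)\<bar> / scaling V" for x
    proof -
      have "dist (h x) (inv V (V x)) = 1 / scaling V * dist (inv T (U (V x))) (V x)"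
        unfolding h using dist_similarity[OF similarity_inv(1)[OF sim[OF V]]] similarity_inv(2)[OF sim[OF V]] by simp
      then show ?thesis using sim[OF V] by (simp add: dist_real_def gD)
    qed
    have bounds: "\<bar>h x - x\<bar> \<in> {\<kappa> * \<tau>..\<tau>}" if x: "x \<in> {0..1}" for x
    proof -
      have "V x \<in> {0..1}" using VW[OF x] unit[OF W(1)] by blast
      then have "\<bar>D (V x)\<bar> \<le> \<tau> * scaling V" using upper[of "V x"] MV(1) by simp
      moreover have "\<kappa> * \<tau> * scaling V \<le> \<bar>D (V x)\<bar>"
      proof -
        have "\<kappa> * \<tau> * scaling V = \<gamma> / 4 * (\<tau> * scaling V * q)" by (simp add: \<kappa>_def)
        also have "\<dots> \<le> \<gamma> / 4 * M" using MV(2) \<gamma> by (intro mult_left_mono) auto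
        also have "\<dots> \<le> \<bar>D (V x)\<bar>" by (rule lower[OF VW[OF x]])
        finally show ?thesis .
      qed
      ultimately show ?thesis using pV by (simp add: disp field_simps)
    qed
    have simh: "similarity h"
    proof -
      have "h = inv (T \<circ> V) \<circ> (U \<circ> V)" by (auto simp: h_def)
      then show ?thesis
        using similarity_comp(1) similarity_inv(1) simT simU sim[OF V] by metis
    qed
    have cont: "continuous_on A (\<lambda>x. h x - x)" for A
      by (intro continuous_on_diff continuous_on_similarity[OF simh] continuous_on_id)
    have nz: "h x - x \<noteq> 0" if "x \<in> {0..1}" for x
      using bounds[OF that] mult_pos_pos[OF \<kappa>(1) \<open>0 < \<tau>\<close>] by auto
    have "(\<forall>x\<in>{0..1}. 0 < h x - x) \<or> (\<forall>x\<in>{0..1}. h x - x < 0)"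
    proof (cases "0 < h 0 - 0")
      case True
      have "0 < h x - x" if "x \<in> {0..1}" for x
      proof (rule ccontr)
        assume "\<not> 0 < h x - x"
        then have "\<exists>z\<ge>0. z \<le> x \<and> h z - z = 0"
          using True that cont by (intro IVT2') auto
        then obtain z where "0 \<le> z" "z \<le> x" "h z - z = 0" by blast
        then show False using nz[of z] that by auto
      qed
      then show ?thesis by blast
    next
      case False
      have "h x - x < 0" if "x \<in> {0..1}" for x
      proof (rule ccontr)
        assume "\<not> h x - x < 0"
        then have "\<exists>z\<ge>0. z \<le> x \<and> h z - z = 0"
          using False that cont by (intro IVT') auto
        then obtain z where "0 \<le> z" "z \<le> x" "h z - z = 0" by blast
        then show False using nz[of z] that by auto
      qed
      then show ?thesis by blast
    qed
    then have "(\<forall>x\<in>{0..1}. h x - x \<in> {\<kappa> * \<tau>..\<tau>}) \<or> (\<forall>x\<in>{0..1}. x - h x \<in> {\<kappa> * \<tau>..\<tau>})"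
    proof
      assume p: "\<forall>x\<in>{0..1}. 0 < h x - x"
      have "h x - x \<in> {\<kappa> * \<tau>..\<tau>}" if "x \<in> {0..1}" for x
        using bounds[OF that] bspec[OF p that] by simp
      then show ?thesis by blast
    next
      assume p: "\<forall>x\<in>{0..1}. h x - x < 0"
      have "x - h x \<in> {\<kappa> * \<tau>..\<tau>}" if "x \<in> {0..1}" for x
        using bounds[OF that] bspec[OF p that] by simp
      then show ?thesis by blast
    qed
    then show ?thesis
      using comp_closed[OF TU(1) V] comp_closed[OF TU(2) V] unfolding h_def by blast
  qed
  with \<kappa> that show ?thesis by blast
qed

text \<open>
  Given such a set \<open>Y\<close> with gaps of size about \<open>\<mu>\<close>, choose \<open>T\<close>, \<open>U\<close> with displacement of size about \<open>\<mu>\<close> on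
  \<open>[0,1]\<close>. If points move to the right, \<open>T\<^sup>-\<^sup>1 (U (Max Y))\<close> extends \<open>Y\<close> by one more gap; if they move to
  the left, \<open>T\<^sup>-\<^sup>1 (U (Min Y))\<close> does. The extended set need not lie in \<open>F\<close>, but its image under \<open>T\<close> does, and
  this image is similar to it.
\<close>

lemma near_progressions:
  assumes "\<not> is_singleton F" near_coincidences
  obtains \<kappa> where "0 < \<kappa>" "\<kappa> \<le> 1"
    "\<And>n. \<exists>Y \<mu>. 0 < \<mu> \<and> \<mu> \<le> 1 \<and> finite Y \<and> Y \<subseteq> F \<and> card Y = Suc n \<and> separated (\<kappa> * \<mu>) Y \<and>
        (\<forall>x\<in>Y. \<forall>y\<in>Y. dist x y \<le> real n * \<mu>)"
proof -
  obtain \<kappa> where \<kappa>: "0 < \<kappa>" "\<kappa> \<le> 1"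
    and disp: "\<And>\<tau>. 0 < \<tau> \<Longrightarrow> \<exists>T\<in>L. \<exists>U\<in>L. (\<forall>x\<in>{0..1}. inv T (U x) - x \<in> {\<kappa> * \<tau>..\<tau>}) \<or>
        (\<forall>x\<in>{0..1}. x - inv T (U x) \<in> {\<kappa> * \<tau>..\<tau>})"
    using uniform_displacement[OF assms] by blast
  have "\<exists>Y \<mu>. 0 < \<mu> \<and> \<mu> \<le> 1 \<and> finite Y \<and> Y \<subseteq> F \<and> card Y = Suc n \<and> separated (\<kappa> * \<mu>) Y \<and>
        (\<forall>x\<in>Y. \<forall>y\<in>Y. dist x y \<le> real n * \<mu>)" for n
  proof (induction n)
    case 0
    obtain y where "y \<in> F" using nonempty by blast
    then show ?case
      by (intro exI[of _ "{y}"] exI[of _ 1]) (auto simp: separated_def)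
  next
    case (Suc n)
    then obtain Y \<mu> where \<mu>: "0 < \<mu>" "\<mu> \<le> 1" and Y: "finite Y" "Y \<subseteq> F" "card Y = Suc n"
        "separated (\<kappa> * \<mu>) Y" and diam: "\<And>x y. x \<in> Y \<Longrightarrow> y \<in> Y \<Longrightarrow> dist x y \<le> real n * \<mu>"
      by blast
    have "Y \<noteq> {}" using Y(3) by auto
    have YI: "y \<in> {0..1}" if "y \<in> Y" for y using that Y(2) sub_unit by blast
    obtain T U where TU: "T \<in> L" "U \<in> L" and
      D: "(\<forall>x\<in>{0..1}. inv T (U x) - x \<in> {\<kappa> * \<mu>..\<mu>}) \<or> (\<forall>x\<in>{0..1}. x - inv T (U x) \<in> {\<kappa> * \<mu>..\<mu>})"
      using disp[OF \<mu>(1)] by blast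
    have "\<exists>m\<in>Y. \<forall>y\<in>Y. dist (inv T (U m)) y \<in> {\<kappa> * \<mu>..real (Suc n) * \<mu>}"
      using D
    proof
      assume D: "\<forall>x\<in>{0..1}. inv T (U x) - x \<in> {\<kappa> * \<mu>..\<mu>}"
      define m where "m = Max Y"
      have m: "m \<in> Y" using Y(1) \<open>Y \<noteq> {}\<close> by (simp add: m_def)
      have Dm: "inv T (U m) - m \<in> {\<kappa> * \<mu>..\<mu>}" using D YI[OF m] by blast
      have "dist (inv T (U m)) y \<in> {\<kappa> * \<mu>..real (Suc n) * \<mu>}" if y: "y \<in> Y" for y
      proof -
        have "y \<le> m" using Y(1) y by (simp add: m_def)
        moreover have "m - y \<le> real n * \<mu>" using diam[OF m y] by (simp add: dist_real_def)
        moreover have "0 < \<kappa> * \<mu>" using \<kappa> \<mu> by simp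
        ultimately show ?thesis using Dm by (simp add: dist_real_def algebra_simps)
      qed
      with m show ?thesis by blast
    next
      assume D: "\<forall>x\<in>{0..1}. x - inv T (U x) \<in> {\<kappa> * \<mu>..\<mu>}"
      define m where "m = Min Y"
      have m: "m \<in> Y" using Y(1) \<open>Y \<noteq> {}\<close> by (simp add: m_def)
      have Dm: "m - inv T (U m) \<in> {\<kappa> * \<mu>..\<mu>}" using D YI[OF m] by blast
      have "dist (inv T (U m)) y \<in> {\<kappa> * \<mu>..real (Suc n) * \<mu>}" if y: "y \<in> Y" for y
      proof -
        have "m \<le> y" using Y(1) y by (simp add: m_def)
        moreover have "y - m \<le> real n * \<mu>" using diam[OF m y] by (simp add: dist_real_def)
        moreover have "0 < \<kappa> * \<mu>" using \<kappa> \<mu> by simp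
        ultimately show ?thesis using Dm by (simp add: dist_real_def algebra_simps)
      qed
      with m show ?thesis by blast
    qed
    then obtain m where m: "m \<in> Y" and new: "\<And>y. y \<in> Y \<Longrightarrow> dist (inv T (U m)) y \<in> {\<kappa> * \<mu>..real (Suc n) * \<mu>}"
      by blast
    define z where "z = inv T (U m)"
    have Tz: "T z = U m" using sim[OF TU(1)] by (simp add: z_def)
    have "0 < \<kappa> * \<mu>" using \<kappa> \<mu> by simp
    have "z \<notin> Y" using new[of z] \<open>0 < \<kappa> * \<mu>\<close> unfolding z_def[symmetric] by auto
    define Z where "Z = insert z Y"
    have Zsep: "\<kappa> * \<mu> \<le> dist x y" if "x \<in> Z" "y \<in> Z" "x \<noteq> y" for x y
      using that Y(4) new unfolding Z_def z_def[symmetric] separated_def by (auto simp: dist_commute)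
    have Zdiam: "dist x y \<le> real (Suc n) * \<mu>" if "x \<in> Z" "y \<in> Z" for x y
    proof -
      have "real n * \<mu> \<le> real (Suc n) * \<mu>" "0 \<le> real (Suc n) * \<mu>" using \<mu> by auto
      then show ?thesis
        using that diam new unfolding Z_def z_def[symmetric]
        by (auto simp: dist_commute) (meson order_trans)+
    qed
    define \<mu>' where "\<mu>' = scaling T * \<mu>"
    have dT: "dist (T x) (T y) = scaling T * dist x y" for x y
      by (rule dist_similarity[OF sim[OF TU(1)]])
    have pT: "0 < scaling T" by (rule pos[OF TU(1)])
    have "\<mu>' \<le> 1 * 1" unfolding \<mu>'_def
      using \<mu> scaling_le_1[OF TU(1)] pT by (intro mult_mono) auto
    moreover have "0 < \<mu>'" using \<mu> pT by (simp add: \<mu>'_def)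
    moreover have "finite (T ` Z)" using Y(1) by (simp add: Z_def)
    moreover have "T ` Z \<subseteq> F"
    proof -
      have "T ` Y \<subseteq> F" using invariant[OF TU(1)] Y(2) by blast
      moreover have "T z \<in> F" unfolding Tz using invariant[OF TU(2)] Y(2) m by blast
      ultimately show ?thesis by (simp add: Z_def)
    qed
    moreover have "card (T ` Z) = Suc (Suc n)"
    proof -
      have "inj_on T Z" using similarity_bij[OF sim[OF TU(1)]] by (meson bij_is_inj inj_on_subset subset_UNIV)
      then show ?thesis using \<open>z \<notin> Y\<close> Y by (simp add: card_image Z_def)
    qed
    moreover have "separated (\<kappa> * \<mu>') (T ` Z)"
      unfolding separated_def
    proof (intro ballI impI)
      fix x y assume "x \<in> T ` Z" "y \<in> T ` Z" "x \<noteq> y"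
      then obtain x' y' where xy: "x' \<in> Z" "y' \<in> Z" "x' \<noteq> y'" "x = T x'" "y = T y'" by blast
      show "\<kappa> * \<mu>' \<le> dist x y"
        unfolding xy dT \<mu>'_def
        using mult_left_mono[OF Zsep[OF xy(1-3)], of "scaling T"] pT by (simp add: mult_ac)
    qed
    moreover have "dist x y \<le> real (Suc n) * \<mu>'" if TZ: "x \<in> T ` Z" "y \<in> T ` Z" for x y
    proof -
      obtain x' y' where xy: "x' \<in> Z" "y' \<in> Z" "x = T x'" "y = T y'" using TZ by blast
      show ?thesis
        unfolding xy dT \<mu>'_def
        using mult_left_mono[OF Zdiam[OF xy(1,2)], of "scaling T"] pT by (simp add: mult_ac)
    qed
    ultimately show ?case by (intro exI[of _ "T ` Z"] exI[of _ \<mu>']) simp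
  qed
  with \<kappa> that show ?thesis by blast
qed

text \<open>
  The ball of radius \<open>(n + 1) \<mu>\<close> around a point of a progression contains \<open>n + 1\<close> points with mutual
  distances at least \<open>\<kappa> \<mu>\<close>. An exponent \<open>t\<close> thus satisfies \<open>n + 1 \<le> K (n + 1)\<^sup>t\<close> for all \<open>n\<close>, with a
  constant \<open>K\<close>.
\<close>

lemma one_le_assouad_exponent:
  assumes "\<not> is_singleton F" near_coincidences "assouad_exponent t F"
  shows "1 \<le> t"
proof (rule ccontr)
  assume "\<not> 1 \<le> t"
  obtain \<kappa> where \<kappa>: "0 < \<kappa>" "\<kappa> \<le> 1"
    and prog: "\<And>n. \<exists>Y \<mu>. 0 < \<mu> \<and> \<mu> \<le> 1 \<and> finite Y \<and> Y \<subseteq> F \<and> card Y = Suc n \<and> separated (\<kappa> * \<mu>) Y \<and>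
        (\<forall>x\<in>Y. \<forall>y\<in>Y. dist x y \<le> real n * \<mu>)"
    using near_progressions[OF assms(1,2)] by blast
  obtain C where "C > 0" and C: "\<And>R r x. 0 < r \<Longrightarrow> r < R \<Longrightarrow> x \<in> F \<Longrightarrow>
      real (covering_number r (ball x R \<inter> F)) \<le> C * (R / r) powr t"
    using assms(3) unfolding assouad_exponent_def by fastforce
  define K where "K = C * (2 / \<kappa>) powr t"
  have "0 < K" using \<open>0 < C\<close> \<kappa> by (simp add: K_def)
  have bound: "real (Suc n) powr (1 - t) \<le> K" for n
  proof -
    obtain Y \<mu> where \<mu>: "0 < \<mu>" and Y: "finite Y" "Y \<subseteq> F" "card Y = Suc n"
        "separated (\<kappa> * \<mu>) Y" and diam: "\<And>x y. x \<in> Y \<Longrightarrow> y \<in> Y \<Longrightarrow> dist x y \<le> real n * \<mu>"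
      using prog[of n] by blast
    obtain x where x: "x \<in> Y" using Y(3) by fastforce
    define R where "R = real (Suc n) * \<mu>"
    define r where "r = \<kappa> * \<mu> / 2"
    have "0 < r" using \<kappa> \<mu> by (simp add: r_def)
    have "\<kappa> * \<mu> \<le> 1 * \<mu>" using \<kappa> \<mu> by (intro mult_right_mono) auto
    moreover have "1 * \<mu> \<le> R" unfolding R_def using \<mu> by (intro mult_right_mono) auto
    ultimately have "r < R" using \<open>0 < r\<close> unfolding r_def by linarith
    have "Y \<subseteq> ball x R \<inter> F"
    proof
      fix y assume "y \<in> Y"
      have "dist x y \<le> real n * \<mu>" using diam[OF x \<open>y \<in> Y\<close>] .
      also have "\<dots> < R" using \<mu> by (simp add: R_def)
      finally show "y \<in> ball x R \<inter> F" using \<open>y \<in> Y\<close> Y(2) by auto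
    qed
    moreover have "bounded (ball x R \<inter> F)" by (simp add: bounded_Int)
    ultimately have "real (Suc n) \<le> real (covering_number r (ball x R \<inter> F))"
      using card_separated_le_covering_number[of "ball x R \<inter> F" r "\<kappa> * \<mu>" Y] \<open>0 < r\<close> Y(3,4)
      by (simp add: r_def del: of_nat_Suc)
    also have "\<dots> \<le> C * (R / r) powr t" using C \<open>0 < r\<close> \<open>r < R\<close> x Y(2) by blast
    also have "R / r = (2 / \<kappa>) * real (Suc n)" using \<mu> by (simp add: R_def r_def)
    also have "C * ((2 / \<kappa>) * real (Suc n)) powr t = K * real (Suc n) powr t"
      unfolding K_def using \<kappa> by (subst powr_mult) auto
    finally have "real (Suc n) / real (Suc n) powr t \<le> K" by (simp add: field_simps)
    then show ?thesis by (simp add: powr_diff)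
  qed
  obtain n where n: "(K + 1) powr (1 / (1 - t)) < real n" using reals_Archimedean2 by blast
  have "K + 1 = ((K + 1) powr (1 / (1 - t))) powr (1 - t)"
    using \<open>\<not> 1 \<le> t\<close> \<open>0 < K\<close> by (simp add: powr_powr)
  also have "\<dots> \<le> real (Suc n) powr (1 - t)"
    using n \<open>\<not> 1 \<le> t\<close> by (intro powr_mono2) auto
  also have "\<dots> \<le> K" by (rule bound)
  finally show False by simp
qed

definition packed_in :: "real set \<Rightarrow> 'i set \<Rightarrow> ('i \<Rightarrow> real \<Rightarrow> real) \<Rightarrow> bool" where
  "packed_in J I T \<longleftrightarrow> finite I \<and> (\<forall>i\<in>I. T i \<in> L \<and> T i ` {0..1} \<subseteq> J) \<and>
    disjoint_family_on (\<lambda>i. T i ` {0..1}) I"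

text \<open>
  Place a piece of size about \<open>\<mu>\<close> near each point of a progression with \<open>n + 1\<close> points and gaps about \<open>\<mu>\<close>.
  Their sum of \<open>s\<close>-th powers is of order \<open>(n + 1) \<mu>\<^sup>s\<close>, while the interval \<open>J\<close> containing them has length of order
  \<open>(n + 1) \<mu>\<close>. The quotient \<open>(n + 1)\<^sup>s\<^sup>-\<^sup>1\<close> tends to \<open>0\<close> because \<open>s < 1\<close>.
\<close>

lemma dense_clusters:
  assumes "\<not> is_singleton F" near_coincidences "hausdorff_dim F \<le> s" "s < 1" "0 < \<theta>"
  shows "\<exists>(Y :: real set) T J y R. packed_in J Y T \<and> J \<subseteq> {0..1} \<and> J \<subseteq> cball y R \<and> J \<noteq> {} \<and> 0 < R \<and>
    R powr s \<le> \<theta> * (\<Sum>z\<in>Y. scaling (T z) powr s)"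
proof -
  obtain \<kappa> where \<kappa>: "0 < \<kappa>" "\<kappa> \<le> 1"
    and prog: "\<And>n. \<exists>Y \<mu>. 0 < \<mu> \<and> \<mu> \<le> 1 \<and> finite Y \<and> Y \<subseteq> F \<and> card Y = Suc n \<and> separated (\<kappa> * \<mu>) Y \<and>
        (\<forall>x\<in>Y. \<forall>y\<in>Y. dist x y \<le> real n * \<mu>)"
    using near_progressions[OF assms(1,2)] by blast
  have "0 < s" by (rule dim_pos[OF assms(1,3)])
  define K where "K = (2 / (\<rho> * \<kappa>)) powr s"
  have "0 < K" using \<rho>_pos \<kappa> by (simp add: K_def)
  obtain n where n: "(K / \<theta>) powr (1 / (1 - s)) < real n" using reals_Archimedean2 by blast
  have "K / \<theta> = ((K / \<theta>) powr (1 / (1 - s))) powr (1 - s)"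
    using \<open>s < 1\<close> \<open>0 < K\<close> \<open>0 < \<theta>\<close> by (simp add: powr_powr)
  also have "\<dots> \<le> real (Suc n) powr (1 - s)"
    using n \<open>s < 1\<close> by (intro powr_mono2) auto
  also have "\<dots> = real (Suc n) / real (Suc n) powr s" by (simp add: powr_diff)
  finally have nK: "real (Suc n) powr s * K \<le> \<theta> * real (Suc n)"
    using \<open>0 < \<theta>\<close> by (simp add: field_simps)
  obtain Y \<mu> where \<mu>: "0 < \<mu>" "\<mu> \<le> 1" and Y: "finite Y" "Y \<subseteq> F" "card Y = Suc n"
      "separated (\<kappa> * \<mu>) Y" and diam: "\<And>x y. x \<in> Y \<Longrightarrow> y \<in> Y \<Longrightarrow> dist x y \<le> real n * \<mu>"
    using prog[of n] by blast
  have \<kappa>\<mu>: "0 < \<kappa> * \<mu>" "\<kappa> * \<mu> \<le> 1 * \<mu>" using \<kappa> \<mu> by simp_all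
  then have "\<kappa> * \<mu> \<le> 1" using \<mu> by linarith
  obtain T where T: "\<And>z. z \<in> Y \<Longrightarrow> T z \<in> L" "\<And>z. z \<in> Y \<Longrightarrow> T z ` {0..1} \<subseteq> ball z (\<kappa> * \<mu> / 2)"
    "\<And>z. z \<in> Y \<Longrightarrow> \<rho> * (\<kappa> * \<mu>) / 2 \<le> scaling (T z)" "disjoint_family_on (\<lambda>z. T z ` {0..1}) Y"
    using separated_pieces[OF Y(2,4) \<kappa>\<mu>(1) \<open>\<kappa> * \<mu> \<le> 1\<close>] by blast
  obtain y where y: "y \<in> Y" using Y(3) by fastforce
  define R where "R = real (Suc n) * \<mu>"
  define J where "J = cball y R \<inter> {0..1}"
  have TJ: "T z ` {0..1} \<subseteq> J" if z: "z \<in> Y" for z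
  proof -
    have "ball z (\<kappa> * \<mu> / 2) \<subseteq> cball y R"
    proof
      fix x assume "x \<in> ball z (\<kappa> * \<mu> / 2)"
      then have "dist y x \<le> real n * \<mu> + \<kappa> * \<mu> / 2"
        using dist_triangle[of y x z] diam[OF y z] by simp
      also have "\<dots> \<le> R" using \<kappa>\<mu> \<mu> by (simp add: R_def algebra_simps)
      finally show "x \<in> cball y R" by simp
    qed
    then show ?thesis using T(2)[OF z] unit[OF T(1)[OF z]] unfolding J_def by blast
  qed
  have "R powr s = real (Suc n) powr s * \<mu> powr s"
    unfolding R_def using \<mu> by (subst powr_mult) auto
  also have "\<mu> powr s = K * (\<rho> * (\<kappa> * \<mu>) / 2) powr s"
    unfolding K_def using \<rho>_pos \<kappa> \<mu> by (subst powr_mult[symmetric]) auto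
  also have "real (Suc n) powr s * (K * (\<rho> * (\<kappa> * \<mu>) / 2) powr s) \<le>
      \<theta> * real (Suc n) * (\<rho> * (\<kappa> * \<mu>) / 2) powr s"
    using mult_right_mono[OF nK, of "(\<rho> * (\<kappa> * \<mu>) / 2) powr s"] by (simp add: mult_ac)
  also have "\<dots> = \<theta> * (\<Sum>z\<in>Y. (\<rho> * (\<kappa> * \<mu>) / 2) powr s)"
    using Y(3) by simp
  also have "\<dots> \<le> \<theta> * (\<Sum>z\<in>Y. scaling (T z) powr s)"
    using T(3) \<rho>_pos \<kappa>\<mu> \<open>0 < s\<close> \<open>0 < \<theta>\<close> by (intro mult_left_mono sum_mono powr_mono2) auto
  finally have "R powr s \<le> \<theta> * (\<Sum>z\<in>Y. scaling (T z) powr s)" .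
  moreover have "J \<noteq> {}" using TJ[OF y] by auto
  moreover have "0 < R" using \<mu> by (simp add: R_def)
  ultimately show ?thesis
    using Y(1) T(1,4) TJ
    by (intro exI[of _ Y] exI[of _ T] exI[of _ J] exI[of _ y] exI[of _ R]) (simp add: J_def packed_in_def)
qed

text \<open>
  Let \<open>J\<close> be an interval as in \<open>dense_clusters\<close>, and \<open>a\<close> the sum of \<open>ratio\<^sup>s\<close> over the pieces packed in it.
  Let \<open>A\<close> be a finite set of maps such that the copies \<open>f J\<close> with \<open>f \<in> A\<close> are disjoint. Packing the pieces
  in all copies shows \<open>a * (\<Sum>f\<in>A. ratio\<^sup>s) \<le> 1\<close>, so the copies are covered at a cost of at most a small
  constant. Choose \<open>A\<close> with \<open>\<Sum>f\<in>A. ratio\<^sup>s\<close> within \<open>e\<close> of its supremum. Small pieces near the points of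
  \<open>F\<close> that stay away from all copies contain further disjoint copies of \<open>J\<close>. They could be added to
  \<open>A\<close>, so their \<open>\<Sum> ratio\<^sup>s\<close> is less than \<open>e\<close>, and this is also the order of the cost of covering those points.
\<close>

lemma small_covers_at_dimension:
  assumes "\<not> is_singleton F" near_coincidences "hausdorff_dim F \<le> s" "s < 1"
  shows "small_covers s F"
  unfolding small_covers_def
proof (intro allI impI)
  fix \<epsilon> :: real assume "0 < \<epsilon>"
  have "0 < s" by (rule dim_pos[OF assms(1,3)])
  define K where "K = (2 / \<rho>) powr s"
  have "0 < K" using \<rho>_pos by (simp add: K_def)
  define e where "e = \<epsilon> / 2 / (K + 1)"
  have "0 < e" using \<open>0 < \<epsilon>\<close> \<open>0 < K\<close> by (simp add: e_def)
  have eK: "e * (K + 1) = \<epsilon> / 2"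
    by (rule nonzero_eq_divide_eq[THEN iffD1, OF _ e_def]) (use \<open>0 < K\<close> in simp)
  have "0 < \<epsilon> / 4" using \<open>0 < \<epsilon>\<close> by simp
  obtain Y :: "real set" and T J y R where "packed_in J Y T"
    and J: "J \<subseteq> {0..1}" "J \<subseteq> cball y R" "J \<noteq> {}" and "0 < R"
    and dense: "R powr s \<le> \<epsilon> / 4 * (\<Sum>z\<in>Y. scaling (T z) powr s)"
    using dense_clusters[OF assms \<open>0 < \<epsilon> / 4\<close>] by blast
  then have Y: "finite Y" and TYJ: "\<forall>z\<in>Y. T z \<in> L \<and> T z ` {0..1} \<subseteq> J"
    and Tdisj: "disjoint_family_on (\<lambda>z. T z ` {0..1}) Y"
    by (simp_all add: packed_in_def)
  have T: "T z \<in> L" and TJ: "T z ` {0..1} \<subseteq> J" if "z \<in> Y" for z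
    using bspec[OF TYJ that] by simp_all
  define a where "a = (\<Sum>z\<in>Y. scaling (T z) powr s)"
  have "0 < R powr s" using \<open>0 < R\<close> by simp
  also note dense[folded a_def]
  finally have "0 < a" using \<open>0 < \<epsilon>\<close> by (simp add: zero_less_mult_iff)
  define good where "good A \<longleftrightarrow> finite A \<and> A \<subseteq> L \<and> disjoint_family_on (\<lambda>f. f ` J) A" for A
  define v where "v A = (\<Sum>f\<in>A. scaling f powr s)" for A
  have va: "v A * a \<le> 1" if "good A" for A
  proof -
    have A: "finite A" "A \<subseteq> L" "disjoint_family_on (\<lambda>f. f ` J) A" using that by (auto simp: good_def)
    have AL: "f \<in> L" if "f \<in> A" for f using A(2) that by blast
    have "(\<Sum>(f, z)\<in>A \<times> Y. scaling (f \<circ> T z) powr s) \<le> 1"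
    proof -
      have "disjoint_family_on (\<lambda>p. (fst p \<circ> T (snd p)) ` {0..1}) (A \<times> Y)"
        unfolding disjoint_family_on_def
      proof (intro ballI impI)
        fix p q assume p: "p \<in> A \<times> Y" and q: "q \<in> A \<times> Y" and "p \<noteq> q"
        obtain f z g w where pq: "p = (f, z)" "q = (g, w)" by (cases p, cases q) blast
        have fz: "f \<in> A" "z \<in> Y" "g \<in> A" "w \<in> Y" using p q pq by auto
        show "(fst p \<circ> T (snd p)) ` {0..1} \<inter> (fst q \<circ> T (snd q)) ` {0..1} = {}"
        proof (cases "f = g")
          case True
          then have "T z ` {0..1} \<inter> T w ` {0..1} = {}"
            using Tdisj fz \<open>p \<noteq> q\<close> pq by (auto simp: disjoint_family_on_def)
          moreover have "inj f" using similarity_bij[OF sim[OF AL[OF fz(1)]]] by (rule bij_is_inj)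
          ultimately have "f ` T z ` {0..1} \<inter> f ` T w ` {0..1} = {}"
            by (metis image_Int image_empty)
          then show ?thesis by (simp add: pq True image_comp)
        next
          case False
          then have "f ` J \<inter> g ` J = {}" using A(3) fz by (auto simp: disjoint_family_on_def)
          moreover have "f ` T z ` {0..1} \<subseteq> f ` J" "g ` T w ` {0..1} \<subseteq> g ` J"
            using TJ fz by (auto intro!: image_mono)
          ultimately show ?thesis unfolding pq fst_conv snd_conv image_comp[symmetric] by blast
        qed
      qed
      moreover have "fst p \<circ> T (snd p) \<in> L" if "p \<in> A \<times> Y" for p
        using that comp_closed AL T by auto
      ultimately have "(\<Sum>p\<in>A \<times> Y. scaling (fst p \<circ> T (snd p)) powr s) \<le> 1"
        using packing[OF assms(3), of "A \<times> Y" "\<lambda>p. fst p \<circ> T (snd p)"] A(1) Y by simp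
      then show ?thesis by (simp add: case_prod_beta)
    qed
    also have "(\<Sum>(f, z)\<in>A \<times> Y. scaling (f \<circ> T z) powr s) =
        (\<Sum>f\<in>A. \<Sum>z\<in>Y. scaling f powr s * scaling (T z) powr s)"
      unfolding sum.cartesian_product
    proof (rule sum.cong[OF refl], clarify)
      fix f z assume "f \<in> A" "z \<in> Y"
      then show "scaling (f \<circ> T z) powr s = scaling f powr s * scaling (T z) powr s"
        using similarity_comp(2)[OF sim[OF AL] sim[OF T]] pos[OF AL] pos[OF T]
        by (simp add: powr_mult less_imp_le)
    qed
    also have "\<dots> = v A * a" by (simp add: v_def a_def sum_product)
    finally show ?thesis .
  qed
  define V where "V = (SUP A\<in>Collect good. v A)"
  have bdd: "bdd_above (v ` Collect good)"
    using va \<open>0 < a\<close> by (intro bdd_aboveI[of _ "1 / a"]) (auto simp: field_simps)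
  have "good {}" by (simp add: good_def disjoint_family_on_def)
  then have "v ` Collect good \<noteq> {}" by blast
  then obtain A where A: "good A" and "V - e < v A"
    using less_cSup_iff[OF _ bdd, of "V - e"] \<open>0 < e\<close> unfolding V_def by auto
  then have near: "v A' < v A + e" if "good A'" for A'
    using cSUP_upper[OF _ bdd, of A'] that unfolding V_def by simp
  have finA: "finite A" and AL: "\<And>f. f \<in> A \<Longrightarrow> f \<in> L" and Adisj: "disjoint_family_on (\<lambda>f. f ` J) A"
    using A by (auto simp: good_def)
  have "((\<lambda>\<delta>. \<Sum>f\<in>A. (scaling f * R + 2 * \<delta>) powr s) \<longlongrightarrow> (\<Sum>f\<in>A. (scaling f * R + 2 * 0) powr s)) (at_right 0)"
    using pos[OF AL] \<open>0 < R\<close>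
    by (intro tendsto_sum tendsto_powr tendsto_intros) force
  then have "\<forall>\<^sub>F \<delta> in at_right 0. (\<Sum>f\<in>A. (scaling f * R + 2 * \<delta>) powr s) < (\<Sum>f\<in>A. (scaling f * R) powr s) + e"
    using \<open>0 < e\<close> by (intro order_tendstoD(2)) auto
  moreover have "\<forall>\<^sub>F \<delta> in at_right 0. \<delta> \<in> {0<..<1::real}"
    by (rule eventually_at_right_real) simp
  ultimately have "\<forall>\<^sub>F \<delta> in at_right 0. (\<Sum>f\<in>A. (scaling f * R + 2 * \<delta>) powr s) < (\<Sum>f\<in>A. (scaling f * R) powr s) + e
      \<and> \<delta> \<in> {0<..<1::real}" by (rule eventually_conj)
  then obtain \<delta> where \<delta>: "0 < \<delta>" "\<delta> \<le> 1"
    and \<delta>sum: "(\<Sum>f\<in>A. (scaling f * R + 2 * \<delta>) powr s) < (\<Sum>f\<in>A. (scaling f * R) powr s) + e"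
    using eventually_happens'[OF trivial_limit_at_right_real] by force
  define E where "E = {x \<in> F. \<forall>f\<in>A. \<forall>y\<in>f ` J. \<delta> \<le> dist y x}"
  have "E \<subseteq> F" by (auto simp: E_def)
  obtain Z where Z: "finite Z" "Z \<subseteq> E" "separated \<delta> Z" "E \<subseteq> (\<Union>z\<in>Z. ball z \<delta>)"
    using separated_net[OF assms(3) \<delta> \<open>E \<subseteq> F\<close>] by blast
  have "Z \<subseteq> F" using Z(2) \<open>E \<subseteq> F\<close> by blast
  obtain P where P: "\<And>z. z \<in> Z \<Longrightarrow> P z \<in> L" "\<And>z. z \<in> Z \<Longrightarrow> P z ` {0..1} \<subseteq> ball z (\<delta> / 2)"
    "\<And>z. z \<in> Z \<Longrightarrow> \<rho> * \<delta> / 2 \<le> scaling (P z)" "disjoint_family_on (\<lambda>z. P z ` {0..1}) Z"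
    using separated_pieces[OF \<open>Z \<subseteq> F\<close> Z(3) \<delta>] by blast
  have PJ: "P z ` J \<subseteq> P z ` {0..1}" for z using J(1) by blast
  have Pdisj: "P z ` J \<inter> P w ` J = {}" if "z \<in> Z" "w \<in> Z" "z \<noteq> w" for z w
  proof -
    have "P z ` {0..1} \<inter> P w ` {0..1} = {}" using P(4) that by (auto simp: disjoint_family_on_def)
    then show ?thesis using PJ[of z] PJ[of w] by blast
  qed
  have PA: "P z ` J \<inter> f ` J = {}" if z: "z \<in> Z" and f: "f \<in> A" for z f
  proof (rule ccontr)
    assume "P z ` J \<inter> f ` J \<noteq> {}"
    then obtain x where x: "x \<in> P z ` J" "x \<in> f ` J" by blast
    then have "dist z x < \<delta> / 2" using P(2)[OF z] PJ[of z] by force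
    moreover have "\<delta> \<le> dist x z" using x(2) f z Z(2) unfolding E_def by blast
    ultimately show False using \<delta>(1) by (simp add: dist_commute)
  qed
  have injP: "inj_on P Z"
    using Pdisj J(3) unfolding inj_on_def by (metis Int_absorb image_is_empty)
  have "A \<inter> P ` Z = {}"
    using PA J(3) by (auto simp: disjoint_iff)
  have "good (A \<union> P ` Z)"
    unfolding good_def
  proof (intro conjI)
    show "finite (A \<union> P ` Z)" using finA Z(1) by simp
    show "A \<union> P ` Z \<subseteq> L" using AL P(1) by blast
    show "disjoint_family_on (\<lambda>f. f ` J) (A \<union> P ` Z)"
      unfolding disjoint_family_on_def
    proof (intro ballI impI)
      fix f g assume fg: "f \<in> A \<union> P ` Z" "g \<in> A \<union> P ` Z" "f \<noteq> g"
      consider "f \<in> A" "g \<in> A" | z where "f \<in> A" "z \<in> Z" "g = P z" | z where "g \<in> A" "z \<in> Z" "f = P z"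
        | z w where "z \<in> Z" "w \<in> Z" "f = P z" "g = P w" using fg(1,2) by blast
      then show "f ` J \<inter> g ` J = {}"
      proof cases
        case 1 then show ?thesis using Adisj fg(3) by (simp add: disjoint_family_on_def)
      next
        case 2 then show ?thesis using PA[of z f] by blast
      next
        case 3 then show ?thesis using PA[of z g] by blast
      next
        case 4 then show ?thesis using Pdisj[of z w] fg(3) by blast
      qed
    qed
  qed
  then have "v (A \<union> P ` Z) < v A + e" by (rule near)
  moreover have "v (A \<union> P ` Z) = v A + (\<Sum>z\<in>Z. scaling (P z) powr s)"
    unfolding v_def using finA Z(1) \<open>A \<inter> P ` Z = {}\<close> injP
    by (simp add: sum.union_disjoint sum.reindex)
  moreover have "(\<Sum>z\<in>Z. (\<rho> * \<delta> / 2) powr s) \<le> (\<Sum>z\<in>Z. scaling (P z) powr s)"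
    using P(3) \<rho>_pos \<delta> \<open>0 < s\<close> by (intro sum_mono powr_mono2) auto
  ultimately have "(\<Sum>z\<in>Z. (\<rho> * \<delta> / 2) powr s) < e" by simp
  then have "K * (\<Sum>z\<in>Z. (\<rho> * \<delta> / 2) powr s) < K * e" using \<open>0 < K\<close> by simp
  also have "K * (\<Sum>z\<in>Z. (\<rho> * \<delta> / 2) powr s) = (\<Sum>z\<in>Z. \<delta> powr s)"
  proof -
    have "K * (\<rho> * \<delta> / 2) powr s = \<delta> powr s"
      unfolding K_def using \<rho>_pos \<delta> by (subst powr_mult[symmetric]) auto
    then show ?thesis by (simp add: sum_distrib_left)
  qed
  finally have sumZ: "(\<Sum>z\<in>Z. \<delta> powr s) < K * e" .
  obtain B1 where B1: "ball_cover B1 E" "ball_sum s B1 \<le> (\<Sum>z\<in>Z. \<delta> powr s)"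
    using ball_cover_family[OF Z(1), of "\<lambda>_. \<delta>" E "\<lambda>z. z" s] \<delta>(1) Z(4) by blast
  have "F - E \<subseteq> (\<Union>f\<in>A. ball (f y) (scaling f * R + 2 * \<delta>))"
  proof
    fix x assume "x \<in> F - E"
    then obtain f j where f: "f \<in> A" "j \<in> J" "dist (f j) x < \<delta>" by (auto simp: E_def not_le)
    have "dist (f y) (f j) = scaling f * dist y j" by (rule dist_similarity[OF sim[OF AL[OF f(1)]]])
    also have "\<dots> \<le> scaling f * R"
      using f(2) J(2) pos[OF AL[OF f(1)]] by (intro mult_left_mono) auto
    finally have "dist (f y) x < scaling f * R + 2 * \<delta>"
      using f(3) dist_triangle[of "f y" x "f j"] \<delta>(1) by linarith
    then show "x \<in> (\<Union>f\<in>A. ball (f y) (scaling f * R + 2 * \<delta>))" using f(1) by auto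
  qed
  moreover have "0 < scaling f * R + 2 * \<delta>" if "f \<in> A" for f
    using pos[OF AL[OF that]] \<open>0 < R\<close> \<delta>(1) by (simp add: add_pos_pos)
  ultimately obtain B2 where B2: "ball_cover B2 (F - E)"
      "ball_sum s B2 \<le> (\<Sum>f\<in>A. (scaling f * R + 2 * \<delta>) powr s)"
    using ball_cover_family[OF finA, of "\<lambda>f. scaling f * R + 2 * \<delta>" "F - E" "\<lambda>f. f y" s] by blast
  have "(\<Sum>f\<in>A. (scaling f * R) powr s) = R powr s * v A"
    unfolding v_def sum_distrib_left
    using pos[OF AL] \<open>0 < R\<close> by (intro sum.cong) (auto simp: powr_mult less_imp_le)
  also have "\<dots> \<le> (\<epsilon> / 4 * a) * v A"
    using dense unfolding a_def v_def by (intro mult_right_mono) (auto intro: sum_nonneg)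
  also have "\<dots> = \<epsilon> / 4 * (v A * a)" by simp
  also have "\<dots> \<le> \<epsilon> / 4 * 1"
    using va[OF A] \<open>0 < \<epsilon>\<close> by (intro mult_left_mono) auto
  finally have main: "(\<Sum>f\<in>A. (scaling f * R) powr s) \<le> \<epsilon> / 4" by simp
  have "ball_sum s (B1 \<union> B2) \<le> ball_sum s B1 + ball_sum s B2" by (rule ball_cover_Un(2)[OF B1(1) B2(1)])
  also have "\<dots> < K * e + (\<epsilon> / 4 + e)" using B1(2) B2(2) sumZ \<delta>sum main by linarith
  also have "\<dots> = \<epsilon> / 4 + \<epsilon> / 2" using eK by (simp add: algebra_simps)
  finally have "ball_sum s (B1 \<union> B2) < \<epsilon>" using \<open>0 < \<epsilon>\<close> by simp
  moreover have "ball_cover (B1 \<union> B2) F"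
    using ball_cover_Un(1)[OF B1(1) B2(1)] by (rule ball_cover_mono) blast
  ultimately show "\<exists>B. ball_cover B F \<and> ball_sum s B < \<epsilon>" by blast
qed

end

section \<open>Graph-directed systems\<close>

locale graph_directed_family = graph_directed_system G S c
  for G :: "('v, 'e) pre_digraph" (structure) and S c +
  fixes F :: "'v \<Rightarrow> real set"
  assumes sets: "graph_directed_sets G S F"
begin

abbreviation pm :: "'e list \<Rightarrow> real \<Rightarrow> real" where "pm \<equiv> path_map S"

definition loop_maps :: "'v \<Rightarrow> (real \<Rightarrow> real) set" where
  "loop_maps v = pm ` {p. awalk v p v}"

lemma pm_Nil: "pm [] = id" and pm_Cons: "pm (e # p) = pm p \<circ> S e"
  and pm_append: "pm (p @ q) = pm q \<circ> pm p"
  by (auto simp: path_map_def)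

lemma edge_similarity:
  assumes "e \<in> arcs G"
  shows "similarity (S e)" "scaling (S e) = c e"
  using similarity_of_dist[OF conjunct1[OF ratio[OF assms]] similarity[OF assms]] by auto

lemma similarity_pm: "set p \<subseteq> arcs G \<Longrightarrow> similarity (pm p)"
  by (induction p) (auto simp: pm_Nil pm_Cons similarity_id similarity_comp edge_similarity)

lemma similarity_walk: "awalk u p v \<Longrightarrow> similarity (pm p)"
  by (auto simp: awalk_def intro: similarity_pm)

lemma pm_unit: "awalk u p v \<Longrightarrow> pm p ` {0..1} \<subseteq> {0..1}"
proof -
  assume "awalk u p v"
  then have "set p \<subseteq> arcs G" by (simp add: awalk_def)
  then show ?thesis
  proof (induction p)
    case (Cons e p)
    then have "S e ` {0..1} \<subseteq> {0..1}" "pm p ` {0..1} \<subseteq> {0..1}"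
      using maps_unit_interval by auto
    then have "pm p ` S e ` {0..1} \<subseteq> {0..1}" by blast
    then show ?case by (simp add: pm_Cons image_comp)
  qed (simp add: pm_Nil)
qed

lemma F_props:
  assumes "v \<in> verts G"
  shows "F v \<noteq> {}" "compact (F v)" "F v \<subseteq> {0..1}"
    "F v = (\<Union>u\<in>verts G. \<Union>e\<in>arcs_from_to G u v. S e ` F u)"
proof -
  note * = bspec[OF sets[unfolded graph_directed_sets_def] assms]
  show "F v \<noteq> {}" "compact (F v)" "F v \<subseteq> {0..1}" using * by (blast+)
  show "F v = (\<Union>u\<in>verts G. \<Union>e\<in>arcs_from_to G u v. S e ` F u)" using * by (elim conjE)
qed

lemma edge_image:
  assumes "e \<in> arcs G"
  shows "S e ` F (tail G e) \<subseteq> F (head G e)"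
proof -
  have "head G e \<in> verts G" "tail G e \<in> verts G" using assms wellformed by auto
  moreover have "e \<in> arcs_from_to G (tail G e) (head G e)" using assms by (simp add: arcs_from_to_def)
  ultimately have "S e ` F (tail G e) \<subseteq> (\<Union>u\<in>verts G. \<Union>e\<in>arcs_from_to G u (head G e). S e ` F u)"
    by blast
  then show ?thesis using F_props(4)[OF \<open>head G e \<in> verts G\<close>] by simp
qed

lemma edge_preimage:
  assumes "v \<in> verts G" "y \<in> F v"
  obtains e where "e \<in> arcs G" "head G e = v" "y \<in> S e ` F (tail G e)"
proof -
  have "y \<in> (\<Union>u\<in>verts G. \<Union>e\<in>arcs_from_to G u v. S e ` F u)"
    using assms F_props(4)[OF assms(1)] by blast
  then show ?thesis using that by (auto simp: arcs_from_to_def)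
qed

lemma pm_image: "awalk u p v \<Longrightarrow> pm p ` F u \<subseteq> F v"
proof (induction p arbitrary: u)
  case Nil
  then show ?case by (simp add: pm_Nil awalk_Nil_iff)
next
  case (Cons e p)
  then have e: "e \<in> arcs G" "u = tail G e" "awalk (head G e) p v" by (auto simp: awalk_Cons_iff)
  have "pm p ` S e ` F u \<subseteq> pm p ` F (head G e)" using edge_image[OF e(1)] e(2) by (intro image_mono) simp
  also have "\<dots> \<subseteq> F v" by (rule Cons.IH[OF e(3)])
  finally show ?case by (simp add: pm_Cons image_comp)
qed

lemma walk_exists:
  assumes "u \<in> verts G" "v \<in> verts G"
  obtains p where "awalk u p v"
  using strongly_connected assms by (auto simp: strongly_connected_def reachable_awalk)

definition cmin :: real where "cmin = Min (insert 1 (c ` arcs G))"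
definition cmax :: real where "cmax = Max (insert 0 (c ` arcs G))"

lemma cmin_pos: "0 < cmin" and cmin_le_1: "cmin \<le> 1" and cmin_le: "e \<in> arcs G \<Longrightarrow> cmin \<le> c e"
  using ratio by (auto simp: cmin_def)

lemma cmax_nonneg: "0 \<le> cmax" and cmax_less_1: "cmax < 1" and le_cmax: "e \<in> arcs G \<Longrightarrow> c e \<le> cmax"
  using ratio by (auto simp: cmax_def)

text \<open>
  Follow the point \<open>y\<close> backwards along edges until the ratio of the path drops to \<open>r\<close> or below; the last
  edge costs at most a factor \<open>cmin\<close>.
\<close>

lemma cut_path:
  assumes v: "v \<in> verts G" and y: "y \<in> F v" and r: "0 < r" "r \<le> 1"
  obtains u p where "awalk u p v" "y \<in> pm p ` F u" "cmin * r \<le> scaling (pm p)" "scaling (pm p) \<le> r"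
proof -
  have "\<exists>u p. awalk u p v \<and> y \<in> pm p ` F u \<and> cmin * r \<le> scaling (pm p) \<and>
      (scaling (pm p) \<le> r \<or> scaling (pm p) \<le> cmax ^ n)" for n
  proof (induction n)
    case 0
    have "cmin * r \<le> 1 * 1" using cmin_pos cmin_le_1 r by (intro mult_mono) auto
    then show ?case
      using v y scaling_id by (intro exI[of _ v] exI[of _ "[]"]) (simp add: awalk_Nil_iff pm_Nil id_def)
  next
    case (Suc n)
    then obtain u p where p: "awalk u p v" "y \<in> pm p ` F u" "cmin * r \<le> scaling (pm p)"
      and n: "scaling (pm p) \<le> r \<or> scaling (pm p) \<le> cmax ^ n" by blast
    show ?case
    proof (cases "scaling (pm p) \<le> r")
      case True
      then show ?thesis using p by blast
    next
      case False
      have "u \<in> verts G" using p(1) by (simp add: awalk_def)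
      obtain z where z: "z \<in> F u" "y = pm p z" using p(2) by blast
      obtain e where e: "e \<in> arcs G" "head G e = u" "z \<in> S e ` F (tail G e)"
        using edge_preimage[OF \<open>u \<in> verts G\<close> z(1)] by blast
      have sc: "scaling (pm (e # p)) = scaling (pm p) * c e"
        using similarity_comp(2)[OF similarity_walk[OF p(1)] edge_similarity(1)[OF e(1)]] edge_similarity(2)[OF e(1)]
        by (simp add: pm_Cons)
      have "awalk (tail G e) (e # p) v" using e p(1) by (simp add: awalk_Cons_iff)
      moreover have "y \<in> pm (e # p) ` F (tail G e)" using z(2) e(3) by (auto simp: pm_Cons)
      moreover have "r * cmin \<le> scaling (pm p) * c e"
        using False cmin_le[OF e(1)] cmin_pos r by (intro mult_mono) auto
      moreover have "scaling (pm p) * c e \<le> cmax ^ n * cmax"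
        using False n le_cmax[OF e(1)] cmax_nonneg ratio[OF e(1)] scaling_pos[OF similarity_walk[OF p(1)]]
        by (intro mult_mono) auto
      ultimately show ?thesis
        by (intro exI[of _ "tail G e"] exI[of _ "e # p"]) (simp add: sc mult.commute)
    qed
  qed
  moreover obtain n where "cmax ^ n < r" using real_arch_pow_inv[OF r(1) cmax_less_1] by blast
  ultimately show ?thesis using that by (meson less_imp_le order_trans)
qed

text \<open>
  The positive lower bound \<open>k\<close> makes prefixing with one of these walks harmless up to constants.
\<close>

lemma walks_from:
  assumes v: "v \<in> verts G"
  obtains q k where "\<And>u. u \<in> verts G \<Longrightarrow> awalk v (q u) u" "0 < k"
    "\<And>u. u \<in> verts G \<Longrightarrow> k \<le> scaling (pm (q u))"
proof -
  have "\<exists>q. awalk v q u" if "u \<in> verts G" for u using walk_exists[OF v that] by blast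
  then obtain q where q: "\<And>u. u \<in> verts G \<Longrightarrow> awalk v (q u) u" by metis
  define k where "k = Min ((\<lambda>u. scaling (pm (q u))) ` verts G)"
  have "0 < scaling (pm (q u))" if "u \<in> verts G" for u
    by (rule scaling_pos[OF similarity_walk[OF q[OF that]]])
  then have "0 < k"
    unfolding k_def using v by (subst Min_gr_iff) auto
  moreover have "k \<le> scaling (pm (q u))" if "u \<in> verts G" for u
    unfolding k_def using that by (intro Min_le) auto
  ultimately show ?thesis using q that by blast
qed

lemma loop_maps_similarity_monoid:
  assumes v: "v \<in> verts G"
  shows "\<exists>\<rho>. similarity_monoid (loop_maps v) (F v) \<rho>"
proof -
  obtain q k where q: "\<And>u. u \<in> verts G \<Longrightarrow> awalk v (q u) u" and "0 < k"
    and k: "\<And>u. u \<in> verts G \<Longrightarrow> k \<le> scaling (pm (q u))"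
    using walks_from[OF v] by blast
  define \<rho> where "\<rho> = cmin * k / 2"
  have "similarity_monoid (loop_maps v) (F v) \<rho>"
  proof
    show "F v \<noteq> {}" "compact (F v)" "F v \<subseteq> {0..1}" using F_props[OF v] by auto
    show "0 < \<rho>" using cmin_pos \<open>0 < k\<close> by (simp add: \<rho>_def)
    show "id \<in> loop_maps v" unfolding loop_maps_def pm_Nil[symmetric] using v by (simp add: awalk_Nil_iff)
  next
    fix T assume "T \<in> loop_maps v"
    then obtain p where "awalk v p v" "T = pm p" by (auto simp: loop_maps_def)
    then show "similarity T" "T ` {0..1} \<subseteq> {0..1}" "T ` F v \<subseteq> F v"
      using similarity_walk pm_unit pm_image by auto
  next
    fix T U assume "T \<in> loop_maps v" "U \<in> loop_maps v"
    then obtain p p' where p: "awalk v p v" "T = pm p" "awalk v p' v" "U = pm p'" by (auto simp: loop_maps_def)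
    then have "T \<circ> U = pm (p' @ p)" "awalk v (p' @ p) v" by (auto simp: pm_append)
    then show "T \<circ> U \<in> loop_maps v" by (auto simp: loop_maps_def)
  next
    fix y r :: real assume y: "y \<in> F v" "0 < r" "r \<le> 1"
    obtain u p where p: "awalk u p v" "y \<in> pm p ` F u" "cmin * (r / 2) \<le> scaling (pm p)" "scaling (pm p) \<le> r / 2"
      using cut_path[OF v y(1), of "r / 2"] y by auto
    have u: "u \<in> verts G" using p(1) by (simp add: awalk_def)
    note sim_p = similarity_walk[OF p(1)] and sim_q = similarity_walk[OF q[OF u]]
    have "awalk v (q u @ p) v" using q[OF u] p(1) by auto
    then have "pm p \<circ> pm (q u) \<in> loop_maps v" by (auto simp: loop_maps_def pm_append[symmetric])
    moreover have "(pm p \<circ> pm (q u)) ` {0..1} \<subseteq> ball y r"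
    proof
      fix x assume "x \<in> (pm p \<circ> pm (q u)) ` {0..1}"
      then obtain a where a: "a \<in> {0..1}" "x = pm p a" using pm_unit[OF q[OF u]] by auto
      obtain b where b: "b \<in> {0..1}" "y = pm p b" using p(2) F_props(3)[OF u] by blast
      have "dist y x = scaling (pm p) * dist b a" using a b dist_similarity[OF sim_p] by simp
      also have "\<dots> \<le> (r / 2) * 1" using a b p(4) y(2) by (intro mult_mono) (auto simp: dist_real_def)
      also have "\<dots> < r" using y(2) by simp
      finally show "x \<in> ball y r" by simp
    qed
    moreover have "\<rho> * r \<le> scaling (pm p \<circ> pm (q u))"
    proof -
      have "\<rho> * r = cmin * (r / 2) * k" by (simp add: \<rho>_def)
      also have "\<dots> \<le> scaling (pm p) * scaling (pm (q u))"
        using p(3) k[OF u] \<open>0 < k\<close> scaling_pos[OF sim_p] by (intro mult_mono) auto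
      finally show ?thesis by (simp add: similarity_comp(2)[OF sim_p sim_q])
    qed
    ultimately show "\<exists>T\<in>loop_maps v. T ` {0..1} \<subseteq> ball y r \<and> \<rho> * r \<le> scaling T" by blast
  qed
  then show ?thesis by blast
qed

lemma not_singleton_transfer:
  assumes "u \<in> verts G" "\<not> is_singleton (F u)" "v \<in> verts G"
  shows "\<not> is_singleton (F v)"
proof
  assume "is_singleton (F v)"
  then obtain a where a: "F v = {a}" by (auto simp: is_singleton_def)
  obtain p where p: "awalk u p v" using walk_exists[OF assms(1,3)] by blast
  obtain x where x: "x \<in> F u" using F_props(1)[OF assms(1)] by blast
  then have "F u \<noteq> {x}" using assms(2) by (auto simp: is_singleton_def)
  then obtain y where xy: "x \<in> F u" "y \<in> F u" "x \<noteq> y" using x by blast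
  then have "pm p x \<in> {a}" "pm p y \<in> {a}" using pm_image[OF p] unfolding a by (blast+)
  then have "pm p x = pm p y" by simp
  then show False
    using xy(3) bij_is_inj[OF similarity_bij[OF similarity_walk[OF p]]] by (simp add: inj_eq)
qed

subsection \<open>The graph-directed weak separation property\<close>

lemma relative_maps_loops: "relative_maps G S v v = {inv T \<circ> U | T U. T \<in> loop_maps v \<and> U \<in> loop_maps v}"
  unfolding relative_maps_def loop_maps_def by blast

lemma id_relative_maps: "v \<in> verts G \<Longrightarrow> id \<in> relative_maps G S v v"
  unfolding relative_maps_def
  by (intro CollectI exI[of _ "[]"]) (simp add: pm_Nil awalk_Nil_iff)

lemma near_coincidences_if_not_gdwsp:
  assumes v: "v \<in> verts G" and "\<not> gdwsp G S" and \<eta>: "0 < \<eta>"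
  shows "\<exists>T\<in>loop_maps v. \<exists>U\<in>loop_maps v. inv T \<circ> U \<noteq> id \<and> \<bar>inv T (U 0)\<bar> < \<eta> \<and> \<bar>inv T (U 1) - 1\<bar> < \<eta>"
proof -
  define N where "N = {g :: real \<Rightarrow> real. \<bar>g 0\<bar> < \<eta> \<and> \<bar>g 1 - 1\<bar> < \<eta>}"
  have "open N"
    unfolding N_def
    by (intro open_Collect_conj open_Collect_less continuous_intros continuous_on_product_coordinates)
  moreover have "id \<in> N" using \<eta> by (simp add: N_def)
  moreover have "\<not> id isolated_in relative_maps G S v v"
    using assms(2) gdwsp_iff_at_vertex[OF v] by simp
  ultimately obtain g where "g \<in> N" "g \<in> relative_maps G S v v" "g \<noteq> id"
    using id_relative_maps[OF v] unfolding isolated_in_def by blast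
  then show ?thesis
    unfolding relative_maps_loops N_def by fastforce
qed

text \<open>
  The map sending \<open>(a, b)\<close> to the function \<open>x \<mapsto> a x + b\<close> is continuous, so an isolating neighbourhood of the identity
  contains all affine maps with coefficients close to \<open>(1, 0)\<close>.
\<close>

lemma gdwsp_neighbourhood:
  assumes v: "v \<in> verts G" and "gdwsp G S"
  obtains \<eta> where "0 < \<eta>" "\<And>T U. T \<in> loop_maps v \<Longrightarrow> U \<in> loop_maps v \<Longrightarrow> \<bar>inv T (U 0)\<bar> < \<eta> \<Longrightarrow>
    \<bar>inv T (U 1) - 1\<bar> < \<eta> \<Longrightarrow> U = T"
proof -
  have "id isolated_in relative_maps G S v v" using assms gdwsp_iff_at_vertex by blast
  then obtain N where N: "open N" "N \<inter> relative_maps G S v v = {id}"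
    by (auto simp: isolated_in_def)
  define \<phi> :: "real \<times> real \<Rightarrow> real \<Rightarrow> real" where "\<phi> = (\<lambda>(a, b) x. a * x + b)"
  have "continuous_on UNIV \<phi>"
    by (rule continuous_on_coordinatewise_then_product)
      (auto simp: \<phi>_def case_prod_beta intro!: continuous_intros)
  then have "open (\<phi> -` N)" using N(1) by (simp add: continuous_on_open_vimage)
  moreover have "\<phi> (1, 0) = id" by (auto simp: \<phi>_def)
  then have "(1, 0) \<in> \<phi> -` N" using N(2) by auto
  ultimately obtain e where e: "0 < e" "ball (1, 0) e \<subseteq> \<phi> -` N"
    using open_contains_ball by blast
  show ?thesis
  proof (rule that[of "e / 3"])
    show "0 < e / 3" using e(1) by simp
    fix T U assume TU: "T \<in> loop_maps v" "U \<in> loop_maps v"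
      and small: "\<bar>inv T (U 0)\<bar> < e / 3" "\<bar>inv T (U 1) - 1\<bar> < e / 3"
    have simT: "similarity T" and simU: "similarity U"
      using TU similarity_walk by (auto simp: loop_maps_def)
    have "similarity (inv T \<circ> U)" by (intro similarity_comp similarity_inv simT simU)
    then obtain a b where ab: "inv T \<circ> U = (\<lambda>x. a * x + b)" unfolding similarity_def by blast
    have b: "inv T (U 0) = b" and a: "inv T (U 1) = a + b"
      using fun_cong[OF ab, of 0] fun_cong[OF ab, of 1] by auto
    have "dist (1, 0) (a, b) \<le> dist 1 a + dist 0 b"
      unfolding dist_prod_def by (simp only: fst_conv snd_conv sqrt_sum_squares_le_sum zero_le_dist)
    also have "\<dots> < e" using small unfolding a b dist_real_def by linarith
    finally have "\<phi> (a, b) \<in> N" using e(2) by auto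
    then have "inv T \<circ> U \<in> N" by (simp add: ab \<phi>_def)
    then have "inv T \<circ> U = id" using N(2) TU unfolding relative_maps_loops by blast
    then have "T (inv T (U x)) = T x" for x by (metis comp_apply id_apply)
    then show "U = T" using simT by auto
  qed
qed

text \<open>
  A path is stored with its start vertex, which the empty path does not determine.
\<close>

definition pieces_cover :: "('v \<times> 'e list) set \<Rightarrow> 'v \<Rightarrow> real \<Rightarrow> real set \<Rightarrow> bool" where
  "pieces_cover Q v r E \<longleftrightarrow> finite Q \<and> (\<forall>(u, p)\<in>Q. awalk u p v \<and> scaling (pm p) \<le> r) \<and>
    E \<subseteq> (\<Union>(u, p)\<in>Q. pm p ` F u)"

text \<open>
  Scaled by \<open>1 / r\<close>, the slope of a path map of ratio about \<open>r\<close> with image near \<open>x\<close>, and its value at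
  \<open>0\<close> relative to \<open>x\<close>, range over a bounded set. Divide this set into cells of side \<open>\<zeta>\<close>. For two
  paths from the same vertex whose maps fall into the same cell, \<open>S\<^sub>p\<^sup>-\<^sup>1 \<circ> S\<^sub>p\<^sub>'\<close> is close to the identity; after prefixing
  both paths with a walk from \<open>v\<close> they become loops, and separation forces the maps to coincide. So one
  path for each occupied cell suffices.
\<close>

lemma finitely_many_pieces_at:
  assumes v: "v \<in> verts G" and "gdwsp G S"
  shows "\<exists>M::nat. \<forall>x r. 0 < r \<longrightarrow> (\<exists>Q. card Q \<le> M \<and> pieces_cover Q v r (F v \<inter> ball x r))"
proof -
  obtain \<eta> where "0 < \<eta>" and \<eta>: "\<And>T U. T \<in> loop_maps v \<Longrightarrow> U \<in> loop_maps v \<Longrightarrow> \<bar>inv T (U 0)\<bar> < \<eta> \<Longrightarrow>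
    \<bar>inv T (U 1) - 1\<bar> < \<eta> \<Longrightarrow> U = T"
    using gdwsp_neighbourhood[OF assms] by blast
  obtain q k where q: "\<And>u. u \<in> verts G \<Longrightarrow> awalk v (q u) u" and "0 < k"
    and k: "\<And>u. u \<in> verts G \<Longrightarrow> k \<le> scaling (pm (q u))"
    using walks_from[OF v] by blast
  \<comment> \<open>Chosen so that the displacement bound \<open>2 * \<zeta> / (cmin * k)\<close> below is \<open>\<eta> / 2\<close>.\<close>
  define \<zeta> where "\<zeta> = \<eta> * cmin * k / 4"
  have "0 < \<zeta>" using \<open>0 < \<eta>\<close> \<open>0 < k\<close> cmin_pos by (simp add: \<zeta>_def)
  define m where "m = \<lceil>2 / \<zeta>\<rceil>"
  define N where "N = verts G \<times> {-m - 1..m} \<times> {-m - 1..m}"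
  have "finite N" by (simp add: N_def)
  \<comment> \<open>The successor ensures that the bound is positive, as the one-element cover for \<open>r > 1\<close> requires.\<close>
  have "\<exists>Q. card Q \<le> Suc (card N) \<and> pieces_cover Q v r (F v \<inter> ball x r)"
    if "0 < r" for x r :: real
  proof (cases "r \<le> 1")
    case False
    then show ?thesis
      using v by (intro exI[of _ "{(v, [])}"]) (auto simp: pieces_cover_def awalk_Nil_iff pm_Nil scaling_id)
  next
    case True
    define P where "P = {(u, p). awalk u p v \<and> cmin * r \<le> scaling (pm p) \<and> scaling (pm p) \<le> r \<and>
        pm p ` F u \<inter> ball x r \<noteq> {}}"
    define code where "code = (\<lambda>(u :: 'v, p). (u, \<lfloor>(pm p 1 - pm p 0) / (r * \<zeta>)\<rfloor>, \<lfloor>(pm p 0 - x) / (r * \<zeta>)\<rfloor>))"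
    have grid: "\<lfloor>t / (r * \<zeta>)\<rfloor> \<in> {-m - 1..m}" if "\<bar>t\<bar> \<le> 2 * r" for t
    proof -
      have "\<bar>t / (r * \<zeta>)\<bar> \<le> 2 / \<zeta>"
        using that \<open>0 < r\<close> \<open>0 < \<zeta>\<close> by (simp add: abs_mult field_simps)
      also have "\<dots> \<le> m" unfolding m_def by linarith
      finally have "t / (r * \<zeta>) \<le> m \<and> - (t / (r * \<zeta>)) \<le> m" by (simp only: abs_le_iff)
      then have "\<lfloor>t / (r * \<zeta>)\<rfloor> \<le> m \<and> - m - 1 \<le> \<lfloor>t / (r * \<zeta>)\<rfloor>" by linarith
      then show ?thesis by simp
    qed
    have codeN: "code ` P \<subseteq> N"
    proof
      fix d assume "d \<in> code ` P"
      then obtain u p where p: "awalk u p v" "scaling (pm p) \<le> r" "pm p ` F u \<inter> ball x r \<noteq> {}"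
        and d: "d = code (u, p)" by (auto simp: P_def)
      have u: "u \<in> verts G" using p(1) by (simp add: awalk_def)
      obtain y where "y \<in> pm p ` F u" "y \<in> ball x r" using p(3) by blast
      then obtain z where z: "z \<in> F u" "dist x (pm p z) < r" by auto
      have "z \<in> {0..1}" using z(1) F_props(3)[OF u] by blast
      then have "scaling (pm p) * dist z 0 \<le> r * 1"
        using p(2) \<open>0 < r\<close> by (intro mult_mono) auto
      then have "\<bar>pm p z - pm p 0\<bar> \<le> r"
        using dist_similarity[OF similarity_walk[OF p(1)], of z 0] by (simp add: dist_real_def)
      then have "\<bar>pm p 0 - x\<bar> \<le> 2 * r" using z(2) by (simp add: dist_real_def)
      moreover have "\<bar>pm p 1 - pm p 0\<bar> \<le> 2 * r" using p(2) \<open>0 < r\<close> by (simp add: scaling_def)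
      ultimately show "d \<in> N" using u grid unfolding d code_def N_def by simp
    qed
    have same: "pm p' = pm p" if "(u, p) \<in> P" "(u', p') \<in> P" "code (u, p) = code (u', p')" for u u' p p'
    proof -
      have p: "awalk u p v" "cmin * r \<le> scaling (pm p)" and p': "awalk u' p' v" and "u' = u"
        using that by (auto simp: P_def code_def)
      have u: "u \<in> verts G" using p(1) by (simp add: awalk_def)
      note sim_p = similarity_walk[OF p(1)] and sim_p' = similarity_walk[OF p'] and sim_q = similarity_walk[OF q[OF u]]
      have close: "\<bar>s - t\<bar> \<le> r * \<zeta>" if "\<lfloor>s / (r * \<zeta>)\<rfloor> = \<lfloor>t / (r * \<zeta>)\<rfloor>" for s t
      proof -
        have "\<bar>s / (r * \<zeta>) - t / (r * \<zeta>)\<bar> \<le> 1" using that by linarith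
        then have "\<bar>s - t\<bar> / (r * \<zeta>) \<le> 1"
          using \<open>0 < r\<close> \<open>0 < \<zeta>\<close> by (simp add: diff_divide_distrib[symmetric] abs_divide abs_mult)
        then show ?thesis using \<open>0 < r\<close> \<open>0 < \<zeta>\<close> by (simp add: field_simps)
      qed
      obtain a b where f: "pm p = (\<lambda>x. a * x + b)" using sim_p unfolding similarity_def by blast
      obtain a' b' where f': "pm p' = (\<lambda>x. a' * x + b')" using sim_p' unfolding similarity_def by blast
      have da: "\<bar>a' - a\<bar> \<le> r * \<zeta>" using close[of a' a] that(3) by (simp add: code_def f f')
      have db: "\<bar>b' - b\<bar> \<le> r * \<zeta>" using close[of "b' - x" "b - x"] that(3) by (simp add: code_def f f')
      have near: "\<bar>pm p' t - pm p t\<bar> \<le> 2 * r * \<zeta>" if "t \<in> {0..1}" for t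
      proof -
        have "\<bar>(a' - a) * t\<bar> \<le> r * \<zeta> * 1"
          unfolding abs_mult using that da \<open>0 < r\<close> \<open>0 < \<zeta>\<close> by (intro mult_mono) auto
        moreover have "pm p' t - pm p t = (a' - a) * t + (b' - b)" by (simp add: f f' algebra_simps)
        ultimately show ?thesis using db by linarith
      qed
      define h where "h = pm (q u)"
      have simh: "similarity h" using sim_q by (simp add: h_def)
      have TU: "pm p \<circ> h \<in> loop_maps v" "pm p' \<circ> h \<in> loop_maps v"
        using q[OF u] p(1) p' \<open>u' = u\<close> unfolding loop_maps_def h_def pm_append[symmetric]
        by (auto intro!: imageI)
      have small: "\<bar>inv (pm p \<circ> h) ((pm p' \<circ> h) t) - t\<bar> < \<eta>" if t: "t \<in> {0..1}" for t
      proof -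
        let ?T = "pm p \<circ> h"
        have simT: "similarity ?T" by (rule similarity_comp(1)[OF sim_p simh])
        have "h t \<in> {0..1}" using pm_unit[OF q[OF u]] t unfolding h_def by blast
        have "dist (inv ?T (pm p' (h t))) (inv ?T (?T t)) = 1 / scaling ?T * dist (pm p' (h t)) (?T t)"
          using dist_similarity[OF similarity_inv(1)[OF simT]] similarity_inv(2)[OF simT] by simp
        then have "\<bar>inv ?T (pm p' (h t)) - t\<bar> = \<bar>pm p' (h t) - pm p (h t)\<bar> / scaling ?T"
          by (simp only: inv_f_similarity[OF simT]) (simp add: dist_real_def)
        also have "\<dots> \<le> 2 * r * \<zeta> / (cmin * r * k)"
        proof (rule frac_le)
          show "cmin * r * k \<le> scaling ?T"
            unfolding h_def similarity_comp(2)[OF sim_p sim_q]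
            using p(2) k[OF u] \<open>0 < k\<close> scaling_pos[OF sim_p] by (intro mult_mono) auto
        qed (use near[OF \<open>h t \<in> {0..1}\<close>] \<open>0 < r\<close> \<open>0 < \<zeta>\<close> \<open>0 < k\<close> cmin_pos in auto)
        also have "\<dots> = \<eta> / 2" using \<open>0 < r\<close> \<open>0 < k\<close> cmin_pos by (simp add: \<zeta>_def)
        also have "\<dots> < \<eta>" using \<open>0 < \<eta>\<close> by simp
        finally show ?thesis by simp
      qed
      have "pm p' \<circ> h = pm p \<circ> h"
        using \<eta>[OF TU] small[of 0] small[of 1] by simp
      then have "pm p' (h (inv h t)) = pm p (h (inv h t))" for t by (metis comp_apply)
      then show ?thesis using simh by auto
    qed
    define Q where "Q = inv_into P code ` (code ` P)"
    have QP: "Q \<subseteq> P" unfolding Q_def by (intro image_subsetI inv_into_into)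
    have "finite (code ` P)" using codeN \<open>finite N\<close> finite_subset by blast
    then have "finite Q" by (simp add: Q_def)
    have "card Q \<le> card (code ` P)" unfolding Q_def by (rule card_image_le[OF \<open>finite (code ` P)\<close>])
    also have "\<dots> \<le> card N" by (rule card_mono[OF \<open>finite N\<close> codeN])
    finally have "card Q \<le> Suc (card N)" by simp
    moreover have "F v \<inter> ball x r \<subseteq> (\<Union>(u, p)\<in>Q. pm p ` F u)"
    proof
      fix y assume y: "y \<in> F v \<inter> ball x r"
      obtain u p where p: "awalk u p v" "y \<in> pm p ` F u" "cmin * r \<le> scaling (pm p)" "scaling (pm p) \<le> r"
        using cut_path[OF v _ \<open>0 < r\<close> True] y by blast
      then have P: "(u, p) \<in> P" using y by (auto simp: P_def)
      define w where "w = inv_into P code (code (u, p))"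
      have w: "w \<in> P" "code w = code (u, p)" "w \<in> Q"
        using P by (auto simp: w_def Q_def inv_into_into f_inv_into_f)
      obtain u' p' where w': "w = (u', p')" using surj_pair[of w] by blast
      have "pm p' = pm p" using same[OF P] w(1,2) by (simp add: w')
      moreover have "u' = u" using w(2) by (simp add: w' code_def)
      ultimately show "y \<in> (\<Union>(u, p)\<in>Q. pm p ` F u)"
        using w(3) p(2) unfolding w' by (intro UN_I[of "(u', p')"]) auto
    qed
    moreover have "\<forall>(u, p)\<in>Q. awalk u p v \<and> scaling (pm p) \<le> r" using QP by (auto simp: P_def)
    ultimately have "pieces_cover Q v r (F v \<inter> ball x r)"
      using \<open>finite Q\<close> by (simp add: pieces_cover_def)
    with \<open>card Q \<le> Suc (card N)\<close> show ?thesis by blast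
  qed
  then show ?thesis by blast
qed

lemma finitely_many_pieces:
  assumes "gdwsp G S"
  obtains M :: nat where
    "\<And>v x r. v \<in> verts G \<Longrightarrow> 0 < r \<Longrightarrow> \<exists>Q. card Q \<le> M \<and> pieces_cover Q v r (F v \<inter> ball x r)"
proof -
  have "\<forall>v\<in>verts G. \<exists>M::nat. \<forall>x r. 0 < r \<longrightarrow> (\<exists>Q. card Q \<le> M \<and> pieces_cover Q v r (F v \<inter> ball x r))"
    using finitely_many_pieces_at assms by blast
  from bchoice[OF this] obtain m :: "'v \<Rightarrow> nat"
    where m: "\<forall>v\<in>verts G. \<forall>x r. 0 < r \<longrightarrow> (\<exists>Q. card Q \<le> m v \<and> pieces_cover Q v r (F v \<inter> ball x r))"
    by blast
  have "\<exists>Q. card Q \<le> sum m (verts G) \<and> pieces_cover Q v r (F v \<inter> ball x r)"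
    if v: "v \<in> verts G" and r: "0 < r" for v x r
  proof -
    have "m v \<le> sum m (verts G)" using v by (intro member_le_sum) auto
    moreover obtain Q where "card Q \<le> m v" "pieces_cover Q v r (F v \<inter> ball x r)"
      using m v r by blast
    ultimately show ?thesis using order_trans by blast
  qed
  then show ?thesis by (rule that)
qed

subsection \<open>Consequences of weak separation\<close>

lemma sum_UNION_le:
  fixes g :: "'a \<Rightarrow> real"
  assumes "finite I" "\<And>i. i \<in> I \<Longrightarrow> finite (A i)" "\<And>x. 0 \<le> g x"
  shows "sum g (\<Union>i\<in>I. A i) \<le> (\<Sum>i\<in>I. sum g (A i))"
proof -
  have "(\<Union>i\<in>I. A i) = snd ` Sigma I A" by force
  then have "sum g (\<Union>i\<in>I. A i) \<le> sum (g \<circ> snd) (Sigma I A)"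
    using assms by (simp only:) (intro sum_image_le finite_SigmaI; simp)
  also have "\<dots> = (\<Sum>i\<in>I. sum g (A i))"
    using assms by (subst sum.Sigma) (auto simp: case_prod_beta)
  finally show ?thesis .
qed

lemma small_covers_all_vertices:
  assumes "u \<in> verts G" "small_covers s (F u)" "v \<in> verts G"
  shows "small_covers s (F v)"
proof -
  obtain p where p: "awalk v p u" using walk_exists[OF assms(3,1)] by blast
  show ?thesis by (rule small_covers_vimage[OF similarity_walk[OF p] assms(2) pm_image[OF p]])
qed

text \<open>
  Each ball of radius \<open>r\<close> in a cover is exchanged for at most \<open>M\<close> pieces of ratio at most \<open>r\<close>, so a cover
  by balls with sum less than \<open>1 / (M + 1)\<close> yields a cover by pieces with sum less than \<open>1\<close>.
\<close>

lemma contracting_cover: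
  assumes v: "v \<in> verts G" and "gdwsp G S" "0 < s" "small_covers s (F v)"
  shows "\<exists>Q. pieces_cover Q v 1 (F v) \<and> (\<Sum>(u, p)\<in>Q. scaling (pm p) powr s) < 1"
proof -
  obtain M :: nat where
    M: "\<And>v x r. v \<in> verts G \<Longrightarrow> 0 < r \<Longrightarrow> \<exists>Q. card Q \<le> M \<and> pieces_cover Q v r (F v \<inter> ball x r)"
    using finitely_many_pieces[OF assms(2)] by blast
  define \<epsilon> where "\<epsilon> = 1 / (real M + 1)"
  have \<epsilon>: "0 < \<epsilon>" "\<epsilon> \<le> 1" "real M * \<epsilon> < 1" by (auto simp: \<epsilon>_def field_simps)
  obtain B where B: "ball_cover B (F v)" "ball_sum s B < \<epsilon>"
    using assms(4) \<epsilon>(1) unfolding small_covers_def by blast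
  have finB: "finite B" and posB: "\<And>b. b \<in> B \<Longrightarrow> 0 < snd b" and covB: "F v \<subseteq> (\<Union>b\<in>B. ball (fst b) (snd b))"
    using B(1) by (auto simp: ball_cover_def case_prod_beta)
  have "\<forall>b\<in>B. \<exists>Q. card Q \<le> M \<and> pieces_cover Q v (snd b) (F v \<inter> ball (fst b) (snd b))"
    using M[OF v] posB by blast
  from bchoice[OF this] obtain Q where
    Q: "\<And>b. b \<in> B \<Longrightarrow> card (Q b) \<le> M" "\<And>b. b \<in> B \<Longrightarrow> pieces_cover (Q b) v (snd b) (F v \<inter> ball (fst b) (snd b))"
    by blast
  have finQ: "finite (Q b)" if "b \<in> B" for b using Q(2)[OF that] by (simp add: pieces_cover_def)
  have le: "awalk (fst w) (snd w) v \<and> scaling (pm (snd w)) \<le> snd b" if "b \<in> B" "w \<in> Q b" for b w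
    using Q(2)[OF that(1)] that(2) unfolding pieces_cover_def by (auto simp: case_prod_beta)
  have rad: "snd b \<le> 1" if "b \<in> B" for b
  proof -
    have "snd b powr s \<le> ball_sum s B"
      unfolding ball_sum_def case_prod_beta using that finB by (intro member_le_sum) auto
    then have "snd b powr s < 1 powr s" using B(2) \<epsilon>(2) by simp
    then show ?thesis using posB[OF that] assms(3)
      by (metis less_eq_real_def linorder_not_le powr_mono2 zero_le_one)
  qed
  define P where "P = (\<Union>b\<in>B. Q b)"
  have "F v \<subseteq> (\<Union>(u, p)\<in>P. pm p ` F u)"
  proof
    fix y assume y: "y \<in> F v"
    then obtain b where b: "b \<in> B" "y \<in> ball (fst b) (snd b)" using covB by blast
    then have "y \<in> (\<Union>(u, p)\<in>Q b. pm p ` F u)" using Q(2)[OF b(1)] y unfolding pieces_cover_def by blast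
    then show "y \<in> (\<Union>(u, p)\<in>P. pm p ` F u)" unfolding P_def using b(1) by blast
  qed
  moreover have "finite P" using finB finQ by (simp add: P_def)
  moreover have "awalk u p v \<and> scaling (pm p) \<le> 1" if "(u, p) \<in> P" for u p
  proof -
    obtain b where "b \<in> B" "(u, p) \<in> Q b" using \<open>(u, p) \<in> P\<close> by (auto simp: P_def)
    then show ?thesis using le[of b "(u, p)"] rad[of b] by auto
  qed
  ultimately have "pieces_cover P v 1 (F v)" by (auto simp: pieces_cover_def)
  moreover have "(\<Sum>(u, p)\<in>P. scaling (pm p) powr s) < 1"
  proof -
    have "(\<Sum>(u, p)\<in>P. scaling (pm p) powr s) \<le> (\<Sum>b\<in>B. \<Sum>(u, p)\<in>Q b. scaling (pm p) powr s)"
      unfolding P_def using finB finQ by (intro sum_UNION_le) auto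
    also have "\<dots> \<le> (\<Sum>b\<in>B. real M * snd b powr s)"
    proof (rule sum_mono)
      fix b assume b: "b \<in> B"
      have "(\<Sum>(u, p)\<in>Q b. scaling (pm p) powr s) \<le> (\<Sum>w\<in>Q b. snd b powr s)"
        unfolding case_prod_beta
      proof (rule sum_mono)
        fix w assume "w \<in> Q b"
        then have w: "awalk (fst w) (snd w) v" "scaling (pm (snd w)) \<le> snd b" using le[OF b] by auto
        show "scaling (pm (snd w)) powr s \<le> snd b powr s"
          using w(2) scaling_pos[OF similarity_walk[OF w(1)]] assms(3) by (intro powr_mono2) auto
      qed
      also have "\<dots> = real (card (Q b)) * snd b powr s" by simp
      also have "\<dots> \<le> real M * snd b powr s" using Q(1)[OF b] by (intro mult_right_mono) auto
      finally show "(\<Sum>(u, p)\<in>Q b. scaling (pm p) powr s) \<le> real M * snd b powr s" .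
    qed
    also have "\<dots> = real M * ball_sum s B"
      by (simp add: ball_sum_def case_prod_beta sum_distrib_left)
    also have "\<dots> \<le> real M * \<epsilon>" using B(2) by (intro mult_left_mono) auto
    also have "\<dots> < 1" by (rule \<epsilon>(3))
    finally show ?thesis .
  qed
  ultimately show ?thesis by blast
qed

text \<open>
  Transporting covers of the sets \<open>F\<^sub>u\<close> by the maps of the pieces covering \<open>F\<^sub>v\<close> multiplies the cost by at
  most \<open>\<theta>\<close>.
\<close>

lemma small_covers_of_contracting_covers:
  assumes Q: "\<And>v. v \<in> verts G \<Longrightarrow> pieces_cover (Q v) v 1 (F v)"
    and sum: "\<And>v. v \<in> verts G \<Longrightarrow> (\<Sum>(u, p)\<in>Q v. scaling (pm p) powr t) \<le> \<theta>"
    and "\<theta> < 1" "v \<in> verts G"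
  shows "small_covers t (F v)"
proof -
  have "0 \<le> (\<Sum>(u, p)\<in>Q v. scaling (pm p) powr t)" by (intro sum_nonneg) auto
  then have "0 \<le> \<theta>" using sum[OF assms(4)] by simp
  have iterate: "\<exists>B. ball_cover B (F v) \<and> ball_sum t B \<le> 2 powr t * \<theta> ^ n" if "v \<in> verts G" for v n
    using that
  proof (induction n arbitrary: v)
    case 0
    have "{0..1::real} \<subseteq> ball 0 2" by (auto simp: dist_norm)
    then have "ball_cover {(0, 2)} (F v)" using F_props(3)[OF 0] by (auto simp: ball_cover_def)
    then show ?case by (intro exI[of _ "{(0, 2)}"]) (simp add: ball_sum_def)
  next
    case (Suc n)
    have Qv: "finite (Q v)" "\<And>u p. (u, p) \<in> Q v \<Longrightarrow> awalk u p v" "F v \<subseteq> (\<Union>(u, p)\<in>Q v. pm p ` F u)"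
      using Q[OF Suc.prems] by (auto simp: pieces_cover_def)
    have "\<forall>u\<in>verts G. \<exists>B. ball_cover B (F u) \<and> ball_sum t B \<le> 2 powr t * \<theta> ^ n"
      using Suc.IH by blast
    from bchoice[OF this] obtain B where
      B: "\<And>u. u \<in> verts G \<Longrightarrow> ball_cover (B u) (F u)" "\<And>u. u \<in> verts G \<Longrightarrow> ball_sum t (B u) \<le> 2 powr t * \<theta> ^ n"
      by blast
    have uv: "u \<in> verts G" and sim: "similarity (pm p)" if "(u, p) \<in> Q v" for u p
      using Qv(2)[OF that] similarity_walk by (auto simp: awalk_def)
    have finB: "finite (B u)" and posB: "\<And>b. b \<in> B u \<Longrightarrow> 0 < snd b"
      and covB: "F u \<subseteq> (\<Union>b\<in>B u. ball (fst b) (snd b))" if "u \<in> verts G" for u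
      using B(1)[OF that] by (auto simp: ball_cover_def case_prod_beta)
    define I where "I = Sigma (Q v) (\<lambda>(u, p). B u)"
    define x where "x = (\<lambda>((u :: 'v, p), (b :: real \<times> real)). pm p (fst b))"
    define r where "r = (\<lambda>((u :: 'v, p), (b :: real \<times> real)). scaling (pm p) * snd b)"
    have "finite I" unfolding I_def using Qv(1) uv finB by (intro finite_SigmaI) auto
    moreover have "0 < r i" if "i \<in> I" for i
    proof -
      obtain u p b where i: "i = ((u, p), b)" "(u, p) \<in> Q v" "b \<in> B u"
        using \<open>i \<in> I\<close> by (auto simp: I_def)
      show ?thesis
        using scaling_pos[OF sim[OF i(2)]] posB[OF uv[OF i(2)] i(3)] by (simp add: i(1) r_def)
    qed
    moreover have "F v \<subseteq> (\<Union>i\<in>I. ball (x i) (r i))"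
    proof
      fix y assume "y \<in> F v"
      then obtain u p z where z: "(u, p) \<in> Q v" "z \<in> F u" "y = pm p z" using Qv(3) by blast
      obtain b where b: "b \<in> B u" "z \<in> ball (fst b) (snd b)" using covB[OF uv[OF z(1)]] z(2) by blast
      have "y \<in> ball (x ((u, p), b)) (r ((u, p), b))"
        using b(2) similarity_image_ball[OF sim[OF z(1)], of "fst b" "snd b"] unfolding z(3) x_def r_def by auto
      moreover have "((u, p), b) \<in> I" using z(1) b(1) by (simp add: I_def)
      ultimately show "y \<in> (\<Union>i\<in>I. ball (x i) (r i))" by blast
    qed
    ultimately obtain B' where B': "ball_cover B' (F v)" "ball_sum t B' \<le> (\<Sum>i\<in>I. r i powr t)"
      using ball_cover_family[of I r "F v" x t] by blast
    note B'(2)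
    also have "(\<Sum>i\<in>I. r i powr t) = (\<Sum>w\<in>Q v. \<Sum>b\<in>B (fst w). r (w, b) powr t)"
      unfolding I_def case_prod_beta using Qv(1) finB uv
      by (subst sum.Sigma) (auto simp: case_prod_beta)
    also have "\<dots> \<le> (\<Sum>w\<in>Q v. scaling (pm (snd w)) powr t * (2 powr t * \<theta> ^ n))"
    proof (rule sum_mono)
      fix w assume "w \<in> Q v"
      then have w: "(fst w, snd w) \<in> Q v" by simp
      have "(\<Sum>b\<in>B (fst w). r (w, b) powr t) = (\<Sum>b\<in>B (fst w). scaling (pm (snd w)) powr t * snd b powr t)"
        using scaling_pos[OF sim[OF w]] posB[OF uv[OF w]]
        by (intro sum.cong) (auto simp: r_def case_prod_beta powr_mult less_imp_le)
      also have "\<dots> = scaling (pm (snd w)) powr t * ball_sum t (B (fst w))"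
        by (simp add: ball_sum_def case_prod_beta sum_distrib_left)
      also have "\<dots> \<le> scaling (pm (snd w)) powr t * (2 powr t * \<theta> ^ n)"
        using B(2)[OF uv[OF w]] by (intro mult_left_mono) auto
      finally show "(\<Sum>b\<in>B (fst w). r (w, b) powr t) \<le> scaling (pm (snd w)) powr t * (2 powr t * \<theta> ^ n)" .
    qed
    also have "\<dots> = (\<Sum>(u, p)\<in>Q v. scaling (pm p) powr t) * (2 powr t * \<theta> ^ n)"
      by (simp add: sum_distrib_right case_prod_beta)
    also have "\<dots> \<le> \<theta> * (2 powr t * \<theta> ^ n)"
      using sum[OF Suc.prems] \<open>0 \<le> \<theta>\<close> by (intro mult_right_mono) auto
    finally have "ball_sum t B' \<le> 2 powr t * \<theta> ^ Suc n" by (simp add: mult_ac)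
    with B'(1) show ?case by blast
  qed
  show ?thesis
    unfolding small_covers_def
  proof (intro allI impI)
    fix \<epsilon> :: real assume "0 < \<epsilon>"
    then obtain n where "\<theta> ^ n < \<epsilon> / 2 powr t"
      using real_arch_pow_inv[of "\<epsilon> / 2 powr t" \<theta>] \<open>\<theta> < 1\<close> by auto
    then have "2 powr t * \<theta> ^ n < \<epsilon>" by (simp add: field_simps)
    then show "\<exists>B. ball_cover B (F v) \<and> ball_sum t B < \<epsilon>"
      using iterate[OF assms(4), of n] by (meson le_less_trans)
  qed
qed

text \<open>
  If one of the sets had measure zero then all would, and each would be covered by finitely many pieces with
  \<open>\<Sum> ratio\<^sup>s < 1\<close>. There are finitely many vertices and finitely many pieces, so by continuity the strict
  inequality persists for all of them at some \<open>t < s\<close>, and the dimension would be at most \<open>t\<close>.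
\<close>

lemma hausdorff_measure_pos:
  assumes "gdwsp G S" and dim: "\<And>v. v \<in> verts G \<Longrightarrow> hausdorff_dim (F v) = s" and v: "v \<in> verts G"
  shows "0 < hausdorff_measure s (F v)"
proof (cases "s = 0")
  case True
  then show ?thesis using hausdorff_measure_zero_pos[OF F_props(1)[OF v]] by simp
next
  case False
  have "0 \<le> s" using hausdorff_dim_nonneg[OF F_props(3)[OF v]] dim[OF v] by simp
  with False have "0 < s" by simp
  show ?thesis
  proof (rule ccontr)
    assume "\<not> 0 < hausdorff_measure s (F v)"
    then have "hausdorff_measure s (F v) = 0" by (simp add: zero_less_iff_neq_zero)
    then have "small_covers s (F v)"
      by (rule small_covers_if_hausdorff_null[OF F_props(2)[OF v] \<open>0 < s\<close>])
    then have "\<forall>u\<in>verts G. \<exists>Q. pieces_cover Q u 1 (F u) \<and> (\<Sum>(w, p)\<in>Q. scaling (pm p) powr s) < 1"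
      using contracting_cover[OF _ assms(1) \<open>0 < s\<close>] small_covers_all_vertices[OF v] by blast
    from bchoice[OF this] obtain Q where Q: "\<And>u. u \<in> verts G \<Longrightarrow> pieces_cover (Q u) u 1 (F u)"
      and less1: "\<And>u. u \<in> verts G \<Longrightarrow> (\<Sum>(w, p)\<in>Q u. scaling (pm p) powr s) < 1"
      by blast
    have "\<forall>\<^sub>F t in at_left s. \<forall>u\<in>verts G. (\<Sum>(w, p)\<in>Q u. scaling (pm p) powr t) < 1"
    proof (intro eventually_ball_finite ballI)
      fix u assume u: "u \<in> verts G"
      have "scaling (pm (snd w)) \<noteq> 0" if "w \<in> Q u" for w
      proof -
        have "awalk (fst w) (snd w) u" using Q[OF u] that by (auto simp: pieces_cover_def)
        then show ?thesis using scaling_pos[OF similarity_walk] by force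
      qed
      then have "((\<lambda>t. \<Sum>w\<in>Q u. scaling (pm (snd w)) powr t) \<longlongrightarrow> (\<Sum>w\<in>Q u. scaling (pm (snd w)) powr s)) (at_left s)"
        by (intro tendsto_sum tendsto_powr tendsto_const tendsto_ident_at) blast
      from order_tendstoD(2)[OF this, of 1] less1[OF u]
      show "\<forall>\<^sub>F t in at_left s. (\<Sum>(w, p)\<in>Q u. scaling (pm p) powr t) < 1"
        by (simp add: case_prod_beta)
    qed simp
    moreover have "\<forall>\<^sub>F t in at_left s. t \<in> {0<..<s}"
      by (rule eventually_at_left_real[OF \<open>0 < s\<close>])
    ultimately have "\<forall>\<^sub>F t in at_left s. (\<forall>u\<in>verts G. (\<Sum>(w, p)\<in>Q u. scaling (pm p) powr t) < 1) \<and> t \<in> {0<..<s}"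
      by (rule eventually_conj)
    then obtain t where t: "0 < t" "t < s" and tsum: "\<And>u. u \<in> verts G \<Longrightarrow> (\<Sum>(w, p)\<in>Q u. scaling (pm p) powr t) < 1"
      using eventually_happens'[OF trivial_limit_at_left_real] by force
    define \<theta> where "\<theta> = Max ((\<lambda>u. \<Sum>(w, p)\<in>Q u. scaling (pm p) powr t) ` verts G)"
    have "\<theta> < 1" unfolding \<theta>_def using v tsum by (subst Max_less_iff) auto
    have "small_covers t (F v)"
    proof (rule small_covers_of_contracting_covers[OF Q _ \<open>\<theta> < 1\<close> v])
      fix u assume "u \<in> verts G"
      then show "(\<Sum>(w, p)\<in>Q u. scaling (pm p) powr t) \<le> \<theta>" unfolding \<theta>_def by (intro Max_ge) auto
    qed
    then have "hausdorff_measure t (F v) = 0" by (rule hausdorff_null_if_small_covers[OF t(1)])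
    then have "hausdorff_dim (F v) \<le> t" using t(1) by (intro hausdorff_dim_le) auto
    then show False using dim[OF v] t(2) by simp
  qed
qed

lemma net_bound:
  assumes dim: "\<And>v. v \<in> verts G \<Longrightarrow> hausdorff_dim (F v) \<le> s"
  obtains K where "0 < K" "\<And>v \<delta>. v \<in> verts G \<Longrightarrow> 0 < \<delta> \<Longrightarrow> \<delta> \<le> 1 \<Longrightarrow>
    \<exists>Z. finite Z \<and> F v \<subseteq> (\<Union>z\<in>Z. ball z \<delta>) \<and> real (card Z) \<le> K * \<delta> powr (- s)"
proof -
  have "\<forall>v\<in>verts G. \<exists>\<rho>. similarity_monoid (loop_maps v) (F v) \<rho>"
    using loop_maps_similarity_monoid by blast
  from bchoice[OF this] obtain \<rho> where \<rho>: "\<And>v. v \<in> verts G \<Longrightarrow> similarity_monoid (loop_maps v) (F v) (\<rho> v)"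
    by blast
  define K where "K = 1 + (\<Sum>v\<in>verts G. (\<rho> v / 2) powr (- s))"
  have "0 < K" unfolding K_def by (intro add_pos_nonneg sum_nonneg) auto
  moreover have "\<exists>Z. finite Z \<and> F v \<subseteq> (\<Union>z\<in>Z. ball z \<delta>) \<and> real (card Z) \<le> K * \<delta> powr (- s)"
    if v: "v \<in> verts G" and \<delta>: "0 < \<delta>" "\<delta> \<le> 1" for v \<delta>
  proof -
    interpret similarity_monoid "loop_maps v" "F v" "\<rho> v" by (rule \<rho>[OF v])
    obtain Z where Z: "finite Z" "Z \<subseteq> F v" "separated \<delta> Z" "F v \<subseteq> (\<Union>z\<in>Z. ball z \<delta>)"
      using separated_net[OF dim[OF v] \<delta> order_refl] by blast
    have "real (card Z) * (\<rho> v * \<delta> / 2) powr s \<le> 1"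
      by (rule card_separated_le[OF dim[OF v] Z(1-3) \<delta>])
    then have "real (card Z) \<le> (\<rho> v * \<delta> / 2) powr (- s)"
      using \<rho>_pos \<delta>(1) by (simp add: powr_minus field_simps)
    also have "\<dots> = (\<rho> v / 2) powr (- s) * \<delta> powr (- s)"
      using \<rho>_pos \<delta>(1) by (subst powr_mult[symmetric]) auto
    also have "\<dots> \<le> K * \<delta> powr (- s)"
    proof (rule mult_right_mono)
      have "(\<rho> v / 2) powr (- s) \<le> (\<Sum>v\<in>verts G. (\<rho> v / 2) powr (- s))"
        using v by (intro member_le_sum) auto
      then show "(\<rho> v / 2) powr (- s) \<le> K" by (simp add: K_def)
    qed simp
    finally show ?thesis using Z(1,4) by blast
  qed
  ultimately show ?thesis by (rule that)
qed

text \<open>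
  A ball of radius \<open>R\<close> meets \<open>F\<^sub>v\<close> in boundedly many pieces of ratio at most \<open>R\<close>, and covering a piece at
  scale \<open>r\<close> amounts to covering some \<open>F\<^sub>u\<close> at scale \<open>r / R\<close>.
\<close>

lemma assouad_exponent_at_dimension:
  assumes "gdwsp G S" and dim: "\<And>v. v \<in> verts G \<Longrightarrow> hausdorff_dim (F v) = s" and v: "v \<in> verts G"
  shows "assouad_exponent s (F v)"
proof -
  obtain M :: nat where
    M: "\<And>v x r. v \<in> verts G \<Longrightarrow> 0 < r \<Longrightarrow> \<exists>Q. card Q \<le> M \<and> pieces_cover Q v r (F v \<inter> ball x r)"
    using finitely_many_pieces[OF assms(1)] by blast
  obtain K where "0 < K" and K: "\<And>v \<delta>. v \<in> verts G \<Longrightarrow> 0 < \<delta> \<Longrightarrow> \<delta> \<le> 1 \<Longrightarrow>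
    \<exists>Z. finite Z \<and> F v \<subseteq> (\<Union>z\<in>Z. ball z \<delta>) \<and> real (card Z) \<le> K * \<delta> powr (- s)"
    using net_bound[of s] dim by (metis order_refl)
  define C where "C = (real M + 1) * (K * 2 powr s)"
  have "0 < C" using \<open>0 < K\<close> by (simp add: C_def)
  have bound: "real (covering_number r (ball x R \<inter> F v)) \<le> C * (R / r) powr s"
    if R: "0 < R" and r: "r \<in> {0<..<R}" for R r x
  proof -
    obtain Q where "card Q \<le> M" and Q: "pieces_cover Q v R (F v \<inter> ball x R)" using M[OF v R] by blast
    have finQ: "finite Q" and QP: "\<And>u p. (u, p) \<in> Q \<Longrightarrow> awalk u p v \<and> scaling (pm p) \<le> R"
      and covQ: "F v \<inter> ball x R \<subseteq> (\<Union>(u, p)\<in>Q. pm p ` F u)"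
      using Q by (auto simp: pieces_cover_def)
    \<comment> \<open>A map of ratio at most \<open>R\<close> sends balls of this radius into balls of radius \<open>r / 2\<close>, whose diameter is \<open>r\<close>.\<close>
    define \<delta> where "\<delta> = r / (2 * R)"
    have \<delta>: "0 < \<delta>" "\<delta> \<le> 1" using R r by (auto simp: \<delta>_def field_simps)
    have "\<forall>u\<in>verts G. \<exists>Z. finite Z \<and> F u \<subseteq> (\<Union>z\<in>Z. ball z \<delta>) \<and> real (card Z) \<le> K * \<delta> powr (- s)"
      using K \<delta> by blast
    from bchoice[OF this] obtain Z where Z: "\<And>u. u \<in> verts G \<Longrightarrow> finite (Z u)"
      "\<And>u. u \<in> verts G \<Longrightarrow> F u \<subseteq> (\<Union>z\<in>Z u. ball z \<delta>)"
      "\<And>u. u \<in> verts G \<Longrightarrow> real (card (Z u)) \<le> K * \<delta> powr (- s)"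
      by blast
    have uv: "fst w \<in> verts G" if "w \<in> Q" for w
      using QP[of "fst w" "snd w"] that by (auto simp: awalk_def)
    define I where "I = Sigma Q (\<lambda>w. Z (fst w))"
    have "finite I" unfolding I_def using finQ Z(1) uv by (intro finite_SigmaI) auto
    have "ball x R \<inter> F v \<subseteq> (\<Union>i\<in>I. ball (pm (snd (fst i)) (snd i)) (r / 2))"
    proof
      fix y assume "y \<in> ball x R \<inter> F v"
      then obtain u p a where a: "(u, p) \<in> Q" "a \<in> F u" "y = pm p a" using covQ by blast
      have u: "u \<in> verts G" using uv[OF a(1)] by simp
      obtain z where z: "z \<in> Z u" "dist z a < \<delta>" using Z(2)[OF u] a(2) by auto
      have "dist (pm p z) y = scaling (pm p) * dist z a"
        unfolding a(3) using QP[OF a(1)] by (intro dist_similarity similarity_walk) blast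
      also have "\<dots> \<le> R * dist z a" using QP[OF a(1)] by (intro mult_right_mono) auto
      also have "\<dots> < R * \<delta>" using z(2) R by simp
      also have "\<dots> = r / 2" using R by (simp add: \<delta>_def)
      finally have "y \<in> ball (pm p z) (r / 2)" by simp
      moreover have "((u, p), z) \<in> I" using a(1) z(1) by (simp add: I_def)
      ultimately show "y \<in> (\<Union>i\<in>I. ball (pm (snd (fst i)) (snd i)) (r / 2))" by force
    qed
    then have "covering_number r (ball x R \<inter> F v) \<le> card I"
      using r by (intro covering_number_le_balls[OF \<open>finite I\<close>]) auto
    then have "real (covering_number r (ball x R \<inter> F v)) \<le> real (card I)" by simp
    also have "\<dots> = (\<Sum>w\<in>Q. real (card (Z (fst w))))"
      unfolding I_def using finQ Z(1) uv by (subst card_SigmaI) auto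
    also have "\<dots> \<le> (\<Sum>w\<in>Q. K * \<delta> powr (- s))" using Z(3) uv by (intro sum_mono) auto
    also have "\<dots> = real (card Q) * (K * \<delta> powr (- s))" by simp
    also have "\<dots> \<le> (real M + 1) * (K * \<delta> powr (- s))"
      using \<open>card Q \<le> M\<close> \<open>0 < K\<close> by (intro mult_right_mono) auto
    also have "\<delta> powr (- s) = (2 * (R / r)) powr s"
    proof -
      have "\<delta> powr (- s) = (inverse \<delta>) powr s" using \<delta>(1) by (simp add: powr_minus inverse_powr)
      also have "inverse \<delta> = 2 * (R / r)" by (simp add: \<delta>_def)
      finally show ?thesis .
    qed
    also have "\<dots> = 2 powr s * (R / r) powr s" by (rule powr_mult)
    also have "(real M + 1) * (K * (2 powr s * (R / r) powr s)) = C * (R / r) powr s" by (simp add: C_def)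
    finally show ?thesis .
  qed
  have "0 \<le> s" using hausdorff_dim_nonneg[OF F_props(3)[OF v]] dim[OF v] by simp
  then show ?thesis unfolding assouad_exponent_def using \<open>0 < C\<close> bound by blast
qed

end

section \<open>The dichotomy\<close>

theorem theorem4p2:
  fixes G :: "('v, 'e) pre_digraph"
    and S :: "'e \<Rightarrow> real \<Rightarrow> real" and c :: "'e \<Rightarrow> real"
    and F :: "'v \<Rightarrow> real set" and s :: real
  assumes "graph_directed_system G S c"
    and "graph_directed_sets G S F"
    and "\<forall>v\<in>verts G. hausdorff_dim (F v) = s"
    and "s < 1"
  shows "(gdwsp G S \<longrightarrow>
            (\<forall>v\<in>verts G. hausdorff_measure s (F v) > 0 \<and>
               assouad_dim (F v) = hausdorff_dim (F v) \<and> hausdorff_dim (F v) = s \<and> s < 1)) \<and>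
         (\<not> gdwsp G S \<longrightarrow> (\<exists>v\<in>verts G. \<not> is_singleton (F v)) \<longrightarrow>
            (\<forall>v\<in>verts G. hausdorff_measure s (F v) = 0 \<and> assouad_dim (F v) = 1))"
proof -
  interpret graph_directed_system G S c by (rule assms(1))
  interpret graph_directed_family G S c F by unfold_locales (rule assms(2))
  have dim: "hausdorff_dim (F v) = s" if "v \<in> verts G" for v using assms(3) that by blast
  show ?thesis
  proof (intro conjI impI ballI)
    fix v assume "gdwsp G S" and v: "v \<in> verts G"
    show "0 < hausdorff_measure s (F v)" by (rule hausdorff_measure_pos[OF \<open>gdwsp G S\<close> dim v])
    show "assouad_dim (F v) = hausdorff_dim (F v)"
      unfolding dim[OF v]
    proof (rule assouad_dim_eqI)
      show "assouad_exponent s (F v)" by (rule assouad_exponent_at_dimension[OF \<open>gdwsp G S\<close> dim v])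
      show "s \<le> t" if "assouad_exponent t (F v)" for t
        using hausdorff_dim_le_assouad_exponent[OF F_props(3)[OF v] that] dim[OF v] by simp
    qed
    show "hausdorff_dim (F v) = s" by (rule dim[OF v])
    show "s < 1" by (rule assms(4))
  next
    fix v assume not: "\<not> gdwsp G S" and "\<exists>u\<in>verts G. \<not> is_singleton (F u)" and v: "v \<in> verts G"
    then have ns: "\<not> is_singleton (F v)" using not_singleton_transfer by blast
    obtain \<rho> where "similarity_monoid (loop_maps v) (F v) \<rho>" using loop_maps_similarity_monoid[OF v] by blast
    then interpret similarity_monoid "loop_maps v" "F v" \<rho> .
    have nc: near_coincidences
      unfolding near_coincidences_def using near_coincidences_if_not_gdwsp[OF v not] by blast
    have le: "hausdorff_dim (F v) \<le> s" using dim[OF v] by simp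
    show "hausdorff_measure s (F v) = 0"
      by (rule hausdorff_null_if_small_covers[OF dim_pos[OF ns le] small_covers_at_dimension[OF ns nc le assms(4)]])
    show "assouad_dim (F v) = 1"
      using assouad_exponent_one one_le_assouad_exponent[OF ns nc] by (rule assouad_dim_eqI)
  qed
qed

end
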